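(* Let $\lambda>0$, $\mu^x>0$ and let $\alpha\in\mathcal S(\mathbb R^+)$ be such that the solution of the uncontrolled equation $\dot x(t)=\lambda-\alpha(t)-x(t)^2$, $x(0)=\mu^x$, diverges to $-\infty$ in finite time on $\mathbb R^+$. Consider the problems $$\textbf{(OCP)}\quad \min_{u\in\mathcal S(\mathbb R^+)}\int_0^\infty u^2(t)\,dt\quad\text{s.t.}\quad \dot x(t)=\lambda-\alpha(t)+u(t)-x^2(t),\ \ x(0)=\mu^x,\ \ \exists M\in\mathbb N:\ x(t)\ge -M\ \ \forall t\ge 0,$$ $$\textbf{(RCP)}\quad \min_{g\in\mathcal S(\mathbb R^+)}\int_0^\infty\big[\alpha(t)-g\big(t\,\mathrm K(\lambda,\alpha,g)\big)\big]^2\,dt ,$$ where $\mathrm K$ is the rate function. Then $g^*\in\mathcal S(\mathbb R^+)$ is an optimal solution of (RCP) if and only if $u^*(t)=\alpha(t)-g^*(t\,\mathrm K(\lambda,\alpha,g^* ))$ is an optimal solution of (OCP).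
   Context: Notation: $\mathbb R^+=[0,\infty)$ and $\mathcal S(\Omega)=L^1(\Omega)\cap L^\infty(\Omega)$. ODE solutions are Carathéodory solutions (locally absolutely continuous, equation holding almost everywhere). For $\lambda>0$, $\alpha\in\mathcal S(\mathbb R)$, $g\in\mathcal S(\mathbb R^+)$ and $\kappa>0$ put $h(t;\kappa)=\alpha(t)$ for $t<0$, $h(t;\kappa)=g(t\kappa)$ for $t\ge0$, and consider $$(x)_\kappa:\qquad\dot x(t)=\lambda-h(t;\kappa)-x(t)^2 ,$$ with $x(t,s,x_0)$ the maximal solution satisfying $x(s,s,x_0)=x_0$. A bounded solution $b:\mathbb R\to\mathbb R$ of $\dot x=f(t,x)$ is hyperbolic if there are $K\ge1,\beta>0$ with either $\exp(\int_s^t f_x(l,b(l))\,dl)\le Ke^{-\beta(t-s)}$ for all $t\ge s$ (attractive) or $\exp(\int_s^t f_x(l,b(l))\,dl)\le Ke^{\beta(t-s)}$ for all $t\le s$ (repelling). It is known that there is a maximal solution $\mathfrak a^x$ (pullback attractor), defined on $\mathbb R$ or a half-line $(-\infty,t_f)$, bounded above, such that $x(t,s,x_0)$ stays bounded as $t\to-\infty$ iff $x_0\le\mathfrak a^x(s)$, and a maximal solution $\mathfrak r^x$, defined on $\mathbb R$ or a half-line $(t_0,\infty)$, bounded below, such that $x(t,s,x_0)$ stays bounded as $t\to\infty$ iff $x_0\ge\mathfrak r^x(s)$; and exactly one of the following holds. Case A: $\mathfrak a^x,\mathfrak r^x$ are globally defined and hyperbolic (attractive, resp. repelling), $\mathfrak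 a^x\to\sqrt\lambda$ and $\mathfrak r^x\to-\sqrt\lambda$ as $t\to\pm\infty$. Case B: there are no hyperbolic solutions, $\mathfrak a^x=\mathfrak r^x$ is the only bounded solution, $\mathfrak a^x\to\sqrt\lambda$ as $t\to-\infty$ and $\mathfrak a^x\to-\sqrt\lambda$ as $t\to\infty$. Case C: there are no globally defined solutions, and $\mathfrak a^x\to-\infty$, $\mathfrak r^x\to\infty$ at finite times. Rate function: for $\alpha$ with $\mathfrak a^x(0)>0$ (this value depends only on $\lambda$ and $\alpha|_{(-\infty,0)}$) and $g\in\mathcal S(\mathbb R^+)$, if there is $\kappa_1>0$ such that $(x)_{\kappa_1}$ is in Case C, then there is a unique $\bar\kappa=\bar\kappa(\lambda,\alpha,g)>0$ such that $(x)_\kappa$ is in Case A for $\kappa>\bar\kappa$, in Case B for $\kappa=\bar\kappa$ and in Case C for $0<\kappa<\bar\kappa$; define $\mathrm K(\lambda,\alpha,g)=\bar\kappa$. If no such $\kappa_1$ exists, define $\mathrm K(\lambda,\alpha,g)=1$. Convention linking initial value problems with the pullback attractor: a forcing $\alpha$ given on $\mathbb R^+$ is extended to an element of $\mathcal S(\mathbb R)$ such that the pullback attractor satisfies $\mathfrak a^x(0)=\mu^x$; then for $t\ge0$ the trajectory with $x(0)=\mu^x$ coincides with $\mathfrak a^x$. The value $\mathrm K(\lambda,\alpha,g)$ does not depend on the choice of such an extension. *)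

theory Defs
  imports "HOL-Analysis.Analysis"
begin

text \<open>Elements of L1 and L-infinity are represented by functions on the whole real line;
  their values outside \<open>\<Omega>\<close> are irrelevant.\<close>

definition L1_Linf :: "real set \<Rightarrow> (real \<Rightarrow> real) set" where
  "L1_Linf \<Omega> = {f. integrable (lebesgue_on \<Omega>) f \<and> (\<exists>C. AE t in lebesgue_on \<Omega>. \<bar>f t\<bar> \<le> C)}"

definition abs_cont_on :: "real set \<Rightarrow> (real \<Rightarrow> real) \<Rightarrow> bool" where
  "abs_cont_on S x \<longleftrightarrow> (\<forall>\<epsilon>>0. \<exists>\<delta>>0. \<forall>D T. D division_of T \<and> T \<subseteq> S \<and> (\<Sum>k\<in>D. measure lborel k) < \<delta>
      \<longrightarrow> (\<Sum>k\<in>D. \<bar>x (Sup k) - x (Inf k)\<bar>) < \<epsilon>)"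

definition loc_abs_cont_on :: "real set \<Rightarrow> (real \<Rightarrow> real) \<Rightarrow> bool" where
  "loc_abs_cont_on S x \<longleftrightarrow> (\<forall>a b. {a..b} \<subseteq> S \<longrightarrow> abs_cont_on {a..b} x)"

text \<open>Caratheodory solutions of \<open>x' = f t x\<close> on an interval \<open>I\<close>, which need not be open.\<close>

definition solves_on :: "(real \<Rightarrow> real \<Rightarrow> real) \<Rightarrow> real set \<Rightarrow> (real \<Rightarrow> real) \<Rightarrow> bool" where
  "solves_on f I x \<longleftrightarrow> is_interval I \<and> loc_abs_cont_on I x \<and>
     (AE t in lebesgue_on I. (x has_real_derivative f t (x t)) (at t within I))"

definition maximal_solution :: "(real \<Rightarrow> real \<Rightarrow> real) \<Rightarrow> real set \<Rightarrow> (real \<Rightarrow> real) \<Rightarrow> bool" where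
  "maximal_solution f I x \<longleftrightarrow> open I \<and> I \<noteq> {} \<and> solves_on f I x \<and>
     (\<forall>J y. open J \<and> I \<subseteq> J \<and> solves_on f J y \<and> (\<forall>t\<in>I. y t = x t) \<longrightarrow> J = I)"

definition bounded_at_minus_infinity :: "(real \<Rightarrow> real \<Rightarrow> real) \<Rightarrow> real \<Rightarrow> real \<Rightarrow> bool" where
  "bounded_at_minus_infinity f s x0 \<longleftrightarrow>
     (\<exists>I x. maximal_solution f I x \<and> {..s} \<subseteq> I \<and> x s = x0 \<and> bounded (x ` {..s}))"

definition bounded_at_plus_infinity :: "(real \<Rightarrow> real \<Rightarrow> real) \<Rightarrow> real \<Rightarrow> real \<Rightarrow> bool" where
  "bounded_at_plus_infinity f s x0 \<longleftrightarrow>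
     (\<exists>I x. maximal_solution f I x \<and> {s..} \<subseteq> I \<and> x s = x0 \<and> bounded (x ` {s..}))"

definition pullback_attractor :: "(real \<Rightarrow> real \<Rightarrow> real) \<Rightarrow> real set \<Rightarrow> (real \<Rightarrow> real) \<Rightarrow> bool" where
  "pullback_attractor f I a \<longleftrightarrow> maximal_solution f I a \<and> (I = UNIV \<or> (\<exists>tf. I = {..<tf})) \<and>
     bdd_above (a ` I) \<and> (\<forall>s\<in>I. \<forall>x0. bounded_at_minus_infinity f s x0 \<longleftrightarrow> x0 \<le> a s)"

definition pullback_repeller :: "(real \<Rightarrow> real \<Rightarrow> real) \<Rightarrow> real set \<Rightarrow> (real \<Rightarrow> real) \<Rightarrow> bool" where
  "pullback_repeller f I r \<longleftrightarrow> maximal_solution f I r \<and> (I = UNIV \<or> (\<exists>t0. I = {t0<..})) \<and>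
     bdd_below (r ` I) \<and> (\<forall>s\<in>I. \<forall>x0. bounded_at_plus_infinity f s x0 \<longleftrightarrow> r s \<le> x0)"

definition bounded_solution :: "(real \<Rightarrow> real \<Rightarrow> real) \<Rightarrow> (real \<Rightarrow> real) \<Rightarrow> bool" where
  "bounded_solution f b \<longleftrightarrow> solves_on f UNIV b \<and> bounded (range b)"

text \<open>\<open>deriv (f l) (b l)\<close> is the partial derivative of \<open>f\<close> in the state variable along \<open>b\<close>.
  The interval integral is oriented, so it changes sign for \<open>t \<le> s\<close>.\<close>

definition hyperbolic_attractive :: "(real \<Rightarrow> real \<Rightarrow> real) \<Rightarrow> (real \<Rightarrow> real) \<Rightarrow> bool" where
  "hyperbolic_attractive f b \<longleftrightarrow> bounded_solution f b \<and>
     (\<exists>K \<beta>. K \<ge> 1 \<and> \<beta> > 0 \<and>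
       (\<forall>s t. s \<le> t \<longrightarrow>
         exp (LBINT l=ereal s..ereal t. deriv (f l) (b l)) \<le> K * exp (- \<beta> * (t - s))))"

definition hyperbolic_repelling :: "(real \<Rightarrow> real \<Rightarrow> real) \<Rightarrow> (real \<Rightarrow> real) \<Rightarrow> bool" where
  "hyperbolic_repelling f b \<longleftrightarrow> bounded_solution f b \<and>
     (\<exists>K \<beta>. K \<ge> 1 \<and> \<beta> > 0 \<and>
       (\<forall>s t. t \<le> s \<longrightarrow>
         exp (LBINT l=ereal s..ereal t. deriv (f l) (b l)) \<le> K * exp (\<beta> * (t - s))))"

definition hyperbolic :: "(real \<Rightarrow> real \<Rightarrow> real) \<Rightarrow> (real \<Rightarrow> real) \<Rightarrow> bool" where
  "hyperbolic f b \<longleftrightarrow> hyperbolic_attractive f b \<or> hyperbolic_repelling f b"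

definition riccati :: "real \<Rightarrow> (real \<Rightarrow> real) \<Rightarrow> real \<Rightarrow> real \<Rightarrow> real" where
  "riccati lam h t x = lam - h t - x\<^sup>2"

definition case_A :: "real \<Rightarrow> (real \<Rightarrow> real) \<Rightarrow> bool" where
  "case_A lam h \<longleftrightarrow> (\<exists>a r.
     pullback_attractor (riccati lam h) UNIV a \<and> pullback_repeller (riccati lam h) UNIV r \<and>
     hyperbolic_attractive (riccati lam h) a \<and> hyperbolic_repelling (riccati lam h) r \<and>
     (a \<longlongrightarrow> sqrt lam) at_bot \<and> (a \<longlongrightarrow> sqrt lam) at_top \<and>
     (r \<longlongrightarrow> - sqrt lam) at_bot \<and> (r \<longlongrightarrow> - sqrt lam) at_top)"

definition case_B :: "real \<Rightarrow> (real \<Rightarrow> real) \<Rightarrow> bool" where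
  "case_B lam h \<longleftrightarrow> (\<nexists>b. hyperbolic (riccati lam h) b) \<and> (\<exists>a.
     pullback_attractor (riccati lam h) UNIV a \<and> pullback_repeller (riccati lam h) UNIV a \<and>
     (\<forall>b. bounded_solution (riccati lam h) b \<longleftrightarrow> b = a) \<and>
     (a \<longlongrightarrow> sqrt lam) at_bot \<and> (a \<longlongrightarrow> - sqrt lam) at_top)"

definition case_C :: "real \<Rightarrow> (real \<Rightarrow> real) \<Rightarrow> bool" where
  "case_C lam h \<longleftrightarrow> (\<nexists>x. solves_on (riccati lam h) UNIV x) \<and>
     (\<exists>a tf. pullback_attractor (riccati lam h) {..<tf} a \<and> filterlim a at_bot (at_left tf)) \<and>
     (\<exists>r t0. pullback_repeller (riccati lam h) {t0<..} r \<and> filterlim r at_top (at_right t0))"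

definition forcing :: "(real \<Rightarrow> real) \<Rightarrow> (real \<Rightarrow> real) \<Rightarrow> real \<Rightarrow> real \<Rightarrow> real" where
  "forcing \<alpha> g \<kappa> t = (if t < 0 then \<alpha> t else g (t * \<kappa>))"

text \<open>Meaningful for \<open>lam > 0\<close>, \<open>\<alpha> \<in> L1_Linf UNIV\<close> with pullback attractor positive at 0, and
  \<open>g \<in> L1_Linf {0..}\<close>; only the values of \<open>\<alpha>\<close> on the negative half-line enter.\<close>

definition rate_function :: "real \<Rightarrow> (real \<Rightarrow> real) \<Rightarrow> (real \<Rightarrow> real) \<Rightarrow> real" where
  "rate_function lam \<alpha> g =
     (if \<exists>\<kappa>\<^sub>1>0. case_C lam (forcing \<alpha> g \<kappa>\<^sub>1)
      then THE \<kappa>. \<kappa> > 0 \<and> (\<forall>\<kappa>'>\<kappa>. case_A lam (forcing \<alpha> g \<kappa>')) \<and> case_B lam (forcing \<alpha> g \<kappa>) \<and>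
             (\<forall>\<kappa>'. 0 < \<kappa>' \<and> \<kappa>' < \<kappa> \<longrightarrow> case_C lam (forcing \<alpha> g \<kappa>'))
      else 1)"

text \<open>A forcing \<open>\<alpha>\<close> on the positive half-line together with the initial value \<open>\<mu>\<close> at time 0 is encoded by an
  extension \<open>\<alpha>e\<close> to the real line whose pullback attractor takes the value \<open>\<mu>\<close> at 0.\<close>

definition admissible_extension ::
    "real \<Rightarrow> real \<Rightarrow> (real \<Rightarrow> real) \<Rightarrow> (real \<Rightarrow> real) \<Rightarrow> bool" where
  "admissible_extension lam \<mu> \<alpha> \<alpha>e \<longleftrightarrow> \<alpha>e \<in> L1_Linf UNIV \<and> (\<forall>t\<ge>0. \<alpha>e t = \<alpha> t) \<and>
     (\<exists>I a. pullback_attractor (riccati lam \<alpha>e) I a \<and> 0 \<in> I \<and> a 0 = \<mu>)"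

definition ocp_admissible :: "real \<Rightarrow> real \<Rightarrow> (real \<Rightarrow> real) \<Rightarrow> (real \<Rightarrow> real) \<Rightarrow> bool" where
  "ocp_admissible lam \<mu> \<alpha> u \<longleftrightarrow> u \<in> L1_Linf {0..} \<and>
     (\<exists>x. solves_on (\<lambda>t x. lam - \<alpha> t + u t - x\<^sup>2) {0..} x \<and> x 0 = \<mu> \<and>
          (\<exists>M::nat. \<forall>t\<ge>0. x t \<ge> - real M))"

definition ocp_optimal :: "real \<Rightarrow> real \<Rightarrow> (real \<Rightarrow> real) \<Rightarrow> (real \<Rightarrow> real) \<Rightarrow> bool" where
  "ocp_optimal lam \<mu> \<alpha> =
     is_arg_min (\<lambda>u. \<integral>t. (u t)\<^sup>2 \<partial>lebesgue_on {0..}) (ocp_admissible lam \<mu> \<alpha>)"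

definition rcp_optimal :: "real \<Rightarrow> (real \<Rightarrow> real) \<Rightarrow> (real \<Rightarrow> real) \<Rightarrow> (real \<Rightarrow> real) \<Rightarrow> bool" where
  "rcp_optimal lam \<alpha> \<alpha>e =
     is_arg_min (\<lambda>g. \<integral>t. (\<alpha> t - g (t * rate_function lam \<alpha>e g))\<^sup>2 \<partial>lebesgue_on {0..})
       (\<lambda>g. g \<in> L1_Linf {0..})"

end

theory Submission
  imports Defs
begin

text \<open>
  Every control admissible for the optimal control problem can be scaled down to the
  critical size without increasing its cost, and a control of critical size is described in the
  regularised problem by a \<open>g\<close> with rate 1.

  In one direction, for any \<open>g\<close> the equation with forcing \<open>g (t K)\<close>, where \<open>K\<close> is the rate of \<open>g\<close>, is not
  in Case C. So the solution through \<open>(0, \<mu>)\<close> exists and is bounded on the positive half-line, and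
  \<open>u t = \<alpha> t - g (t K)\<close> is admissible (\<open>feedback_admissible\<close>), with the cost of \<open>g\<close>. Conversely, let
  \<open>u\<close> be admissible. The solution for the control \<open>s u\<close> blows up for \<open>s = 0\<close> and exists for all
  future times for \<open>s = 1\<close>. At the smallest \<open>s\<close> for which it exists, the equation with forcing
  \<open>\<alpha> - s u\<close> is in Case B, hence \<open>\<alpha> - s u\<close> has rate 1 and cost \<open>s\<^sup>2\<close> times that of \<open>u\<close>
  (\<open>scaled_control\<close>). So the two problems have the same infimum, and the equivalence follows.

  All this rests on the theory of the scalar Riccati equation, which is developed first. If \<open>H\<close> is a
  primitive of the forcing \<open>h\<close>, then \<open>x\<close> is a Caratheodory solution exactly if \<open>x + H\<close> is
  differentiable everywhere with derivative \<open>lam - x\<^sup>2\<close> (\<open>solves_on_riccati_iff\<close>), and the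
  substitution \<open>x + H = p / y\<close> leads to a linear system. A solution exists on an interval exactly if
  \<open>y\<close> has no zero there (\<open>sol_exists_iff\<close>); this gives maximal solutions, the attainment of the
  extremal bounded solutions, and continuous dependence. Each solution which exists
  for all future times tends to \<open>sqrt lam\<close> or \<open>- sqrt lam\<close> (\<open>sol_asymptotic_top\<close>), and the limit of
  the solution through \<open>(0, \<mu>)\<close>, or its blow-up, decides between the three cases (\<open>cases_of_future\<close>). Survival is monotone in the rate
  (\<open>survives_faster\<close>). Blow-up and convergence to \<open>sqrt lam\<close> are open conditions, so that the first
  survivor in a continuous family is in Case B (\<open>critical_parameter\<close>); this yields the critical
  rate and the critical \<open>s\<close> above.\<close>

section \<open>Absolute continuity and primitives\<close>

lemma AE_lebesgue_on_iff_negligible: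
  assumes "I \<in> sets lebesgue"
  shows "(AE t in lebesgue_on I. P t) \<longleftrightarrow> (\<exists>N. negligible N \<and> (\<forall>t\<in>I - N. P t))"
proof -
  have "(AE t in lebesgue_on I. P t) \<longleftrightarrow> (AE t in lebesgue. t \<in> I \<longrightarrow> P t)"
    using assms by (subst AE_restrict_space_iff) auto
  also have "\<dots> \<longleftrightarrow> (\<exists>N\<in>null_sets lebesgue. {t. \<not> (t \<in> I \<longrightarrow> P t)} \<subseteq> N)"
    by (simp add: eventually_ae_filter)
  also have "\<dots> \<longleftrightarrow> (\<exists>N. negligible N \<and> (\<forall>t\<in>I - N. P t))"
    unfolding negligible_iff_null_sets by blast
  finally show ?thesis .
qed

lemma is_interval_lebesgue:
  fixes I :: "real set"
  assumes "is_interval I"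
  shows "I \<in> sets lebesgue"
proof -
  have "negligible (frontier I)"
    using assms by (simp add: is_interval_convex_1 negligible_convex_frontier)
  then have "negligible (I - interior I)"
    by (rule negligible_subset) (use closure_subset in \<open>auto simp: frontier_def\<close>)
  then have "interior I \<union> (I - interior I) \<in> sets lebesgue"
    using negligible_imp_sets by (intro sets.Un) auto
  moreover have "interior I \<union> (I - interior I) = I" using interior_subset by auto
  ultimately show ?thesis by simp
qed

lemma interval_neighbourhood:
  fixes I :: "real set"
  assumes "is_interval I" "t \<in> I"
  obtains a b where "a \<le> t" "t \<le> b" "{a..b} \<subseteq> I" "at t within {a..b} = at t within I"
proof -
  obtain a S where a: "a \<in> I" "a \<le> t" "open S" "t \<in> S" "I \<inter> S \<subseteq> {a..}"
  proof (cases "\<exists>a\<in>I. a < t")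
    case True
    then obtain a where "a \<in> I" "a < t" by blast
    then show ?thesis by (intro that[of a "{a<..}"]) auto
  next
    case False
    then show ?thesis using assms by (intro that[of t UNIV]) force+
  qed
  obtain b U where b: "b \<in> I" "t \<le> b" "open U" "t \<in> U" "I \<inter> U \<subseteq> {..b}"
  proof (cases "\<exists>b\<in>I. t < b")
    case True
    then obtain b where "b \<in> I" "t < b" by blast
    then show ?thesis by (intro that[of b "{..<b}"]) auto
  next
    case False
    then show ?thesis using assms by (intro that[of t UNIV]) force+
  qed
  have sub: "{a..b} \<subseteq> I"
    using assms(1) a(1) b(1) unfolding is_interval_1 by (meson atLeastAtMost_iff subsetI)
  have "at t within {a..b} = at t within I"
  proof (rule at_within_nhd[of t "S \<inter> U"])
    show "{a..b} \<inter> (S \<inter> U) - {t} = I \<inter> (S \<inter> U) - {t}"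
      using sub a(5) b(5) by auto
  qed (use a b in auto)
  then show ?thesis using that a b sub by blast
qed

lemma abs_cont_on_subset: "abs_cont_on S f \<Longrightarrow> T \<subseteq> S \<Longrightarrow> abs_cont_on T f"
  unfolding abs_cont_on_def by (meson order_trans)

lemma abs_cont_on_lipschitz:
  assumes "\<And>s t. s \<in> S \<Longrightarrow> t \<in> S \<Longrightarrow> \<bar>f s - f t\<bar> \<le> C * \<bar>s - t\<bar>"
  shows "abs_cont_on S f"
  unfolding abs_cont_on_def
proof (intro allI impI)
  fix e :: real
  assume "e > 0"
  define B where "B = max C 0 + 1"
  have B: "B > 0" "C \<le> B" unfolding B_def by auto
  show "\<exists>\<delta>>0. \<forall>D T. D division_of T \<and> T \<subseteq> S \<and> (\<Sum>k\<in>D. measure lborel k) < \<delta>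
      \<longrightarrow> (\<Sum>k\<in>D. \<bar>f (Sup k) - f (Inf k)\<bar>) < e"
  proof (intro exI[of _ "e / B"] conjI allI impI)
    show "e / B > 0" using \<open>e > 0\<close> B by simp
    fix D T
    assume *: "D division_of T \<and> T \<subseteq> S \<and> (\<Sum>k\<in>D. measure lborel k) < e / B"
    have "(\<Sum>k\<in>D. \<bar>f (Sup k) - f (Inf k)\<bar>) \<le> (\<Sum>k\<in>D. B * measure lborel k)"
    proof (rule sum_mono)
      fix k assume k: "k \<in> D"
      obtain u v where uv: "k = cbox u v" using * k division_ofD(4) by blast
      have ne: "k \<noteq> {}" using * k division_ofD(3) by blast
      have kS: "k \<subseteq> S" using * k division_ofD(2) by blast
      have "u \<le> v" using uv ne by simp
      then have "\<bar>f (Sup k) - f (Inf k)\<bar> \<le> C * \<bar>v - u\<bar>"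
        using assms[of v u] kS uv by (simp add: subset_iff)
      also have "\<dots> \<le> B * \<bar>v - u\<bar>" using B by (simp add: mult_right_mono)
      also have "\<dots> = B * measure lborel k" using \<open>u \<le> v\<close> uv by simp
      finally show "\<bar>f (Sup k) - f (Inf k)\<bar> \<le> B * measure lborel k" .
    qed
    also have "\<dots> = B * (\<Sum>k\<in>D. measure lborel k)" by (simp add: sum_distrib_left)
    also have "\<dots> < B * (e / B)" using * B by (intro mult_strict_left_mono) auto
    finally show "(\<Sum>k\<in>D. \<bar>f (Sup k) - f (Inf k)\<bar>) < e" using B by simp
  qed
qed

lemma abs_cont_on_diff:
  assumes "abs_cont_on S f" "abs_cont_on S g"
  shows "abs_cont_on S (\<lambda>t. f t - g t)"
  unfolding abs_cont_on_def
proof (intro allI impI)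
  fix e :: real
  assume "e > 0"
  then have "e / 2 > 0" by simp
  obtain d1 where d1: "d1 > 0" "\<And>D T. D division_of T \<Longrightarrow> T \<subseteq> S \<Longrightarrow> (\<Sum>k\<in>D. measure lborel k) < d1
      \<Longrightarrow> (\<Sum>k\<in>D. \<bar>f (Sup k) - f (Inf k)\<bar>) < e / 2"
    using assms(1) \<open>e / 2 > 0\<close> unfolding abs_cont_on_def by meson
  obtain d2 where d2: "d2 > 0" "\<And>D T. D division_of T \<Longrightarrow> T \<subseteq> S \<Longrightarrow> (\<Sum>k\<in>D. measure lborel k) < d2
      \<Longrightarrow> (\<Sum>k\<in>D. \<bar>g (Sup k) - g (Inf k)\<bar>) < e / 2"
    using assms(2) \<open>e / 2 > 0\<close> unfolding abs_cont_on_def by meson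
  show "\<exists>\<delta>>0. \<forall>D T. D division_of T \<and> T \<subseteq> S \<and> (\<Sum>k\<in>D. measure lborel k) < \<delta>
      \<longrightarrow> (\<Sum>k\<in>D. \<bar>(f (Sup k) - g (Sup k)) - (f (Inf k) - g (Inf k))\<bar>) < e"
  proof (intro exI[of _ "min d1 d2"] conjI allI impI)
    show "min d1 d2 > 0" using d1 d2 by simp
    fix D T
    assume *: "D division_of T \<and> T \<subseteq> S \<and> (\<Sum>k\<in>D. measure lborel k) < min d1 d2"
    have "(\<Sum>k\<in>D. \<bar>(f (Sup k) - g (Sup k)) - (f (Inf k) - g (Inf k))\<bar>) \<le>
      (\<Sum>k\<in>D. \<bar>f (Sup k) - f (Inf k)\<bar> + \<bar>g (Sup k) - g (Inf k)\<bar>)"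
      by (rule sum_mono) arith
    also have "\<dots> = (\<Sum>k\<in>D. \<bar>f (Sup k) - f (Inf k)\<bar>) + (\<Sum>k\<in>D. \<bar>g (Sup k) - g (Inf k)\<bar>)"
      by (rule sum.distrib)
    also have "\<dots> < e" using d1(2)[of D T] d2(2)[of D T] * by auto
    finally show "(\<Sum>k\<in>D. \<bar>(f (Sup k) - g (Sup k)) - (f (Inf k) - g (Inf k))\<bar>) < e" .
  qed
qed

lemma abs_cont_on_imp_continuous_on:
  assumes "abs_cont_on {a..b} f"
  shows "continuous_on {a..b} f"
  unfolding continuous_on_iff
proof (intro ballI allI impI)
  fix t and e :: real
  assume t: "t \<in> {a..b}" and "e > 0"
  obtain d where d: "d > 0" "\<And>D T. D division_of T \<Longrightarrow> T \<subseteq> {a..b} \<Longrightarrow> (\<Sum>k\<in>D. measure lborel k) < d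
      \<Longrightarrow> (\<Sum>k\<in>D. \<bar>f (Sup k) - f (Inf k)\<bar>) < e"
    using assms \<open>e > 0\<close> unfolding abs_cont_on_def by meson
  have *: "\<bar>f v - f u\<bar> < e" if "u \<in> {a..b}" "v \<in> {a..b}" "u \<le> v" "v - u < d" for u v
  proof -
    have "{{u..v}} division_of {u..v}"
      using that division_of_self[of u v] by (simp add: box_real)
    from d(2)[OF this] that show ?thesis by auto
  qed
  show "\<exists>d>0. \<forall>s\<in>{a..b}. dist s t < d \<longrightarrow> dist (f s) (f t) < e"
  proof (intro exI[of _ d] conjI ballI impI)
    fix s assume "s \<in> {a..b}" "dist s t < d"
    then show "dist (f s) (f t) < e"
      using *[of s t] *[of t s] t by (cases "s \<le> t") (auto simp: dist_real_def abs_minus_commute)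
  qed (rule d)
qed

text \<open>An absolutely continuous function with derivative zero almost everywhere is constant. A tagged
  division is chosen fine for a gauge which forces the increments at the good tags to be small, and
  the intervals at the bad tags into an open set of small measure.\<close>

lemma abs_cont_on_zero_derivative:
  assumes ac: "abs_cont_on {a..b} f" and "a \<le> b" and N: "negligible N"
    and der: "\<And>t. t \<in> {a..b} - N \<Longrightarrow> (f has_real_derivative 0) (at t within {a..b})"
  shows "f b = f a"
proof -
  have "\<bar>f b - f a\<bar> \<le> 0 + e" if "e > 0" for e
  proof -
    define e1 where "e1 = e / (2 * (b - a + 1))"
    have e1: "e1 > 0" "e1 * (b - a) \<le> e / 2"
      using \<open>e > 0\<close> \<open>a \<le> b\<close> by (auto simp: e1_def field_simps)
    have "e / 2 > 0" using \<open>e > 0\<close> by simp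
    then obtain d where d: "d > 0" "\<And>D T. D division_of T \<Longrightarrow> T \<subseteq> {a..b} \<Longrightarrow> (\<Sum>k\<in>D. measure lborel k) < d
      \<Longrightarrow> (\<Sum>k\<in>D. \<bar>f (Sup k) - f (Inf k)\<bar>) < e / 2"
      using ac unfolding abs_cont_on_def by meson
    obtain U where U: "open U" "N \<subseteq> U" "U \<in> lmeasurable" "measure lebesgue U < d"
    proof -
      have N0: "N \<in> lmeasurable" "measure lebesgue N = 0"
        using N by (auto simp: negligible_imp_measurable negligible_imp_measure0)
      obtain U where "open U" "N \<subseteq> U" "U - N \<in> lmeasurable" "emeasure lebesgue (U - N) < ennreal d"
        using sets_lebesgue_outer_open[OF fmeasurableD[OF N0(1)] d(1)] by blast
      moreover have U2: "U \<in> lmeasurable"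
        using fmeasurable.Un[OF N0(1) calculation(3)] calculation(2) by (simp add: Un_absorb1)
      moreover have "measure lebesgue U = measure lebesgue (U - N)"
        using N by (metis N0(1) N0(2) calculation(2,3) U2 diff_zero measurable_measure_Diff fmeasurableD)
      moreover have "measure lebesgue (U - N) < d"
        using calculation(3,4) d(1) by (simp add: emeasure_eq_measure2 ennreal_less_iff)
      ultimately show ?thesis using that by auto
    qed
    have "\<exists>r>0. \<forall>v\<in>{a..b}. \<bar>v - t\<bar> < r \<longrightarrow> \<bar>f v - f t\<bar> \<le> e1 * \<bar>v - t\<bar>" if "t \<in> {a..b} - N" for t
      using der[OF that] e1(1) unfolding has_field_derivative_def has_derivative_within_alt
      by (fastforce simp: norm_mult)
    then obtain r where r: "\<And>t. t \<in> {a..b} - N \<Longrightarrow> r t > 0"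
      "\<And>t v. t \<in> {a..b} - N \<Longrightarrow> v \<in> {a..b} \<Longrightarrow> \<bar>v - t\<bar> < r t \<Longrightarrow> \<bar>f v - f t\<bar> \<le> e1 * \<bar>v - t\<bar>"
      by metis
    define \<gamma> where "\<gamma> t = (if t \<in> N then U else if t \<in> {a..b} then ball t (r t) else ball t 1)" for t
    have "gauge \<gamma>"
      using U r unfolding gauge_def \<gamma>_def by auto
    then obtain p where p: "p tagged_division_of {a..b}" "\<gamma> fine p"
      using fine_division_exists_real by blast
    then have "finite p" by blast
    define q where "q = {(t,k) \<in> p. t \<in> N}"
    have q: "q \<subseteq> p" "finite q" "finite (p - q)" using \<open>finite p\<close> by (auto simp: q_def intro: finite_subset)
    have pD: "\<exists>u v. k = {u..v} \<and> u \<le> t \<and> t \<le> v \<and> a \<le> u \<and> v \<le> b" if "(t,k) \<in> p" for t k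
      using tagged_division_ofD(2,3,4)[OF p(1) that] by (auto simp: box_real)
    have sumf: "f b - f a = (\<Sum>(t,k)\<in>p. f (Sup k) - f (Inf k))"
      using additive_tagged_division_1[OF \<open>a \<le> b\<close> p(1), of f] by simp
    have good: "(\<Sum>(t,k)\<in>p - q. \<bar>f (Sup k) - f (Inf k)\<bar>) \<le> e / 2"
    proof -
      have "(\<Sum>(t,k)\<in>p - q. \<bar>f (Sup k) - f (Inf k)\<bar>) \<le> (\<Sum>(t,k)\<in>p - q. e1 * measure lborel k)"
      proof (rule sum_mono, clarify)
        fix t k assume tk: "(t,k) \<in> p" "(t,k) \<notin> q"
        obtain u v where uv: "k = {u..v}" "u \<le> t" "t \<le> v" "a \<le> u" "v \<le> b" using pD[OF tk(1)] by blast
        have tN: "t \<notin> N" using tk by (auto simp: q_def)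
        have tab: "t \<in> {a..b} - N" using uv tN by auto
        have "k \<subseteq> ball t (r t)" using fineD[OF p(2) tk(1)] tN tab by (simp add: \<gamma>_def)
        moreover have "u \<in> k" "v \<in> k" using uv by auto
        ultimately have "u \<in> ball t (r t)" "v \<in> ball t (r t)" by blast+
        then have uvr: "\<bar>u - t\<bar> < r t" "\<bar>v - t\<bar> < r t" by (auto simp: dist_real_def)
        have "\<bar>f u - f t\<bar> \<le> e1 * \<bar>u - t\<bar>" "\<bar>f v - f t\<bar> \<le> e1 * \<bar>v - t\<bar>"
          using r(2)[OF tab _ uvr(1)] r(2)[OF tab _ uvr(2)] uv by auto
        then have "\<bar>f v - f u\<bar> \<le> e1 * \<bar>v - t\<bar> + e1 * \<bar>u - t\<bar>" by linarith
        also have "\<dots> = e1 * (v - u)" using uv by (simp add: algebra_simps)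
        finally show "\<bar>f (Sup k) - f (Inf k)\<bar> \<le> e1 * measure lborel k" using uv by simp
      qed
      also have "\<dots> \<le> (\<Sum>(t,k)\<in>p. e1 * measure lborel k)"
        using e1 \<open>finite p\<close> by (intro sum_mono2) auto
      also have "\<dots> = e1 * (\<Sum>(t,k)\<in>p. measure lborel k)" by (simp add: sum_distrib_left split_def)
      also have "\<dots> = e1 * (b - a)"
        using additive_content_tagged_division[of p a b] p(1) \<open>a \<le> b\<close> by (simp add: box_real)
      finally show ?thesis using e1 by simp
    qed
    have bad: "(\<Sum>(t,k)\<in>q. \<bar>f (Sup k) - f (Inf k)\<bar>) < e / 2"
    proof -
      have "q tagged_partial_division_of {a..b}"
        using p(1) q(1) by (meson tagged_division_of_def tagged_partial_division_subset)
      then have qt: "q tagged_division_of \<Union>(snd ` q)" by (rule tagged_partial_division_of_Union_self)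
      have D: "snd ` q division_of \<Union>(snd ` q)" by (rule division_of_tagged_division[OF qt])
      define \<phi> where "\<phi> k = (if k = {} then 0 else \<bar>f (Sup k) - f (Inf k)\<bar>)" for k
      have "(\<Sum>(t,k)\<in>q. \<bar>f (Sup k) - f (Inf k)\<bar>) = (\<Sum>(t,k)\<in>q. \<phi> k)"
        using pD q(1) by (intro sum.cong refl) (fastforce simp: \<phi>_def)
      also have "\<dots> = (\<Sum>k\<in>snd ` q. \<phi> k)"
      proof (rule sum.over_tagged_division_lemma[OF qt])
        fix u v :: real assume "box u v = {}"
        then have "cbox u v = {} \<or> u = v" by (auto simp: box_real)
        then show "\<phi> (cbox u v) = 0" by (auto simp: \<phi>_def)
      qed
      also have "\<dots> = (\<Sum>k\<in>snd ` q. \<bar>f (Sup k) - f (Inf k)\<bar>)"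
        using division_ofD(3)[OF D] by (intro sum.cong refl) (auto simp: \<phi>_def)
      also have "\<dots> < e / 2"
      proof (rule d(2)[OF D])
        show "\<Union> (snd ` q) \<subseteq> {a..b}" using pD q(1) by fastforce
        have "(\<Sum>k\<in>snd ` q. measure lborel k) = measure lebesgue (\<Union>(snd ` q))"
          unfolding content_division[OF D, symmetric]
          using division_ofD(4)[OF D] by (intro sum.cong refl) (fastforce intro!: measure_completion[symmetric])
        also have "\<dots> \<le> measure lebesgue U"
        proof (rule measure_mono_fmeasurable[OF _ _ U(3)])
          show "\<Union> (snd ` q) \<subseteq> U"
            using fineD[OF p(2)] q(1) by (fastforce simp: q_def \<gamma>_def)
          show "\<Union> (snd ` q) \<in> sets lebesgue"
            using D by (meson fmeasurableD lmeasurable_division)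
        qed
        finally show "(\<Sum>k\<in>snd ` q. measure lborel k) < d" using U(4) by simp
      qed
      finally show ?thesis .
    qed
    have "\<bar>f b - f a\<bar> \<le> (\<Sum>(t,k)\<in>p. \<bar>f (Sup k) - f (Inf k)\<bar>)"
      unfolding sumf split_def by (rule sum_abs)
    also have "\<dots> = (\<Sum>(t,k)\<in>p - q. \<bar>f (Sup k) - f (Inf k)\<bar>) + (\<Sum>(t,k)\<in>q. \<bar>f (Sup k) - f (Inf k)\<bar>)"
      using \<open>finite p\<close> q(1) by (subst sum.subset_diff[of q p]) auto
    also have "\<dots> \<le> e" using good bad by simp
    finally show ?thesis by simp
  qed
  then have "\<bar>f b - f a\<bar> \<le> 0" by (rule field_le_epsilon)
  then show ?thesis by simp
qed


section \<open>The classical form of the Riccati equation\<close>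

text \<open>\<open>H\<close> is Lipschitz continuous, with derivative \<open>h\<close> off a negligible set. The Lipschitz condition
  replaces the boundedness of \<open>h\<close>, and gives absolute continuity.\<close>

definition is_primitive :: "(real \<Rightarrow> real) \<Rightarrow> (real \<Rightarrow> real) \<Rightarrow> bool" where
  "is_primitive h H \<longleftrightarrow> (\<exists>C. \<forall>s t. \<bar>H s - H t\<bar> \<le> C * \<bar>s - t\<bar>) \<and>
     (\<exists>N. negligible N \<and> (\<forall>t. t \<notin> N \<longrightarrow> (H has_real_derivative h t) (at t)))"

text \<open>The classical form of \<open>x' = lam - h - x\<^sup>2\<close>, in terms of a primitive \<open>H\<close> of \<open>h\<close>: the sum \<open>x + H\<close> is
  differentiable at every point of the interval \<open>I\<close>, one-sidedly at end points which belong to \<open>I\<close>.\<close>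

definition riccati_sol :: "real \<Rightarrow> (real \<Rightarrow> real) \<Rightarrow> real set \<Rightarrow> (real \<Rightarrow> real) \<Rightarrow> bool" where
  "riccati_sol lam H I x \<longleftrightarrow> is_interval I \<and>
     (\<forall>t\<in>I. ((\<lambda>t. x t + H t) has_real_derivative lam - (x t)\<^sup>2) (at t within I))"

lemma is_primitive_continuous_on:
  assumes "is_primitive h H"
  shows "continuous_on S H"
proof -
  obtain C where C: "\<And>s t. \<bar>H s - H t\<bar> \<le> C * \<bar>s - t\<bar>"
    using assms unfolding is_primitive_def by blast
  have "C \<ge> 0" using C[of 0 1] by simp
  then have "C-lipschitz_on S H"
    by (intro lipschitz_onI) (auto simp: dist_real_def C)
  then show ?thesis by (rule lipschitz_on_continuous_on)
qed

lemma abs_cont_on_C1: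
  assumes "\<And>t. t \<in> {a..b} \<Longrightarrow> (f has_real_derivative q t) (at t within {a..b})"
    and "continuous_on {a..b} q"
  shows "abs_cont_on {a..b} f"
proof -
  have "compact (q ` {a..b})" using assms(2) by (rule compact_continuous_image) simp
  then obtain B where B: "\<And>t. t \<in> {a..b} \<Longrightarrow> \<bar>q t\<bar> \<le> B"
    using compact_imp_bounded bounded_iff by (metis imageI real_norm_def)
  show ?thesis
  proof (rule abs_cont_on_lipschitz)
    fix s t assume st: "s \<in> {a..b}" "t \<in> {a..b}"
    show "\<bar>f s - f t\<bar> \<le> B * \<bar>s - t\<bar>"
      using field_differentiable_bound[of "{a..b}" f q B s t] assms(1) B st by simp
  qed
qed

lemma riccati_sol_continuous_on:
  assumes "riccati_sol lam H I x" "continuous_on I H"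
  shows "continuous_on I x"
proof -
  have "continuous_on I (\<lambda>t. (x t + H t) - H t)"
    using assms unfolding riccati_sol_def
    by (intro continuous_on_diff DERIV_continuous_on[of I "\<lambda>t. x t + H t"]) auto
  then show ?thesis by simp
qed

text \<open>For a Caratheodory solution \<open>x\<close> and a primitive \<open>Q\<close> of the continuous function \<open>lam - x\<^sup>2\<close>, the
  difference \<open>x + H - Q\<close> is absolutely continuous with derivative zero almost everywhere.\<close>

lemma solves_on_riccati_iff:
  assumes prim: "is_primitive h H"
  shows "solves_on (riccati lam h) I x \<longleftrightarrow> riccati_sol lam H I x"
proof
  obtain C where C: "\<And>s t. \<bar>H s - H t\<bar> \<le> C * \<bar>s - t\<bar>"
    using prim unfolding is_primitive_def by blast
  have acH: "abs_cont_on {a..b} H" for a b by (rule abs_cont_on_lipschitz) (rule C)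
  obtain N where N: "negligible N" "\<And>t. t \<notin> N \<Longrightarrow> (H has_real_derivative h t) (at t)"
    using prim unfolding is_primitive_def by blast
  {
    assume "solves_on (riccati lam h) I x"
    then have I: "is_interval I" and ac: "loc_abs_cont_on I x"
      and ae: "AE t in lebesgue_on I. (x has_real_derivative riccati lam h t (x t)) (at t within I)"
      unfolding solves_on_def by auto
    obtain N' where N': "negligible N'"
      "\<And>t. t \<in> I - N' \<Longrightarrow> (x has_real_derivative riccati lam h t (x t)) (at t within I)"
      using ae unfolding AE_lebesgue_on_iff_negligible[OF is_interval_lebesgue[OF I]] by blast
    have "((\<lambda>t. x t + H t) has_real_derivative lam - (x t)\<^sup>2) (at t within I)" if "t \<in> I" for t
    proof -
      obtain a b where ab: "a \<le> t" "t \<le> b" "{a..b} \<subseteq> I" "at t within {a..b} = at t within I"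
        using interval_neighbourhood[OF I \<open>t \<in> I\<close>] by blast
      have acx: "abs_cont_on {a..b} x" using ac ab(3) unfolding loc_abs_cont_on_def by blast
      define q where "q = (\<lambda>t. lam - (x t)\<^sup>2)"
      have cq: "continuous_on {a..b} q"
        unfolding q_def using abs_cont_on_imp_continuous_on[OF acx] by (intro continuous_intros)
      define Q where "Q u = integral {a..u} q" for u
      have Q: "(Q has_real_derivative q u) (at u within {a..b})" if "u \<in> {a..b}" for u
        unfolding Q_def by (rule integral_has_real_derivative[OF cq that])
      define f where "f u = (x u - Q u) - (- H u)" for u
      have acf: "abs_cont_on {a..b} f"
        unfolding f_def using C
        by (intro abs_cont_on_diff acx abs_cont_on_C1[OF Q cq] abs_cont_on_lipschitz[of _ _ C])
           (auto simp: abs_minus_commute)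
      have fconst: "f c = f a" if "c \<in> {a..b}" for c
      proof (rule abs_cont_on_zero_derivative[of a c f "N \<union> N'"])
        show "abs_cont_on {a..c} f" using acf that by (auto intro: abs_cont_on_subset)
        show "negligible (N \<union> N')" using N N' by simp
        fix u assume u: "u \<in> {a..c} - (N \<union> N')"
        have sub: "{a..c} \<subseteq> {a..b}" "{a..c} \<subseteq> I" using that ab(3) by auto
        have "(x has_real_derivative riccati lam h u (x u)) (at u within {a..c})"
          using N'(2)[of u] u sub by (blast intro: DERIV_subset)
        moreover have "(Q has_real_derivative q u) (at u within {a..c})"
          using Q[of u] u sub by (blast intro: DERIV_subset)
        moreover have "(H has_real_derivative h u) (at u within {a..c})"
          using N(2)[of u] u by (blast intro: has_field_derivative_at_within)
        ultimately show "(f has_real_derivative 0) (at u within {a..c})"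
          unfolding f_def by (auto intro!: derivative_eq_intros simp: riccati_def q_def)
      qed (use that in auto)
      have "((\<lambda>u. Q u + f a) has_real_derivative q t) (at t within {a..b})"
        using Q[of t] ab by (auto intro!: derivative_eq_intros)
      moreover have "Q u + f a = x u + H u" if "u \<in> {a..b}" for u
        using fconst[OF that] unfolding f_def by linarith
      ultimately have "((\<lambda>u. x u + H u) has_real_derivative q t) (at t within {a..b})"
        using ab by (elim has_field_derivative_transform_within[OF _ zero_less_one]) auto
      then show ?thesis using ab(4) by (simp add: q_def)
    qed
    then show "riccati_sol lam H I x" using I by (simp add: riccati_sol_def)
  next
    assume sol: "riccati_sol lam H I x"
    then have I: "is_interval I"
      and der: "\<And>t. t \<in> I \<Longrightarrow> ((\<lambda>t. x t + H t) has_real_derivative lam - (x t)\<^sup>2) (at t within I)"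
      unfolding riccati_sol_def by auto
    have cx: "continuous_on I x"
      by (rule riccati_sol_continuous_on[OF sol is_primitive_continuous_on[OF prim]])
    have "abs_cont_on {a..b} x" if "{a..b} \<subseteq> I" for a b
    proof -
      have "abs_cont_on {a..b} (\<lambda>t. x t + H t)"
      proof (rule abs_cont_on_C1)
        show "((\<lambda>t. x t + H t) has_real_derivative lam - (x t)\<^sup>2) (at t within {a..b})" if "t \<in> {a..b}" for t
          using der[of t] that \<open>{a..b} \<subseteq> I\<close> by (blast intro: DERIV_subset)
        show "continuous_on {a..b} (\<lambda>t. lam - (x t)\<^sup>2)"
          using continuous_on_subset[OF cx that] by (intro continuous_intros)
      qed
      from abs_cont_on_diff[OF this acH] show ?thesis by simp
    qed
    then have "loc_abs_cont_on I x" unfolding loc_abs_cont_on_def by blast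
    moreover have "(x has_real_derivative riccati lam h t (x t)) (at t within I)" if "t \<in> I - N" for t
    proof -
      have "((\<lambda>t. (x t + H t) - H t) has_real_derivative (lam - (x t)\<^sup>2) - h t) (at t within I)"
        using der[of t] N(2)[of t] that
        by (intro DERIV_diff) (auto intro: has_field_derivative_at_within)
      then show ?thesis by (simp add: riccati_def algebra_simps)
    qed
    ultimately show "solves_on (riccati lam h) I x"
      unfolding solves_on_def AE_lebesgue_on_iff_negligible[OF is_interval_lebesgue[OF I]]
      using I N(1) by blast
  }
qed

section \<open>Existence and transformation of primitives\<close>

lemma L1_Linf_UNIV_iff:
  "h \<in> L1_Linf UNIV \<longleftrightarrow> integrable lebesgue h \<and> (\<exists>C N. negligible N \<and> (\<forall>t. t \<notin> N \<longrightarrow> \<bar>h t\<bar> \<le> C))"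
  unfolding L1_Linf_def AE_lebesgue_on_iff_negligible[OF is_interval_lebesgue[OF is_interval_univ]]
  by (simp add: lebesgue_on_UNIV_eq Ball_def)

lemma L1_Linf_half_line_iff:
  "h \<in> L1_Linf {0..} \<longleftrightarrow> (\<lambda>t. if t \<ge> 0 then h t else 0) \<in> L1_Linf UNIV"
proof -
  have "integrable (lebesgue_on {0..}) h \<longleftrightarrow> integrable lebesgue (\<lambda>t. if t \<in> {0..} then h t else 0)"
    by (subst integrable_restrict_space) (auto intro!: Bochner_Integration.integrable_cong simp: indicator_def)
  moreover have "(\<exists>C. AE t in lebesgue_on {0..}. \<bar>h t\<bar> \<le> C) \<longleftrightarrow>
     (\<exists>C N. negligible N \<and> (\<forall>t. t \<notin> N \<longrightarrow> \<bar>if t \<ge> 0 then h t else 0\<bar> \<le> C))" (is "?L \<longleftrightarrow> ?R")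
  proof
    assume ?L
    then obtain C N where CN: "negligible N" "\<And>t. t \<in> {0..} - N \<Longrightarrow> \<bar>h t\<bar> \<le> C"
      by (auto simp: AE_lebesgue_on_iff_negligible)
    then show ?R by (intro exI[of _ "max C 0"] exI[of _ N]) (force simp: le_max_iff_disj)
  next
    assume ?R
    then obtain C N where CN: "negligible N" "\<And>t. t \<notin> N \<Longrightarrow> \<bar>if t \<ge> 0 then h t else 0\<bar> \<le> C"
      by blast
    then have "\<forall>t\<in>{0..} - N. \<bar>h t\<bar> \<le> C" by (metis Diff_iff atLeast_iff)
    with CN(1) show ?L by (auto simp: AE_lebesgue_on_iff_negligible)
  qed
  ultimately show ?thesis
    unfolding L1_Linf_UNIV_iff by (simp add: L1_Linf_def)
qed

lemma negligible_scaled_image: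
  fixes N :: "real set"
  assumes "negligible N"
  shows "negligible ((\<lambda>t. t * c) ` N)"
proof (rule negligible_locally_Lipschitz_image[OF _ assms])
  fix x assume "x \<in> N"
  show "\<exists>T B. open T \<and> x \<in> T \<and> (\<forall>y\<in>N \<inter> T. norm (y * c - x * c) \<le> B * norm (y - x))"
    by (intro exI[of _ UNIV] exI[of _ "\<bar>c\<bar>"]) (simp add: abs_mult flip: left_diff_distrib)
qed simp

text \<open>The right derivative of the indefinite integral comes from \<open>integrable_ccontinuous_explicit\<close>; the left
  derivative is the right derivative for the reflected integrand.\<close>

lemma indefinite_integral_has_derivative:
  fixes h F :: "real \<Rightarrow> real"
  assumes int: "\<And>a b. h integrable_on {a..b}"
    and F: "\<And>u v. u \<le> v \<Longrightarrow> F v - F u = integral {u..v} h"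
  obtains N where "negligible N" "\<And>t. t \<notin> N \<Longrightarrow> (F has_real_derivative h t) (at t)"
proof -
  obtain N1 where N1: "negligible N1" "\<And>x e. \<lbrakk>x \<notin> N1; 0 < e\<rbrakk> \<Longrightarrow>
      \<exists>d>0. \<forall>s. 0 < s \<and> s < d \<longrightarrow> norm (integral {x..x + s} h /\<^sub>R s - h x) < e"
    using integrable_ccontinuous_explicit[of h] int by (auto simp: box_real)
  have int': "(\<lambda>t. h (- t)) integrable_on {a..b}" for a b
    using Henstock_Kurzweil_Integration.integrable_reflect_real[where f = h and a = "- b" and b = "- a"] int[of "- b" "- a"] by simp
  obtain N2 where N2: "negligible N2" "\<And>x e. \<lbrakk>x \<notin> N2; 0 < e\<rbrakk> \<Longrightarrow>
      \<exists>d>0. \<forall>s. 0 < s \<and> s < d \<longrightarrow> norm (integral {x..x + s} (\<lambda>t. h (- t)) /\<^sub>R s - h (- x)) < e"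
    using integrable_ccontinuous_explicit[of "\<lambda>t. h (- t)"] int' by (auto simp: box_real)
  have neg: "negligible (uminus ` N2)"
    using negligible_scaled_image[OF N2(1), of "- 1"] by simp
  show ?thesis
  proof (rule that[of "N1 \<union> uminus ` N2"])
    show "negligible (N1 \<union> uminus ` N2)" using N1 neg by simp
    fix x assume x: "x \<notin> N1 \<union> uminus ` N2"
    then have x': "x \<notin> N1" "- x \<notin> N2" by (auto simp: image_iff)
    show "(F has_real_derivative h x) (at x)"
      unfolding DERIV_def LIM_eq
    proof (intro allI impI)
      fix e :: real assume "e > 0"
      obtain d1 where d1: "d1 > 0" "\<And>s. 0 < s \<Longrightarrow> s < d1 \<Longrightarrow> norm (integral {x..x + s} h /\<^sub>R s - h x) < e"
        using N1(2)[OF x'(1) \<open>e > 0\<close>] by blast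
      obtain d2 where d2: "d2 > 0" "\<And>s. 0 < s \<Longrightarrow> s < d2 \<Longrightarrow>
          norm (integral {- x..- x + s} (\<lambda>t. h (- t)) /\<^sub>R s - h x) < e"
        using N2(2)[OF x'(2) \<open>e > 0\<close>] by auto
      show "\<exists>d>0. \<forall>s. s \<noteq> 0 \<and> norm (s - 0) < d \<longrightarrow> norm ((F (x + s) - F x) / s - h x) < e"
      proof (intro exI[of _ "min d1 d2"] conjI allI impI)
        fix s :: real assume s: "s \<noteq> 0 \<and> norm (s - 0) < min d1 d2"
        show "norm ((F (x + s) - F x) / s - h x) < e"
        proof (cases "s > 0")
          case True
          then show ?thesis
            using d1(2)[of s] s F[of x "x + s"] by (simp add: divide_inverse mult.commute)
        next
          case False
          have "integral {- x..- x + (- s)} (\<lambda>t. h (- t)) = integral {x + s..x} h"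
            using Henstock_Kurzweil_Integration.integral_reflect_real[where f = h and a = "x + s" and b = x] by (simp add: add.commute)
          also have "\<dots> = F x - F (x + s)" using F[of "x + s" x] False by simp
          finally have *: "integral {- x..- x + (- s)} (\<lambda>t. h (- t)) /\<^sub>R (- s) = (F (x + s) - F x) / s"
            using s by (simp add: field_simps)
          have "norm (integral {- x..- x + (- s)} (\<lambda>t. h (- t)) /\<^sub>R (- s) - h x) < e"
            using d2(2)[of "- s"] s False by auto
          then show ?thesis using * by simp
        qed
      qed (use d1 d2 in auto)
    qed
  qed
qed

lemma L1_Linf_primitive:
  assumes "h \<in> L1_Linf UNIV"
  obtains H a b where "is_primitive h H" "H 0 = 0" "(H \<longlongrightarrow> a) at_bot" "(H \<longlongrightarrow> b) at_top"
proof -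
  have hi: "integrable lebesgue h" using assms by (simp add: L1_Linf_UNIV_iff)
  obtain C N where CN: "negligible N" "\<And>t. t \<notin> N \<Longrightarrow> \<bar>h t\<bar> \<le> C"
    using assms unfolding L1_Linf_UNIV_iff by blast
  have ai: "set_integrable lebesgue S h" if "S \<in> sets lebesgue" for S
    using set_integrable_subset[of lebesgue UNIV h S] hi that by (simp add: set_integrable_def)
  have hk: "h integrable_on S" if "S \<in> sets lebesgue" for S
    using set_lebesgue_integral_eq_integral(1)[OF ai[OF that]] .
  define F where "F t = integral {..t} h" for t
  have Fdiff: "F v - F u = integral {u..v} h" if "u \<le> v" for u v
  proof -
    have "integral ({..u} \<union> {u..v}) h = integral {..u} h + integral {u..v} h"
    proof (rule integral_Un)
      have "{..u} \<inter> {u..v} \<subseteq> {u}" by auto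
      then show "negligible ({..u} \<inter> {u..v})" by (rule negligible_subset[rotated]) simp
    qed (auto intro!: hk)
    moreover have "{..u} \<union> {u..v} = {..v}" using that by auto
    ultimately show ?thesis by (simp add: F_def)
  qed
  have F_eq: "F t = (LINT x|lebesgue. indicator {..t} x * h x)" for t
    using set_lebesgue_integral_eq_integral(2)[OF ai[of "{..t}"]]
    by (simp add: F_def set_lebesgue_integral_def)
  have meas: "(\<lambda>x. indicator {..t} x * h x) \<in> borel_measurable lebesgue" for t :: real
    using ai[of "{..t}"] unfolding set_integrable_def by simp
  have top: "(F \<longlongrightarrow> (LINT x|lebesgue. h x)) at_top"
    unfolding F_eq
  proof (rule integral_dominated_convergence_at_top[where w = "\<lambda>x. \<bar>h x\<bar>"])
    have "eventually (\<lambda>t. indicator {..t} x * h x = h x) at_top" for x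
      using eventually_ge_at_top[of x] by eventually_elim auto
    then show "AE x in lebesgue. ((\<lambda>t. indicator {..t} x * h x) \<longlongrightarrow> h x) at_top"
      by (intro AE_I2 tendsto_eventually)
  qed (use hi meas in \<open>auto simp: indicator_def\<close>)
  have bot: "((\<lambda>t. F (- t)) \<longlongrightarrow> (LINT x|(lebesgue :: real measure). 0)) at_top"
    unfolding F_eq
  proof (rule integral_dominated_convergence_at_top[where w = "\<lambda>x. \<bar>h x\<bar>"])
    have "eventually (\<lambda>t. indicator {..- t} x * h x = 0) at_top" for x
      using eventually_gt_at_top[of "- x"] by eventually_elim auto
    then show "AE x in lebesgue. ((\<lambda>t. indicator {..- t} x * h x) \<longlongrightarrow> 0) at_top"
      by (intro AE_I2 tendsto_eventually)
  qed (use hi meas in \<open>auto simp: indicator_def\<close>)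
  have lip1: "\<bar>F v - F u\<bar> \<le> C * \<bar>v - u\<bar>" if "u \<le> v" for u v
  proof -
    have "norm (integral {u..v} h) \<le> integral {u..v} (\<lambda>t. if t \<in> N then \<bar>h t\<bar> else C)"
    proof (rule integral_norm_bound_integral)
      have "(\<lambda>t. C) integrable_on {u..v}" by (rule integrable_const_ivl)
      then show "(\<lambda>t. if t \<in> N then \<bar>h t\<bar> else C) integrable_on {u..v}"
        by (rule integrable_spike[OF _ CN(1)]) simp
    qed (use CN hk in auto)
    also have "\<dots> = integral {u..v} (\<lambda>t. C)"
      by (rule integral_spike[OF CN(1)]) simp
    also have "\<dots> = C * (v - u)" using that by simp
    finally show ?thesis using Fdiff[OF that] that by simp
  qed
  have lip: "\<bar>F s - F t\<bar> \<le> C * \<bar>s - t\<bar>" for s t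
    using lip1[of s t] lip1[of t s] by (cases "s \<le> t") (auto simp: abs_minus_commute)
  obtain N' where N': "negligible N'" "\<And>t. t \<notin> N' \<Longrightarrow> (F has_real_derivative h t) (at t)"
    using indefinite_integral_has_derivative[of h F] hk Fdiff by auto
  show ?thesis
  proof (rule that[of "\<lambda>t. F t - F 0"])
    show "is_primitive h (\<lambda>t. F t - F 0)"
      unfolding is_primitive_def
    proof (intro conjI exI allI impI)
      show "\<bar>(F s - F 0) - (F t - F 0)\<bar> \<le> C * \<bar>s - t\<bar>" for s t using lip[of s t] by simp
      show "negligible N'" by (rule N')
      show "((\<lambda>t. F t - F 0) has_real_derivative h t) (at t)" if "t \<notin> N'" for t
        using DERIV_diff[OF N'(2)[OF that] DERIV_const, of "F 0"] by simp
    qed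
    show "((\<lambda>t. F t - F 0) \<longlongrightarrow> (LINT x|(lebesgue :: real measure). 0) - F 0) at_bot"
      using bot unfolding filterlim_at_bot_mirror by (intro tendsto_diff tendsto_const)
    show "((\<lambda>t. F t - F 0) \<longlongrightarrow> (LINT x|lebesgue. h x) - F 0) at_top"
      using top by (intro tendsto_diff tendsto_const)
  qed simp
qed

lemma is_primitive_diff_scaled:
  assumes "is_primitive h H" "is_primitive k K"
  shows "is_primitive (\<lambda>t. h t - c * k t) (\<lambda>t. H t - c * K t)"
proof -
  obtain C N where H: "\<And>s t. \<bar>H s - H t\<bar> \<le> C * \<bar>s - t\<bar>" "negligible N"
    "\<And>t. t \<notin> N \<Longrightarrow> (H has_real_derivative h t) (at t)"
    using assms(1) unfolding is_primitive_def by blast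
  obtain D M where K: "\<And>s t. \<bar>K s - K t\<bar> \<le> D * \<bar>s - t\<bar>" "negligible M"
    "\<And>t. t \<notin> M \<Longrightarrow> (K has_real_derivative k t) (at t)"
    using assms(2) unfolding is_primitive_def by blast
  have "\<bar>(H s - c * K s) - (H t - c * K t)\<bar> \<le> (C + \<bar>c\<bar> * D) * \<bar>s - t\<bar>" for s t
  proof -
    have "\<bar>(H s - c * K s) - (H t - c * K t)\<bar> = \<bar>(H s - H t) - c * (K s - K t)\<bar>"
      by (simp add: algebra_simps)
    also have "\<dots> \<le> \<bar>H s - H t\<bar> + \<bar>c\<bar> * \<bar>K s - K t\<bar>"
      by (metis abs_mult abs_triangle_ineq4)
    also have "\<dots> \<le> C * \<bar>s - t\<bar> + \<bar>c\<bar> * (D * \<bar>s - t\<bar>)"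
      by (intro add_mono mult_left_mono H K) simp
    finally show ?thesis by (simp add: algebra_simps)
  qed
  moreover have "negligible (N \<union> M)" using H K by simp
  moreover have "((\<lambda>t. H t - c * K t) has_real_derivative h t - c * k t) (at t)" if "t \<notin> N \<union> M" for t
    using H(3)[of t] K(3)[of t] that by (auto intro!: derivative_eq_intros)
  ultimately show ?thesis unfolding is_primitive_def by blast
qed

lemma is_primitive_time_scaled:
  assumes "is_primitive h H" "c > 0"
  shows "is_primitive (\<lambda>t. h (t * c)) (\<lambda>t. H (t * c) / c)"
proof -
  obtain C N where H: "\<And>s t. \<bar>H s - H t\<bar> \<le> C * \<bar>s - t\<bar>" "negligible N"
    "\<And>t. t \<notin> N \<Longrightarrow> (H has_real_derivative h t) (at t)"
    using assms(1) unfolding is_primitive_def by blast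
  have "\<bar>H (s * c) / c - H (t * c) / c\<bar> \<le> C * \<bar>s - t\<bar>" for s t
  proof -
    have "\<bar>H (s * c) / c - H (t * c) / c\<bar> = \<bar>H (s * c) - H (t * c)\<bar> / c"
      using assms(2) by (simp flip: diff_divide_distrib)
    also have "\<dots> \<le> C * \<bar>s * c - t * c\<bar> / c"
      using assms(2) by (intro divide_right_mono H) simp
    also have "\<dots> = C * \<bar>s - t\<bar>"
      using assms(2) by (simp add: abs_mult flip: left_diff_distrib)
    finally show ?thesis .
  qed
  moreover have "negligible ((\<lambda>t. t / c) ` N)"
    using negligible_scaled_image[OF H(2), of "inverse c"] by (simp add: divide_inverse)
  moreover have "((\<lambda>t. H (t * c) / c) has_real_derivative h (t * c)) (at t)"
    if "t \<notin> (\<lambda>t. t / c) ` N" for t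
  proof -
    have "t * c \<notin> N" using that assms(2) by (force simp: image_iff)
    have "((\<lambda>t. H (t * c)) has_real_derivative h (t * c) * c) (at t)"
      using H(3)[OF \<open>t * c \<notin> N\<close>] by (rule DERIV_chain2[where g = "\<lambda>t. t * c"]) (auto intro!: derivative_eq_intros)
    from DERIV_cdivide[OF this, of c] show ?thesis using assms(2) by simp
  qed
  ultimately show ?thesis unfolding is_primitive_def by blast
qed

lemma is_primitive_glue:
  assumes "is_primitive h H" "is_primitive k K" "H 0 = 0" "K 0 = 0"
  shows "is_primitive (\<lambda>t. if t < 0 then h t else k t) (\<lambda>t. if t < 0 then H t else K t)"
proof -
  obtain C N where H: "\<And>s t. \<bar>H s - H t\<bar> \<le> C * \<bar>s - t\<bar>" "negligible N"
    "\<And>t. t \<notin> N \<Longrightarrow> (H has_real_derivative h t) (at t)"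
    using assms(1) unfolding is_primitive_def by blast
  obtain D M where K: "\<And>s t. \<bar>K s - K t\<bar> \<le> D * \<bar>s - t\<bar>" "negligible M"
    "\<And>t. t \<notin> M \<Longrightarrow> (K has_real_derivative k t) (at t)"
    using assms(2) unfolding is_primitive_def by blast
  define F where "F t = (if t < 0 then H t else K t)" for t
  have pos: "C \<ge> 0" "D \<ge> 0" using H(1)[of 0 1] K(1)[of 0 1] by auto
  have lip1: "\<bar>F s - F t\<bar> \<le> (C + D) * \<bar>s - t\<bar>" if "s \<le> t" for s t
  proof -
    consider "t < 0" | "s < 0" "t \<ge> 0" | "s \<ge> 0" by linarith
    then show ?thesis
    proof cases
      case 1
      have "\<bar>H s - H t\<bar> \<le> (C + D) * \<bar>s - t\<bar>"
        using H(1)[of s t] mult_right_mono[of C "C + D" "\<bar>s - t\<bar>"] pos by linarith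
      then show ?thesis using 1 that by (simp add: F_def)
    next
      case 2
      have "\<bar>H s - K t\<bar> \<le> C * \<bar>s\<bar> + D * \<bar>t\<bar>"
        using H(1)[of s 0] K(1)[of t 0] assms by simp
      also have "\<dots> \<le> C * \<bar>s - t\<bar> + D * \<bar>s - t\<bar>"
        using 2 pos by (intro add_mono mult_left_mono) auto
      finally show ?thesis using 2 by (simp add: F_def algebra_simps)
    next
      case 3
      have "\<bar>K s - K t\<bar> \<le> (C + D) * \<bar>s - t\<bar>"
        using K(1)[of s t] mult_right_mono[of D "C + D" "\<bar>s - t\<bar>"] pos by linarith
      then show ?thesis using 3 that by (simp add: F_def)
    qed
  qed
  have lip: "\<bar>F s - F t\<bar> \<le> (C + D) * \<bar>s - t\<bar>" for s t
    using lip1[of s t] lip1[of t s] by (cases "s \<le> t") (auto simp: abs_minus_commute)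
  have neg: "negligible (insert 0 (N \<union> M))" using H K by simp
  have der: "(F has_real_derivative (if t < 0 then h t else k t)) (at t)" if "t \<notin> insert 0 (N \<union> M)" for t
  proof (cases "t < 0")
    case True
    have "(F has_real_derivative h t) (at t)"
      by (rule has_field_derivative_transform_within_open[of H _ _ "{..<0}"])
        (use H(3)[of t] that True in \<open>auto simp: F_def\<close>)
    then show ?thesis using True by simp
  next
    case False
    have "(F has_real_derivative k t) (at t)"
      by (rule has_field_derivative_transform_within_open[of K _ _ "{0<..}"])
        (use K(3)[of t] that False in \<open>auto simp: F_def\<close>)
    then show ?thesis using False by simp
  qed
  show ?thesis
    unfolding is_primitive_def using lip neg der unfolding F_def by blast
qed

section \<open>Linear differential equations\<close>

lemma derivative_nonneg_imp_le:
  fixes f :: "real \<Rightarrow> real"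
  assumes "a \<le> b" "\<And>t. t \<in> {a..b} \<Longrightarrow> (f has_real_derivative f' t) (at t within {a..b})"
    and "\<And>t. t \<in> {a..b} \<Longrightarrow> f' t \<ge> 0"
  shows "f a \<le> f b"
proof (cases "a = b")
  case False
  then have "a < b" using assms by simp
  then obtain t where t: "t \<in> {a<..<b}" "f b - f a = f' t * (b - a)"
    using mvt_simple[of a b f "\<lambda>t. (*) (f' t)"] assms(2) by (auto simp: has_field_derivative_def)
  then have "f b - f a \<ge> 0" using assms(3)[of t] \<open>a < b\<close> by simp
  then show ?thesis by simp
qed simp

lemma gronwall_lower:
  fixes d m :: "real \<Rightarrow> real"
  assumes "a \<le> b" and m: "continuous_on {a..b} m"
    and der: "\<And>t. t \<in> {a..b} \<Longrightarrow> (d has_real_derivative D t) (at t within {a..b})"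
    and ineq: "\<And>t. t \<in> {a..b} \<Longrightarrow> D t \<ge> m t * d t"
  shows "d b \<ge> d a * exp (integral {a..b} m)"
proof -
  define M where "M t = integral {a..t} m" for t
  have M: "(M has_real_derivative m t) (at t within {a..b})" if "t \<in> {a..b}" for t
    unfolding M_def by (rule integral_has_real_derivative[OF m that])
  have "d a * exp (- M a) \<le> d b * exp (- M b)"
  proof (rule derivative_nonneg_imp_le[OF \<open>a \<le> b\<close>, where f' = "\<lambda>t. (D t - m t * d t) * exp (- M t)"])
    fix t assume t: "t \<in> {a..b}"
    show "((\<lambda>t. d t * exp (- M t)) has_real_derivative (D t - m t * d t) * exp (- M t)) (at t within {a..b})"
      using der[OF t] M[OF t] by (auto intro!: derivative_eq_intros simp: algebra_simps)
    show "0 \<le> (D t - m t * d t) * exp (- M t)" using ineq[OF t] by simp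
  qed
  moreover have "M a = 0" by (simp add: M_def)
  ultimately show ?thesis
    by (simp add: M_def exp_minus field_simps)
qed

text \<open>In particular, a solution of \<open>d' = m d\<close> keeps its sign, and vanishes identically if it has a
  zero.\<close>

lemma linear_ode_sign:
  fixes d m :: "real \<Rightarrow> real"
  assumes "is_interval I" "continuous_on I m"
    and der: "\<And>t. t \<in> I \<Longrightarrow> (d has_real_derivative m t * d t) (at t within I)"
    and "s \<in> I" "t \<in> I"
  obtains c where "c > 0" "d t = d s * c"
proof -
  have *: "d v = d u * exp (integral {u..v} m)" if "u \<in> I" "v \<in> I" "u \<le> v" for u v
  proof -
    have sub: "{u..v} \<subseteq> I"
      using assms(1) that unfolding is_interval_1 by (meson atLeastAtMost_iff subsetI)
    have cm: "continuous_on {u..v} m" using assms(2) sub by (rule continuous_on_subset)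
    have d: "(d has_real_derivative m t * d t) (at t within {u..v})" if "t \<in> {u..v}" for t
      using der[of t] sub that by (blast intro: DERIV_subset)
    have d': "((\<lambda>t. - d t) has_real_derivative m t * (- d t)) (at t within {u..v})" if "t \<in> {u..v}" for t
      using d[OF that] by (auto intro!: derivative_eq_intros)
    show ?thesis
      using gronwall_lower[OF \<open>u \<le> v\<close> cm d] gronwall_lower[OF \<open>u \<le> v\<close> cm d'] by fastforce
  qed
  show ?thesis
  proof (cases "s \<le> t")
    case True
    then show ?thesis using that[of "exp (integral {s..t} m)"] *[of s t] assms by simp
  next
    case False
    then have "d s = d t * exp (integral {t..s} m)" using *[of t s] assms by simp
    then show ?thesis using that[of "exp (- integral {t..s} m)"] by (simp add: exp_minus)
  qed
qed

lemma antiderivative_on_UNIV: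
  fixes f :: "real \<Rightarrow> 'a::banach" and s t :: real
  assumes f: "continuous_on UNIV f"
  defines "J \<equiv> \<lambda>t. if s \<le> t then integral {s..t} f else - integral {t..s} f"
  shows "(J has_vector_derivative f t) (at t)"
proof -
  define c where "c = min s t - 1"
  define d where "d = max s t + 1"
  have int: "f integrable_on {u..v}" for u v
    using f by (intro integrable_continuous_real) (rule continuous_on_subset, auto)
  have J: "J u = integral {c..u} f - integral {c..s} f" if "u \<in> {c..d}" for u
  proof (cases "s \<le> u")
    case True
    have "c \<le> s" by (simp add: c_def)
    from Henstock_Kurzweil_Integration.integral_combine[OF this True int[of c u]] show ?thesis
      using True by (simp add: J_def algebra_simps)
  next
    case False
    then have "u \<le> s" by simp
    have "c \<le> u" using that by simp
    from Henstock_Kurzweil_Integration.integral_combine[OF this \<open>u \<le> s\<close> int[of c s]] show ?thesis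
      using False by (simp add: J_def algebra_simps)
  qed
  have t: "t \<in> {c<..<d}" unfolding c_def d_def greaterThanLessThan_iff by linarith
  have "((\<lambda>u. integral {c..u} f - integral {c..s} f) has_vector_derivative f t - 0) (at t within {c..d})"
    using t f by (intro has_vector_derivative_diff integral_has_vector_derivative has_vector_derivative_const)
      (auto intro: continuous_on_subset)
  then have "(J has_vector_derivative f t) (at t within {c..d})"
    unfolding diff_zero
    by (rule has_vector_derivative_transform_within[OF _ zero_less_one]) (use t J in auto)
  then show ?thesis using t by (simp add: at_within_Icc_at)
qed

text \<open>Global solutions of linear equations, by the contraction principle in the space of bounded
  continuous functions; the weight \<open>exp (2 L \<bar>t - s\<bar>)\<close> makes the Picard operator a contraction on
  the whole line.\<close>

lemma linear_ode_exists:
  fixes A :: "real \<Rightarrow> 'a \<Rightarrow> 'a::banach"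
  assumes cont: "\<And>z. continuous_on UNIV z \<Longrightarrow> continuous_on UNIV (\<lambda>t. A t (z t))"
    and lip: "\<And>t u v. norm (A t u - A t v) \<le> L * norm (u - v)"
    and zero: "\<And>t. A t 0 = 0" and "L > 0"
  obtains z where "z s = z0" "\<And>t. (z has_vector_derivative A t (z t)) (at t)"
proof -
  define \<omega> where "\<omega> t = exp (2 * L * \<bar>t - s\<bar>)" for t
  have \<omega>: "\<omega> t \<ge> 1" "\<omega> t > 0" for t using \<open>L > 0\<close> by (auto simp: \<omega>_def)
  have c\<omega>: "continuous_on UNIV \<omega>" unfolding \<omega>_def by (intro continuous_intros)
  define J where "J f t = (if s \<le> t then integral {s..t} f else - integral {t..s} f)"
    for f :: "real \<Rightarrow> 'a" and t
  define F where "F v t = A t (\<omega> t *\<^sub>R v t)" for v t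
  have cF: "continuous_on UNIV (F v)" if "continuous_on UNIV v" for v
    unfolding F_def using that c\<omega> by (intro cont continuous_intros)
  have derJ: "(J f has_vector_derivative f t) (at t)" if "continuous_on UNIV f" for f t
    unfolding J_def using antiderivative_on_UNIV[OF that] .
  have cJ: "continuous_on UNIV (J f)" if "continuous_on UNIV f" for f
    using derJ[OF that] by (meson continuous_at_imp_continuous_on has_vector_derivative_continuous)
  \<comment> \<open>the integral of \<open>L \<omega>\<close> between \<open>s\<close> and \<open>t\<close> is at most \<open>\<omega> t / 2\<close>, whence the contraction factor one half\<close>
  have est: "norm (J (F v) t - J (F w) t) \<le> \<omega> t * (D / 2)"
    if v: "continuous_on UNIV v" and w: "continuous_on UNIV w" and D: "\<And>t. norm (v t - w t) \<le> D" for v w t D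
  proof -
    have int: "F v integrable_on {a..b}" "F w integrable_on {a..b}" for a b
      using cF[OF v] cF[OF w] by (auto intro: integrable_continuous_real continuous_on_subset)
    have D0: "D \<ge> 0" using D[of 0] norm_ge_zero order_trans by blast
    have bd: "norm (F v \<tau> - F w \<tau>) \<le> L * D * \<omega> \<tau>" for \<tau>
    proof -
      have "norm (F v \<tau> - F w \<tau>) \<le> L * norm (\<omega> \<tau> *\<^sub>R v \<tau> - \<omega> \<tau> *\<^sub>R w \<tau>)" unfolding F_def by (rule lip)
      also have "\<dots> = L * (\<omega> \<tau> * norm (v \<tau> - w \<tau>))" using \<omega>(2)[of \<tau>] by (simp flip: scaleR_diff_right)
      also have "\<dots> \<le> L * (\<omega> \<tau> * D)" using D \<open>L > 0\<close> \<omega>(2)[of \<tau>] by (intro mult_left_mono) auto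
      finally show ?thesis by (simp add: mult_ac)
    qed
    show ?thesis
    proof (cases "s \<le> t")
      case True
      have hi: "((\<lambda>\<tau>. L * D * \<omega> \<tau>) has_integral (D / 2) * \<omega> t - (D / 2) * \<omega> s) {s..t}"
      proof (rule fundamental_theorem_of_calculus[OF True])
        fix u assume u: "u \<in> {s..t}"
        have "((\<lambda>u. (D / 2) * exp (2 * L * (u - s))) has_real_derivative L * D * \<omega> u) (at u within {s..t})"
          using u by (auto intro!: derivative_eq_intros simp: \<omega>_def)
        then have "((\<lambda>u. (D / 2) * \<omega> u) has_real_derivative L * D * \<omega> u) (at u within {s..t})"
          using u by (elim has_field_derivative_transform_within[OF _ zero_less_one]) (auto simp: \<omega>_def)
        then show "((\<lambda>u. (D / 2) * \<omega> u) has_vector_derivative L * D * \<omega> u) (at u within {s..t})"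
          by (simp add: has_real_derivative_iff_has_vector_derivative)
      qed
      have "norm (integral {s..t} (\<lambda>\<tau>. F v \<tau> - F w \<tau>)) \<le> integral {s..t} (\<lambda>\<tau>. L * D * \<omega> \<tau>)"
        using hi int bd by (intro integral_norm_bound_integral integrable_diff) auto
      also have "\<dots> = (D / 2) * \<omega> t - (D / 2) * \<omega> s" using hi by (rule integral_unique)
      also have "\<dots> \<le> \<omega> t * (D / 2)" using D0 \<omega>(2)[of s] by (simp add: mult.commute)
      finally show ?thesis using True int by (simp add: J_def integral_diff)
    next
      case False
      then have le: "t \<le> s" by simp
      have hi: "((\<lambda>\<tau>. L * D * \<omega> \<tau>) has_integral (- (D / 2) * \<omega> s) - (- (D / 2) * \<omega> t)) {t..s}"
      proof (rule fundamental_theorem_of_calculus[OF le])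
        fix u assume u: "u \<in> {t..s}"
        have "((\<lambda>u. - (D / 2) * exp (2 * L * (s - u))) has_real_derivative L * D * \<omega> u) (at u within {t..s})"
          using u by (auto intro!: derivative_eq_intros simp: \<omega>_def)
        then have "((\<lambda>u. - (D / 2) * \<omega> u) has_real_derivative L * D * \<omega> u) (at u within {t..s})"
          using u by (elim has_field_derivative_transform_within[OF _ zero_less_one]) (auto simp: \<omega>_def)
        then show "((\<lambda>u. - (D / 2) * \<omega> u) has_vector_derivative L * D * \<omega> u) (at u within {t..s})"
          by (simp add: has_real_derivative_iff_has_vector_derivative)
      qed
      have "norm (integral {t..s} (\<lambda>\<tau>. F v \<tau> - F w \<tau>)) \<le> integral {t..s} (\<lambda>\<tau>. L * D * \<omega> \<tau>)"
        using hi int bd by (intro integral_norm_bound_integral integrable_diff) auto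
      also have "\<dots> = (- (D / 2) * \<omega> s) - (- (D / 2) * \<omega> t)" using hi by (rule integral_unique)
      also have "\<dots> \<le> \<omega> t * (D / 2)" using D0 \<omega>(2)[of s] by (simp add: mult.commute)
      finally show ?thesis using False int by (simp add: J_def integral_diff norm_minus_commute)
    qed
  qed
  define P where "P v t = (1 / \<omega> t) *\<^sub>R (z0 + J (F v) t)" for v t
  have P_bcont: "P v \<in> bcontfun" if v: "continuous_on UNIV v" and B: "\<And>t. norm (v t) \<le> B" for v B
  proof (rule bcontfun_normI)
    show "continuous_on UNIV (P v)"
      unfolding P_def using \<omega> by (intro continuous_intros c\<omega> cJ cF v) (auto simp: less_imp_neq[symmetric])
    fix t
    have "F (\<lambda>_. 0) = (\<lambda>_. 0)" by (simp add: F_def fun_eq_iff zero)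
    then have J0: "J (F (\<lambda>_. 0)) t = 0" by (simp add: J_def)
    have "norm (J (F v) t) \<le> \<omega> t * (B / 2)"
      using est[OF v continuous_on_const, of 0 B t] B J0 by simp
    then have "norm (z0 + J (F v) t) \<le> \<omega> t * norm z0 + \<omega> t * (B / 2)"
      using \<omega>(1)[of t] mult_right_mono[of 1 "\<omega> t" "norm z0"] norm_triangle_ineq[of z0 "J (F v) t"] by simp
    then have "(1 / \<omega> t) * norm (z0 + J (F v) t) \<le> norm z0 + B / 2"
      using \<omega>(2)[of t] by (simp add: field_simps)
    then show "norm (P v t) \<le> norm z0 + B / 2" using \<omega>(2)[of t] by (simp add: P_def)
  qed
  define \<Phi> where "\<Phi> v = Bcontfun (P (apply_bcontfun v))" for v
  have app\<Phi>: "apply_bcontfun (\<Phi> v) = P (apply_bcontfun v)" for v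
    unfolding \<Phi>_def using P_bcont[of "apply_bcontfun v" "norm v"]
    by (simp add: Bcontfun_inverse norm_bounded)
  have "\<exists>!v. \<Phi> v = v"
  proof (rule banach_fix_type[of "1 / 2"])
    show "\<forall>v w. dist (\<Phi> v) (\<Phi> w) \<le> 1 / 2 * dist v w"
    proof (intro allI dist_bound)
      fix v w :: "real \<Rightarrow>\<^sub>C 'a" and t
      have "norm (J (F (apply_bcontfun v)) t - J (F (apply_bcontfun w)) t) \<le> \<omega> t * (dist v w / 2)"
        by (rule est) (auto simp: dist_bounded simp flip: dist_norm)
      then have "(1 / \<omega> t) * norm (J (F (apply_bcontfun v)) t - J (F (apply_bcontfun w)) t) \<le> dist v w / 2"
        using \<omega>(2)[of t] by (simp add: field_simps)
      then show "dist (apply_bcontfun (\<Phi> v) t) (apply_bcontfun (\<Phi> w) t) \<le> 1 / 2 * dist v w"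
        unfolding app\<Phi> P_def dist_norm using \<omega>(2)[of t] by (simp flip: scaleR_diff_right)
    qed
  qed auto
  then obtain v where "\<Phi> v = v" by blast
  then have v: "apply_bcontfun v t = P (apply_bcontfun v) t" for t using app\<Phi>[of v] by simp
  define z where "z t = \<omega> t *\<^sub>R apply_bcontfun v t" for t
  have z: "z t = z0 + J (F (apply_bcontfun v)) t" for t
    unfolding z_def using v[of t] \<omega>(2)[of t] by (simp add: P_def)
  show ?thesis
  proof (rule that)
    show "z s = z0" unfolding z by (simp add: J_def)
    fix t
    have "((\<lambda>t. z0 + J (F (apply_bcontfun v)) t) has_vector_derivative 0 + F (apply_bcontfun v) t) (at t)"
      by (intro has_vector_derivative_add has_vector_derivative_const derJ cF) simp
    then show "(z has_vector_derivative A t (z t)) (at t)"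
      unfolding z[abs_def, symmetric] by (simp add: F_def z_def)
  qed
qed


section \<open>Linearisation of the Riccati equation\<close>

text \<open>The substitution \<open>x + H = p / y\<close> turns the Riccati equation into a linear system, whose
  solutions are global.\<close>

definition linear_sol :: "real \<Rightarrow> (real \<Rightarrow> real) \<Rightarrow> (real \<Rightarrow> real) \<Rightarrow> (real \<Rightarrow> real) \<Rightarrow> bool" where
  "linear_sol lam H y p \<longleftrightarrow> (\<forall>t. (y has_real_derivative p t - H t * y t) (at t) \<and>
     (p has_real_derivative (lam - (H t)\<^sup>2) * y t + H t * p t) (at t))"

lemma linear_sol_continuous_on:
  assumes "linear_sol lam H y p"
  shows "continuous_on S y" "continuous_on S p"
  using assms unfolding linear_sol_def
  by (meson DERIV_isCont continuous_at_imp_continuous_on)+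

lemma linear_sol_exists:
  assumes cont: "continuous_on UNIV H" and bdd: "\<And>t. \<bar>H t\<bar> \<le> B"
  obtains y p where "linear_sol lam H y p" "y s = a" "p s = b"
proof -
  define A where "A t z = (snd z - H t * fst z, (lam - (H t)\<^sup>2) * fst z + H t * snd z)"
    for t and z :: "real \<times> real"
  define L where "L = 1 + B + (\<bar>lam\<bar> + B\<^sup>2) + B"
  have B: "B \<ge> 0" using bdd[of 0] by simp
  have "\<exists>z. z s = (a, b) \<and> (\<forall>t. (z has_vector_derivative A t (z t)) (at t))"
  proof (rule linear_ode_exists[of A L s "(a, b)"])
    show "continuous_on UNIV (\<lambda>t. A t (z t))" if "continuous_on UNIV z" for z
      unfolding A_def using that cont by (intro continuous_intros)
    show "A t 0 = 0" for t by (simp add: A_def zero_prod_def)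
    show "L > 0"
      unfolding L_def using B abs_ge_zero[of lam] zero_le_power2[of B] by linarith
    have bound: "norm (A t w) \<le> L * norm w" for t w
    proof -
      obtain u v where w: "w = (u, v)" by fastforce
      define n where "n = norm w"
      have n: "\<bar>u\<bar> \<le> n" "\<bar>v\<bar> \<le> n" "n \<ge> 0"
        using norm_fst_le[of u v] norm_snd_le[of v u] by (auto simp: w n_def)
      have Hu: "\<bar>H t * u\<bar> \<le> B * n" "\<bar>H t * v\<bar> \<le> B * n"
        unfolding abs_mult using bdd n B by (auto intro!: mult_mono)
      have "(H t)\<^sup>2 \<le> B\<^sup>2" using power_mono[OF bdd[of t], of 2] by simp
      then have "\<bar>lam - (H t)\<^sup>2\<bar> \<le> \<bar>lam\<bar> + B\<^sup>2"
        using abs_triangle_ineq4[of lam "(H t)\<^sup>2"] by simp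
      then have lu: "\<bar>(lam - (H t)\<^sup>2) * u\<bar> \<le> (\<bar>lam\<bar> + B\<^sup>2) * n"
        unfolding abs_mult using n by (intro mult_mono) auto
      have "norm (A t w) \<le> \<bar>v - H t * u\<bar> + \<bar>(lam - (H t)\<^sup>2) * u + H t * v\<bar>"
        using norm_Pair_le[of "v - H t * u" "(lam - (H t)\<^sup>2) * u + H t * v"] by (simp add: A_def w)
      also have "\<dots> \<le> n + B * n + ((\<bar>lam\<bar> + B\<^sup>2) * n + B * n)"
        using n Hu lu by linarith
      finally show ?thesis by (simp add: L_def n_def algebra_simps)
    qed
    have "A t u - A t v = A t (u - v)" for t u v
      by (simp add: A_def prod_eq_iff algebra_simps)
    then show "norm (A t u - A t v) \<le> L * norm (u - v)" for t u v
      using bound by simp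
  qed blast
  then obtain z where z: "z s = (a, b)" "\<And>t. (z has_vector_derivative A t (z t)) (at t)" by blast
  show ?thesis
  proof (rule that)
    have "((\<lambda>t. fst (z t)) has_vector_derivative fst (A t (z t))) (at t)"
      "((\<lambda>t. snd (z t)) has_vector_derivative snd (A t (z t))) (at t)" for t
      by (intro bounded_linear.has_vector_derivative[OF bounded_linear_fst] z(2)
          bounded_linear.has_vector_derivative[OF bounded_linear_snd])+
    then show "linear_sol lam H (\<lambda>t. fst (z t)) (\<lambda>t. snd (z t))"
      by (simp add: linear_sol_def A_def has_real_derivative_iff_has_vector_derivative)
  qed (use z in auto)
qed

lemma linear_sol_combination:
  assumes "linear_sol lam H y p" "linear_sol lam H z q"
  shows "linear_sol lam H (\<lambda>t. a * y t + b * z t) (\<lambda>t. a * p t + b * q t)"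
  using assms unfolding linear_sol_def
  by (auto intro!: derivative_eq_intros simp: algebra_simps)

text \<open>The Wronskian is constant, since the system has trace zero.\<close>

lemma linear_sol_wronskian:
  assumes "linear_sol lam H y p" "linear_sol lam H z q"
  shows "y t * q t - z t * p t = y s * q s - z s * p s"
proof -
  have "((\<lambda>t. y t * q t - z t * p t) has_real_derivative 0) (at t)" for t
    using assms unfolding linear_sol_def
    by (auto intro!: derivative_eq_intros simp: algebra_simps power2_eq_square)
  then show ?thesis using DERIV_isconst_all[of "\<lambda>t. y t * q t - z t * p t" t s] by blast
qed

lemma linear_sol_nontrivial:
  assumes sol: "linear_sol lam H y p" and cont: "continuous_on UNIV H" and bdd: "\<And>t. \<bar>H t\<bar> \<le> B"
    and nz: "y s \<noteq> 0" and "y t = 0"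
  shows "p t \<noteq> 0"
proof -
  obtain z q where zq: "linear_sol lam H z q" "z s = 0" "q s = 1"
    using linear_sol_exists[OF cont bdd] by metis
  have "y t * q t - z t * p t = y s" using linear_sol_wronskian[OF sol zq(1), of t s] zq by simp
  then show ?thesis using assms by auto
qed

lemma riccati_sol_subset:
  assumes "riccati_sol lam H I x" "is_interval J" "J \<subseteq> I"
  shows "riccati_sol lam H J x"
  using assms unfolding riccati_sol_def by (meson DERIV_subset subsetD)

lemma riccati_sol_cong:
  assumes "riccati_sol lam H I x" "\<And>t. t \<in> I \<Longrightarrow> y t = x t" "\<And>t. t \<in> I \<Longrightarrow> K t = H t"
  shows "riccati_sol lam K I y"
  using assms unfolding riccati_sol_def
  by (auto elim!: has_field_derivative_transform_within[OF _ zero_less_one])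

lemma riccati_sol_shift:
  "riccati_sol lam (\<lambda>t. H t - c) I x \<longleftrightarrow> riccati_sol lam H I x"
proof -
  have "((\<lambda>t. x t + (H t - c)) has_real_derivative d) (at t within S) \<longleftrightarrow>
    ((\<lambda>t. x t + H t) has_real_derivative d) (at t within S)" for d t S
  proof
    assume "((\<lambda>t. x t + (H t - c)) has_real_derivative d) (at t within S)"
    from DERIV_add[OF this DERIV_const[of c]] show "((\<lambda>t. x t + H t) has_real_derivative d) (at t within S)" by simp
  next
    assume "((\<lambda>t. x t + H t) has_real_derivative d) (at t within S)"
    from DERIV_diff[OF this DERIV_const[of c]] show "((\<lambda>t. x t + (H t - c)) has_real_derivative d) (at t within S)"
      by (simp add: algebra_simps)
  qed
  then show ?thesis by (simp add: riccati_sol_def)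
qed

text \<open>The equation is invariant under \<open>(t, x) \<mapsto> (-t, -x)\<close>. This exchanges past and future, and
  attractor and repeller.\<close>

lemma riccati_sol_reflect:
  assumes "riccati_sol lam H I x"
  shows "riccati_sol lam (\<lambda>t. - H (- t)) (uminus ` I) (\<lambda>t. - x (- t))"
  unfolding riccati_sol_def
proof (intro conjI ballI)
  have I: "is_interval I" using assms by (simp add: riccati_sol_def)
  then show "is_interval (uminus ` I)" by simp
  fix t assume t: "t \<in> uminus ` I"
  then have "((\<lambda>t. x t + H t) has_real_derivative lam - (x (- t))\<^sup>2) (at (- t) within I)"
    using assms by (auto simp: riccati_sol_def)
  moreover have "uminus ` uminus ` I = I" by force
  ultimately have "((\<lambda>t. x t + H t) \<circ> uminus has_real_derivative (lam - (x (- t))\<^sup>2) * (- 1)) (at t within uminus ` I)"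
    by (intro DERIV_image_chain) (auto intro!: derivative_eq_intros)
  from DERIV_minus[OF this]
  show "((\<lambda>t. - x (- t) + - H (- t)) has_real_derivative lam - (- x (- t))\<^sup>2) (at t within uminus ` I)"
    by (simp add: o_def algebra_simps)
qed

lemma riccati_sol_difference:
  assumes "riccati_sol lam H I x" "riccati_sol lam H I x'" "t \<in> I"
  shows "((\<lambda>t. x' t - x t) has_real_derivative - (x t + x' t) * (x' t - x t)) (at t within I)"
proof -
  have "((\<lambda>t. (x' t + H t) - (x t + H t)) has_real_derivative (lam - (x' t)\<^sup>2) - (lam - (x t)\<^sup>2)) (at t within I)"
    using assms unfolding riccati_sol_def by (intro DERIV_diff) auto
  then show ?thesis by (simp add: algebra_simps power2_eq_square)
qed

lemma riccati_sol_of_linear: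
  assumes lin: "linear_sol lam H y p" and "is_interval I" and nz: "\<And>t. t \<in> I \<Longrightarrow> y t \<noteq> 0"
  shows "riccati_sol lam H I (\<lambda>t. p t / y t - H t)"
  unfolding riccati_sol_def
proof (intro conjI ballI)
  fix t assume "t \<in> I"
  then have "y t \<noteq> 0" by (rule nz)
  have "(y has_real_derivative p t - H t * y t) (at t within I)"
    "(p has_real_derivative (lam - (H t)\<^sup>2) * y t + H t * p t) (at t within I)"
    using lin by (auto simp: linear_sol_def intro: has_field_derivative_at_within)
  then have "((\<lambda>t. p t / y t) has_real_derivative lam - (p t / y t - H t)\<^sup>2) (at t within I)"
    using \<open>y t \<noteq> 0\<close>
    by (auto intro!: derivative_eq_intros simp: field_simps power2_eq_square)
  then show "((\<lambda>t. (p t / y t - H t) + H t) has_real_derivative lam - (p t / y t - H t)\<^sup>2) (at t within I)"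
    by simp
qed fact

text \<open>The defect \<open>q = p - (x + H) y\<close> satisfies \<open>q' = - x q\<close>, so it vanishes identically; then \<open>y' = x y\<close>.\<close>

lemma linear_sol_along_riccati_sol:
  assumes lin: "linear_sol lam H y p" and sol: "riccati_sol lam H I x" and cont: "continuous_on I H"
    and s: "s \<in> I" "y s > 0" "p s = (x s + H s) * y s" and t: "t \<in> I"
  shows "y t > 0" "p t = (x t + H t) * y t"
proof -
  have I: "is_interval I" using sol by (simp add: riccati_sol_def)
  have cx: "continuous_on I x" by (rule riccati_sol_continuous_on[OF sol cont])
  have y: "(y has_real_derivative p t - H t * y t) (at t within I)"
    and p: "(p has_real_derivative (lam - (H t)\<^sup>2) * y t + H t * p t) (at t within I)" for t
    using lin by (auto simp: linear_sol_def intro: has_field_derivative_at_within)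
  define q where "q t = p t - (x t + H t) * y t" for t
  have "(q has_real_derivative - x t * q t) (at t within I)" if "t \<in> I" for t
  proof -
    have "((\<lambda>t. x t + H t) has_real_derivative lam - (x t)\<^sup>2) (at t within I)"
      using sol that by (simp add: riccati_sol_def)
    from DERIV_diff[OF p[of t] DERIV_mult[OF this y[of t]]]
    show ?thesis unfolding q_def by (simp add: algebra_simps power2_eq_square)
  qed
  then have q0: "q t = 0" if "t \<in> I" for t
    using linear_ode_sign[OF I continuous_on_minus[OF cx], of q s t] s that
    by (force simp: q_def)
  then show "p t = (x t + H t) * y t" using t by (simp add: q_def)
  have "(y has_real_derivative x t * y t) (at t within I)" if "t \<in> I" for t
    using y[of t] q0[OF that] by (simp add: q_def algebra_simps)
  then obtain c where "c > 0" "y t = y s * c"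
    using linear_ode_sign[OF I cx, of y s t] s t by blast
  then show "y t > 0" using s by simp
qed

section \<open>Maximal solutions and comparison\<close>

text \<open>A function which increases whenever it is at the level \<open>m\<close> cannot cross this level downwards.\<close>

lemma barrier_ge:
  fixes f :: "real \<Rightarrow> real"
  assumes "a \<le> b" and der: "\<And>t. t \<in> {a..b} \<Longrightarrow> (f has_real_derivative f' t) (at t within {a..b})"
    and "f a \<ge> m" and up: "\<And>t. t \<in> {a..b} \<Longrightarrow> f t = m \<Longrightarrow> f' t > 0"
  shows "f b \<ge> m"
proof (rule ccontr)
  assume "\<not> f b \<ge> m"
  have cf: "continuous_on {a..b} f" using der by (rule DERIV_continuous_on)
  define S where "S = {a..b} \<inter> f -` {m..}"
  have "closed S" unfolding S_def using cf by (intro continuous_closed_preimage) auto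
  then have "compact S" unfolding S_def by (metis compact_Icc compact_Int_closed inf.left_idem inf_commute)
  moreover have "a \<in> S" using assms by (simp add: S_def)
  ultimately obtain s where s: "s \<in> S" "\<And>t. t \<in> S \<Longrightarrow> t \<le> s" using compact_attains_sup[of S] by blast
  have sb: "s < b" using s \<open>\<not> f b \<ge> m\<close> by (auto simp: S_def less_le)
  have below: "f t < m" if "s < t" "t \<le> b" for t
    using s that by (fastforce simp: S_def not_le[symmetric])
  have "f s = m"
  proof (rule ccontr)
    assume "f s \<noteq> m"
    then have "f s > m" using s by (simp add: S_def)
    then obtain d where d: "d > 0" "\<And>t. t \<in> {a..b} \<Longrightarrow> \<bar>t - s\<bar> < d \<Longrightarrow> \<bar>f t - f s\<bar> < f s - m"
      using cf s(1) unfolding continuous_on_iff dist_real_def S_def by (metis IntD1 diff_gt_0_iff_gt)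
    define t where "t = min b (s + d / 2)"
    have "t \<in> {a..b}" "\<bar>t - s\<bar> < d" "s < t" "t \<le> b" using d(1) sb s by (auto simp: t_def S_def)
    then show False using d(2)[of t] below[of t] by linarith
  qed
  then have "f' s > 0" using up s by (simp add: S_def)
  then obtain d where d: "d > 0" "\<And>h. h > 0 \<Longrightarrow> s + h \<in> {a..b} \<Longrightarrow> h < d \<Longrightarrow> f s < f (s + h)"
    using has_real_derivative_pos_inc_right[OF der, of s] s by (auto simp: S_def)
  define h where "h = min (b - s) (d / 2)"
  have "h > 0" "s + h \<in> {a..b}" "h < d" using d(1) sb s by (auto simp: h_def S_def)
  then show False using d(2)[of h] below[of "s + h"] \<open>f s = m\<close> by auto
qed


text \<open>A Riccati equation in classical form on the whole line. The limits of \<open>H\<close> at both ends are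
  all that the analysis uses of the integrability of the forcing.\<close>

locale riccati_field =
  fixes lam :: real and H :: "real \<Rightarrow> real"
  assumes lam_pos: "lam > 0"
    and contH: "continuous_on UNIV H"
    and lim_bot: "\<exists>l. (H \<longlongrightarrow> l) at_bot"
    and lim_top: "\<exists>l. (H \<longlongrightarrow> l) at_top"
begin

abbreviation sol :: "real set \<Rightarrow> (real \<Rightarrow> real) \<Rightarrow> bool" where
  "sol \<equiv> riccati_sol lam H"

lemma contH': "continuous_on S H"
  using contH by (rule continuous_on_subset) simp

lemma bounded_H: obtains B where "\<And>t. \<bar>H t\<bar> \<le> B"
proof -
  obtain l1 where "(H \<longlongrightarrow> l1) at_bot" using lim_bot by blast
  then have "eventually (\<lambda>t. \<bar>H t - l1\<bar> < 1) at_bot" by (auto dest!: tendstoD[of _ _ _ 1] simp: dist_real_def)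
  then obtain a where a: "\<And>t. t \<le> a \<Longrightarrow> \<bar>H t - l1\<bar> < 1" by (auto simp: eventually_at_bot_linorder)
  obtain l2 where "(H \<longlongrightarrow> l2) at_top" using lim_top by blast
  then have "eventually (\<lambda>t. \<bar>H t - l2\<bar> < 1) at_top" by (auto dest!: tendstoD[of _ _ _ 1] simp: dist_real_def)
  then obtain b where b: "\<And>t. t \<ge> b \<Longrightarrow> \<bar>H t - l2\<bar> < 1" by (auto simp: eventually_at_top_linorder)
  have "compact (H ` {a..b})" using contH' by (rule compact_continuous_image) simp
  then obtain C where C: "\<And>t. t \<in> {a..b} \<Longrightarrow> \<bar>H t\<bar> \<le> C"
    using compact_imp_bounded bounded_iff by (metis imageI real_norm_def)
  have "\<bar>H t\<bar> \<le> max (\<bar>l1\<bar> + 1) (max (\<bar>l2\<bar> + 1) C)" for t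
  proof -
    consider "t \<le> a" | "t \<ge> b" | "t \<in> {a..b}" by fastforce
    then have "\<bar>H t\<bar> \<le> \<bar>l1\<bar> + 1 \<or> \<bar>H t\<bar> \<le> \<bar>l2\<bar> + 1 \<or> \<bar>H t\<bar> \<le> C"
    proof cases
      case 1
      then show ?thesis using a[of t] by linarith
    next
      case 2
      then show ?thesis using b[of t] by linarith
    next
      case 3
      then show ?thesis using C[of t] by blast
    qed
    then show ?thesis by (simp add: le_max_iff_disj)
  qed
  then show ?thesis using that by blast
qed

lemma linear_exists: obtains y p where "linear_sol lam H y p" "y s = a" "p s = b"
  using bounded_H linear_sol_exists[OF contH] by metis

lemma linear_nontrivial: "linear_sol lam H y p \<Longrightarrow> y s \<noteq> 0 \<Longrightarrow> y t = 0 \<Longrightarrow> p t \<noteq> 0"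
  using bounded_H linear_sol_nontrivial[OF _ contH] by metis

lemma sol_interval: "sol I x \<Longrightarrow> is_interval I"
  by (simp add: riccati_sol_def)

lemma sol_continuous_on: "sol I x \<Longrightarrow> continuous_on I x"
  using riccati_sol_continuous_on contH' by blast

text \<open>A solution through \<open>(s, x0)\<close> exists on an interval exactly if the corresponding linear
  solution is positive there.\<close>

lemma sol_exists_iff:
  assumes lin: "linear_sol lam H y p" "y s > 0" "p s = (x0 + H s) * y s" and I: "is_interval I" "s \<in> I"
  shows "(\<exists>x. sol I x \<and> x s = x0) \<longleftrightarrow> (\<forall>t\<in>I. y t > 0)"
proof
  assume "\<exists>x. sol I x \<and> x s = x0"
  then show "\<forall>t\<in>I. y t > 0"
    using linear_sol_along_riccati_sol(1)[OF lin(1) _ contH' I(2)] lin by blast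
next
  assume "\<forall>t\<in>I. y t > 0"
  then have "sol I (\<lambda>t. p t / y t - H t)" using lin(1) I(1) by (intro riccati_sol_of_linear) force+
  then show "\<exists>x. sol I x \<and> x s = x0" using lin by (intro exI[of _ "\<lambda>t. p t / y t - H t"]) simp
qed

lemma sol_difference_sign:
  assumes "sol I x" "sol J x'" "s \<in> I \<inter> J" "t \<in> I \<inter> J"
  obtains c where "c > 0" "x' t - x t = (x' s - x s) * c"
proof -
  have IJ: "is_interval (I \<inter> J)" using assms by (auto intro: is_interval_Int sol_interval)
  have sol: "sol (I \<inter> J) x" "sol (I \<inter> J) x'"
    using assms(1,2) IJ by (auto intro: riccati_sol_subset)
  have "continuous_on (I \<inter> J) (\<lambda>t. - (x t + x' t))"
    using sol by (intro continuous_intros sol_continuous_on)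
  from linear_ode_sign[OF IJ this riccati_sol_difference[OF sol] assms(3,4)] that show ?thesis by blast
qed

lemma sol_unique:
  assumes "sol I x" "sol J x'" "s \<in> I \<inter> J" "x s = x' s" "t \<in> I \<inter> J"
  shows "x t = x' t"
proof -
  obtain c where "c > 0" "x' t - x t = (x' s - x s) * c" by (rule sol_difference_sign[OF assms(1,2,3,5)])
  then show ?thesis using assms(4) by simp
qed

lemma sol_less:
  assumes "sol I x" "sol J x'" "s \<in> I \<inter> J" "x s < x' s" "t \<in> I \<inter> J"
  shows "x t < x' t"
proof -
  obtain c where "c > 0" "x' t - x t = (x' s - x s) * c" by (rule sol_difference_sign[OF assms(1,2,3,5)])
  then have "x' t - x t > 0" using assms(4) by simp
  then show ?thesis by simp
qed

lemma sol_le: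
  assumes "sol I x" "sol J x'" "s \<in> I \<inter> J" "x s \<le> x' s" "t \<in> I \<inter> J"
  shows "x t \<le> x' t"
  using sol_less[OF assms(1-3) _ assms(5)] sol_unique[OF assms(1-3) _ assms(5)] assms(4)
  by (cases "x s = x' s") auto

text \<open>Every solution extends to a largest one, which blows up at the finite ends of its domain:
  there the linear solution \<open>y\<close> vanishes while \<open>p\<close> does not.\<close>

lemma maximal_sol:
  obtains I x where "open I" "s \<in> I" "sol I x" "x s = x0"
    "\<And>J x' t. sol J x' \<Longrightarrow> t \<in> I \<inter> J \<Longrightarrow> x' t = x t \<Longrightarrow> J \<subseteq> I"
    "\<And>T. T \<notin> I \<Longrightarrow> s < T \<Longrightarrow> {s..<T} \<subseteq> I \<Longrightarrow> filterlim x at_bot (at_left T)"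
    "\<And>T. T \<notin> I \<Longrightarrow> T < s \<Longrightarrow> {T<..s} \<subseteq> I \<Longrightarrow> filterlim x at_top (at_right T)"
proof -
  obtain y p where lin: "linear_sol lam H y p" and yp: "y s = 1" "p s = x0 + H s"
    using linear_exists by metis
  have cy: "continuous_on S y" and cp: "continuous_on S p" for S
    using linear_sol_continuous_on[OF lin] by auto
  have pos_open: "open {t. y t > 0}"
    using cy[of UNIV] by (simp add: open_Collect_less continuous_on_const)
  define I where "I = connected_component_set {t. y t > 0} s"
  define x where "x t = p t / y t - H t" for t
  have oI: "open I" unfolding I_def using pos_open by (rule open_connected_component)
  have sI: "s \<in> I" by (simp add: I_def connected_component_refl_eq yp)
  have Ipos: "y t > 0" if "t \<in> I" for t
    using connected_component_subset[of "{t. y t > 0}" s] that by (auto simp: I_def)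
  have intI: "is_interval I" by (simp add: I_def is_interval_connected_1)
  have large: "J \<subseteq> I" if "is_interval J" "s \<in> J" "\<forall>t\<in>J. y t > 0" for J
    unfolding I_def using that by (intro connected_component_maximal) (auto simp: is_interval_connected_1)
  have solI: "sol I x"
    unfolding x_def using Ipos intI lin by (intro riccati_sol_of_linear) force+
  have y0: "y T = 0" if T: "T \<notin> I" "s < T \<and> {s..<T} \<subseteq> I \<or> T < s \<and> {T<..s} \<subseteq> I" for T
  proof (rule antisym)
    show "y T \<le> 0"
    proof (rule ccontr)
      assume "\<not> y T \<le> 0"
      then have "y T > 0" by simp
      have "{min s T..max s T} \<subseteq> I"
      proof (rule large)
        show "\<forall>t\<in>{min s T..max s T}. y t > 0"
        proof
          fix t assume t: "t \<in> {min s T..max s T}"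
          show "y t > 0"
          proof (cases "t = T")
            case False
            then have "t \<in> I" using T(2) t by (auto simp: min_def max_def split: if_splits)
            then show ?thesis by (rule Ipos)
          qed (use \<open>y T > 0\<close> in simp)
        qed
      qed auto
      moreover have "T \<in> {min s T..max s T}" by simp
      ultimately show False using T(1) by blast
    qed
    have ev: "(y \<longlongrightarrow> y T) (at T within S)" for S
      using cy[of UNIV] by (meson UNIV_I continuous_on_eq_continuous_at continuous_within_subset
          continuous_within open_UNIV subset_UNIV)
    from T(2) show "0 \<le> y T"
    proof
      assume *: "s < T \<and> {s..<T} \<subseteq> I"
      then have "eventually (\<lambda>t. t \<in> {s<..<T}) (at_left T)" by (intro eventually_at_left_real) simp
      then have "eventually (\<lambda>t. y t \<ge> 0) (at_left T)"
      proof eventually_elim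
        case (elim t)
        then have "t \<in> I" using * by auto
        then show ?case using Ipos[of t] by simp
      qed
      then show ?thesis using ev by (intro tendsto_lowerbound[of y _ "at_left T"]) auto
    next
      assume *: "T < s \<and> {T<..s} \<subseteq> I"
      then have "eventually (\<lambda>t. t \<in> {T<..<s}) (at_right T)" by (intro eventually_at_right_real) simp
      then have "eventually (\<lambda>t. y t \<ge> 0) (at_right T)"
      proof eventually_elim
        case (elim t)
        then have "t \<in> I" using * by auto
        then show ?case using Ipos[of t] by simp
      qed
      then show ?thesis using ev by (intro tendsto_lowerbound[of y _ "at_right T"]) auto
    qed
  qed
  have tend: "(y \<longlongrightarrow> y T) (at T within S)" "(p \<longlongrightarrow> p T) (at T within S)" "(H \<longlongrightarrow> H T) (at T within S)" for T S
    using cy[of UNIV] cp[of UNIV] contH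
    by (meson UNIV_I continuous_on_eq_continuous_at continuous_within_subset continuous_within open_UNIV subset_UNIV)+
  show ?thesis
  proof (rule that[OF oI sI solI])
    show "x s = x0" by (simp add: x_def yp)
    show "J \<subseteq> I" if J: "sol J x'" "t \<in> I \<inter> J" "x' t = x t" for J x' t
    proof -
      have t: "t \<in> I" "t \<in> J" using J(2) by auto
      have "p t = (x' t + H t) * y t" using J(3) Ipos[OF t(1)] by (simp add: x_def)
      then have "\<forall>\<tau>\<in>J. y \<tau> > 0"
        using linear_sol_along_riccati_sol(1)[OF lin J(1) contH' t(2) Ipos[OF t(1)]] by blast
      moreover have "is_interval (I \<union> J)"
        using J(2) intI sol_interval[OF J(1)] unfolding is_interval_connected_1
        by (intro connected_Un) auto
      moreover have "s \<in> I \<union> J" using sI by simp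
      moreover have "\<forall>\<tau>\<in>I. y \<tau> > 0" using Ipos by simp
      ultimately have "I \<union> J \<subseteq> I" by (intro large) blast+
      then show ?thesis by simp
    qed
    fix T
    assume "T \<notin> I"
    have der: "(y has_real_derivative p T) (at T)" if "y T = 0"
      using lin[unfolded linear_sol_def, rule_format, of T] that by simp
    have pne: "p T \<noteq> 0" if "y T = 0" using linear_nontrivial[OF lin, of s T] yp that by simp
    {
      assume T: "s < T" "{s..<T} \<subseteq> I"
      have "y T = 0" using y0 \<open>T \<notin> I\<close> T by blast
      have ev: "eventually (\<lambda>t. y t > 0) (at_left T)"
        using eventually_at_left_real[OF T(1)]
      proof eventually_elim
        case (elim t)
        then have "t \<in> I" using T(2) by auto
        then show ?case by (rule Ipos)
      qed
      have "p T < 0"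
      proof (rule ccontr)
        assume "\<not> p T < 0"
        then have "p T > 0" using pne \<open>y T = 0\<close> by simp
        then obtain d where d: "d > 0" "\<And>h. h > 0 \<Longrightarrow> h < d \<Longrightarrow> y (T - h) < y T"
          using DERIV_pos_inc_left[OF der] \<open>y T = 0\<close> by blast
        define h where "h = min (d / 2) ((T - s) / 2)"
        have h: "h > 0" "h < d" "T - h \<in> {s..<T}" using d(1) T(1) by (auto simp: h_def min_def field_simps)
        then have "T - h \<in> I" using T(2) by blast
        then show False using d(2)[of h] h(1,2) Ipos[of "T - h"] \<open>y T = 0\<close> by auto
      qed
      have "filterlim y (at_right 0) (at_left T)"
        using tend(1)[of T "{..<T}"] ev \<open>y T = 0\<close> by (simp add: filterlim_at eventually_mono)
      then have "filterlim (\<lambda>t. inverse (y t)) at_top (at_left T)"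
        by (rule filterlim_compose[OF filterlim_inverse_at_top_right])
      from filterlim_tendsto_neg_mult_at_bot[OF tend(2) \<open>p T < 0\<close> this]
      have "filterlim (\<lambda>t. - (p t * inverse (y t))) at_top (at_left T)"
        unfolding filterlim_uminus_at_bot .
      from filterlim_tendsto_add_at_top[OF tend(3) this]
      show "filterlim x at_bot (at_left T)"
        by (simp add: x_def[abs_def] divide_inverse filterlim_uminus_at_bot)
    }
    {
      assume T: "T < s" "{T<..s} \<subseteq> I"
      have "y T = 0" using y0 \<open>T \<notin> I\<close> T by blast
      have ev: "eventually (\<lambda>t. y t > 0) (at_right T)"
        using eventually_at_right_real[OF T(1)]
      proof eventually_elim
        case (elim t)
        then have "t \<in> I" using T(2) by auto
        then show ?case by (rule Ipos)
      qed
      have "p T > 0"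
      proof (rule ccontr)
        assume "\<not> p T > 0"
        then have "p T < 0" using pne \<open>y T = 0\<close> by simp
        then obtain d where d: "d > 0" "\<And>h. h > 0 \<Longrightarrow> h < d \<Longrightarrow> y (T + h) < y T"
          using DERIV_neg_dec_right[OF der] \<open>y T = 0\<close> by blast
        define h where "h = min (d / 2) ((s - T) / 2)"
        have h: "h > 0" "h < d" "T + h \<in> {T<..s}" using d(1) T(1) by (auto simp: h_def min_def field_simps)
        then have "T + h \<in> I" using T(2) by blast
        then show False using d(2)[of h] h(1,2) Ipos[of "T + h"] \<open>y T = 0\<close> by auto
      qed
      have "filterlim y (at_right 0) (at_right T)"
        using tend(1)[of T "{T<..}"] ev \<open>y T = 0\<close> by (simp add: filterlim_at eventually_mono)
      then have "filterlim (\<lambda>t. inverse (y t)) at_top (at_right T)"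
        by (rule filterlim_compose[OF filterlim_inverse_at_top_right])
      from filterlim_tendsto_pos_mult_at_top[OF tend(2) \<open>p T > 0\<close> this]
      have "filterlim (\<lambda>t. p t * inverse (y t)) at_top (at_right T)" .
      from filterlim_tendsto_add_at_top[OF tendsto_minus[OF tend(3)] this]
      show "filterlim x at_top (at_right T)"
        by (simp add: x_def[abs_def] divide_inverse)
    }
  qed
qed

lemma first_exit:
  fixes I :: "real set"
  assumes "open I" "s \<in> I" "\<not> {s..} \<subseteq> I"
  obtains T where "s < T" "T \<notin> I" "{s..<T} \<subseteq> I"
proof -
  obtain b where b: "b \<ge> s" "b \<notin> I" using assms(3) by auto
  have "compact ({s..b} - I)" using assms(1) by (intro compact_diff) auto
  moreover have "b \<in> {s..b} - I" using b by simp
  ultimately obtain T where T: "T \<in> {s..b} - I" "\<And>t. t \<in> {s..b} - I \<Longrightarrow> T \<le> t"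
    using compact_attains_inf[of "{s..b} - I"] by blast
  have "{s..<T} \<subseteq> I" using T by fastforce
  moreover have "s < T" using T(1) assms(2) by (metis Diff_iff atLeastAtMost_iff less_eq_real_def)
  ultimately show ?thesis using that T by blast
qed

text \<open>Solutions can only escape to \<open>-\<infinity>\<close> forwards in time. Hence a continuous lower barrier
  yields existence for all future times.\<close>

lemma forward_exists:
  assumes contz: "continuous_on {s..} z"
    and barrier: "\<And>T x. s < T \<Longrightarrow> sol {s..<T} x \<Longrightarrow> x s = x0 \<Longrightarrow> \<forall>t\<in>{s..<T}. z t \<le> x t"
  shows "\<exists>x. sol {s..} x \<and> x s = x0"
proof -
  obtain I x where I: "open I" "s \<in> I" "sol I x" "x s = x0"
    and exit: "\<And>T. T \<notin> I \<Longrightarrow> s < T \<Longrightarrow> {s..<T} \<subseteq> I \<Longrightarrow> filterlim x at_bot (at_left T)"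
    using maximal_sol[of s x0] by metis
  have "{s..} \<subseteq> I"
  proof (rule ccontr)
    assume "\<not> {s..} \<subseteq> I"
    then obtain T where T: "s < T" "T \<notin> I" "{s..<T} \<subseteq> I" using first_exit[OF I(1,2)] by blast
    have "sol {s..<T} x" by (rule riccati_sol_subset[OF I(3) _ T(3)]) (simp add: is_interval_1)
    then have zx: "z t \<le> x t" if "t \<in> {s..<T}" for t using barrier T(1) I(4) that by blast
    have "compact (z ` {s..T})"
      using contz by (intro compact_continuous_image) (auto intro: continuous_on_subset)
    then obtain B where B: "\<And>t. t \<in> {s..T} \<Longrightarrow> \<bar>z t\<bar> \<le> B"
      using compact_imp_bounded bounded_iff by (metis imageI real_norm_def)
    have "eventually (\<lambda>t. x t < - B) (at_left T)"
      using exit[OF T(2,1,3)] by (simp add: filterlim_at_bot_dense)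
    then have "eventually (\<lambda>t. False) (at_left T)"
      using eventually_at_left_real[OF T(1)]
    proof eventually_elim
      case (elim t)
      then show False using zx[of t] B[of t] by auto
    qed
    then show False by simp
  qed
  then have "sol {s..} x" using I(3) by (intro riccati_sol_subset[OF I(3)]) (auto simp: is_interval_1)
  then show ?thesis using I(4) by blast
qed

lemma forward_exists_above:
  assumes "sol {s..} x" "x s \<le> x0"
  shows "\<exists>x'. sol {s..} x' \<and> x' s = x0"
proof (rule forward_exists)
  show "continuous_on {s..} x" using assms(1) by (rule sol_continuous_on)
  show "\<forall>t\<in>{s..<T}. x t \<le> x' t" if "s < T" "sol {s..<T} x'" "x' s = x0" for T x'
    using sol_le[OF assms(1) that(2), of s] that assms(2) by auto
qed

end

section \<open>Asymptotics of solutions\<close>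

text \<open>A function which increases at a rate of at least \<open>k\<close> between the levels \<open>l\<close> and \<open>m\<close> rises above \<open>m\<close>
  and stays there.\<close>

lemma push_up:
  fixes f :: "real \<Rightarrow> real"
  assumes der: "\<And>t. t \<ge> T \<Longrightarrow> (f has_real_derivative f' t) (at t within {T..})"
    and "k > 0" "l < m" "f T \<ge> l"
    and up: "\<And>t. t \<ge> T \<Longrightarrow> l \<le> f t \<Longrightarrow> f t \<le> m \<Longrightarrow> f' t \<ge> k"
  shows "eventually (\<lambda>t. f t \<ge> m) at_top"
proof -
  have der': "(f has_real_derivative f' t) (at t within {u..v})" if "T \<le> u" "t \<in> {u..v}" for t u v
    using der[of t] that by (auto intro: DERIV_subset)
  have stay: "f v \<ge> n" if "l \<le> n" "n \<le> m" "T \<le> u" "f u \<ge> n" "u \<le> v" for n u v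
  proof (rule barrier_ge[OF \<open>u \<le> v\<close> der'[OF \<open>T \<le> u\<close>] \<open>f u \<ge> n\<close>])
    fix t assume "t \<in> {u..v}" "f t = n"
    then show "f' t > 0" using up[of t] that \<open>k > 0\<close> by fastforce
  qed
  have "\<exists>u\<ge>T. f u \<ge> m"
  proof (rule ccontr)
    assume "\<not> (\<exists>u\<ge>T. f u \<ge> m)"
    then have below: "f t < m" if "t \<ge> T" for t using that by (meson not_le)
    define v where "v = T + (m - f T) / k"
    have v: "T \<le> v" using below[of T] \<open>k > 0\<close> by (simp add: v_def)
    have "f T - k * T \<le> f v - k * v"
    proof (rule derivative_nonneg_imp_le[OF v, where f' = "\<lambda>t. f' t - k"])
      fix t assume t: "t \<in> {T..v}"
      show "((\<lambda>t. f t - k * t) has_real_derivative f' t - k) (at t within {T..v})"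
        using der'[OF order_refl t] by (auto intro!: derivative_eq_intros)
      show "0 \<le> f' t - k"
        using up[of t] below[of t] stay[of l T t] t assms(3,4) by auto
    qed
    then have "f v \<ge> m" using \<open>k > 0\<close> by (simp add: v_def field_simps)
    then show False using below[OF v] by simp
  qed
  then obtain u where "u \<ge> T" "f u \<ge> m" by blast
  then have "f t \<ge> m" if "t \<ge> u" for t using stay[of m u t] that \<open>l < m\<close> by simp
  then show ?thesis by (auto simp: eventually_at_top_linorder)
qed

lemma bounded_half_line:
  fixes f :: "real \<Rightarrow> real"
  assumes "continuous_on {s..} f" "(f \<longlongrightarrow> l) at_top"
  shows "bounded (f ` {s..})"
proof -
  have "eventually (\<lambda>t. \<bar>f t - l\<bar> < 1) at_top"
    using assms(2) by (auto dest!: tendstoD[of _ _ _ 1] simp: dist_real_def)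
  then obtain b where b: "\<And>t. t \<ge> b \<Longrightarrow> \<bar>f t - l\<bar> < 1" by (auto simp: eventually_at_top_linorder)
  have "compact (f ` {s..b})"
    using assms(1) by (intro compact_continuous_image) (auto intro: continuous_on_subset)
  then have "bounded (f ` {s..b})" by (rule compact_imp_bounded)
  moreover have "f ` {b..} \<subseteq> cball l 1" using b by (force simp: dist_real_def abs_minus_commute)
  then have "bounded (f ` {b..})" using bounded_cball bounded_subset by blast
  ultimately have "bounded (f ` {s..b} \<union> f ` {b..})" by simp
  moreover have "f ` {s..} \<subseteq> f ` {s..b} \<union> f ` {b..}" by fastforce
  ultimately show ?thesis by (rule bounded_subset)
qed

context riccati_field
begin

text \<open>\<open>c\<close> and \<open>-c\<close> are the equilibria of the unforced equation.\<close>

abbreviation c :: real where "c \<equiv> sqrt lam"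

lemma c_pos: "c > 0" and c_square: "c\<^sup>2 = lam"
  using lam_pos by auto

lemma sol_shifted_derivative:
  assumes "sol I x" "t \<in> I"
  shows "((\<lambda>t. x t + (H t - l)) has_real_derivative lam - (x t)\<^sup>2) (at t within I)"
  using assms riccati_sol_shift[of lam H l I x] by (simp add: riccati_sol_def)

text \<open>Far below \<open>-c\<close> the quadratic term makes \<open>1 / (x + H - l)\<close> grow at least linearly, so the
  solution would blow up.\<close>

lemma sol_lower_bound:
  assumes sol: "sol {T..} x" and "\<delta> > 0" and H: "\<And>t. t \<ge> T \<Longrightarrow> \<bar>H t - l\<bar> < \<delta>" and "t1 \<ge> T"
  shows "x t1 + (H t1 - l) \<ge> - c - 2 * \<delta>"
proof (rule ccontr)
  define r where "r t = - (x t + (H t - l))" for t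
  assume "\<not> ?thesis"
  then have r1: "r t1 > c + 2 * \<delta>" by (simp add: r_def)
  have der: "(r has_real_derivative (x t)\<^sup>2 - lam) (at t within {u..v})" if "T \<le> u" "t \<in> {u..v}" for t u v
  proof -
    have "t \<in> {T..}" using that by simp
    from DERIV_minus[OF sol_shifted_derivative[OF sol this, of l]]
    have "(r has_real_derivative (x t)\<^sup>2 - lam) (at t within {T..})" by (simp add: r_def[abs_def])
    then show ?thesis by (rule DERIV_subset) (use that in auto)
  qed
  have xr: "(x t)\<^sup>2 \<ge> (r t - \<delta>)\<^sup>2" if "t \<ge> T" "r t \<ge> c + 2 * \<delta>" for t
  proof -
    have "r t - \<delta> \<le> - x t" using H[OF that(1)] by (simp add: r_def abs_less_iff)
    moreover have "0 \<le> r t - \<delta>" using that c_pos \<open>\<delta> > 0\<close> by linarith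
    ultimately have "(r t - \<delta>)\<^sup>2 \<le> (- x t)\<^sup>2" by (rule power_mono)
    then show ?thesis by simp
  qed
  have stay: "r t \<ge> r t1" if "t \<ge> t1" for t
  proof (rule barrier_ge[OF that der[OF \<open>t1 \<ge> T\<close>] order_refl])
    fix u assume u: "u \<in> {t1..t}" "r u = r t1"
    have "c < r u - \<delta>" using r1 u \<open>\<delta> > 0\<close> by linarith
    then have "c\<^sup>2 < (r u - \<delta>)\<^sup>2" using c_pos by (intro power_strict_mono) auto
    then show "0 < (x u)\<^sup>2 - lam" using xr[of u] u r1 \<open>t1 \<ge> T\<close> c_square by auto
  qed
  define \<eta> where "\<eta> = \<delta> / (2 * (c + 2 * \<delta>))"
  have \<eta>: "\<eta> > 0"
    unfolding \<eta>_def using \<open>\<delta> > 0\<close> c_pos by (intro divide_pos_pos mult_pos_pos add_pos_pos) auto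
  have quad: "(x t)\<^sup>2 - lam \<ge> \<eta> * (r t)\<^sup>2" if "t \<ge> t1" for t
  proof -
    define \<rho> where "\<rho> = r t"
    have \<rho>: "\<rho> \<ge> c + 2 * \<delta>" using stay[OF that] r1 by (simp add: \<rho>_def)
    have pos: "c + 2 * \<delta> > 0" "\<rho> > 0" using \<open>\<delta> > 0\<close> c_pos \<rho> by linarith+
    have "\<rho> * (c + \<delta>) \<ge> (c + 2 * \<delta>) * (c + \<delta>)" using \<rho> c_pos \<open>\<delta> > 0\<close> by (intro mult_right_mono) auto
    then have "(\<delta> / (c + 2 * \<delta>)) * \<rho> \<le> \<rho> - \<delta> - c" using pos by (simp add: field_simps)
    moreover have "\<rho> / 2 \<le> \<rho> - \<delta> + c" using \<rho> c_pos \<open>\<delta> > 0\<close> by linarith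
    ultimately have "((\<delta> / (c + 2 * \<delta>)) * \<rho>) * (\<rho> / 2) \<le> (\<rho> - \<delta> - c) * (\<rho> - \<delta> + c)"
      using pos \<open>\<delta> > 0\<close> \<rho> by (intro mult_mono) auto
    also have "\<dots> = (\<rho> - \<delta>)\<^sup>2 - c\<^sup>2" by (simp add: power2_eq_square algebra_simps)
    finally have "\<eta> * \<rho>\<^sup>2 \<le> (\<rho> - \<delta>)\<^sup>2 - lam"
      unfolding c_square by (simp add: \<eta>_def power2_eq_square algebra_simps)
    then show ?thesis using xr[of t] \<rho> that \<open>t1 \<ge> T\<close> by (simp add: \<rho>_def)
  qed
  have rpos: "r t > 0" if "t \<ge> t1" for t using stay[OF that] r1 c_pos \<open>\<delta> > 0\<close> by linarith
  define v where "v = t1 + 1 / (r t1 * \<eta>)"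
  have v: "t1 \<le> v" using rpos[of t1] \<eta> by (simp add: v_def)
  have "- inverse (r t1) - \<eta> * t1 \<le> - inverse (r v) - \<eta> * v"
  proof (rule derivative_nonneg_imp_le[OF v, where f' = "\<lambda>t. ((x t)\<^sup>2 - lam) / (r t)\<^sup>2 - \<eta>"])
    fix t assume t: "t \<in> {t1..v}"
    have rt: "r t > 0" using rpos t by simp
    then have "(r t)\<^sup>2 > 0" by simp
    show "((\<lambda>t. - inverse (r t) - \<eta> * t) has_real_derivative ((x t)\<^sup>2 - lam) / (r t)\<^sup>2 - \<eta>) (at t within {t1..v})"
      using der[OF \<open>t1 \<ge> T\<close> t] rt
      by (auto intro!: derivative_eq_intros simp: field_simps power2_eq_square)
    show "0 \<le> ((x t)\<^sup>2 - lam) / (r t)\<^sup>2 - \<eta>"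
      using quad[of t] t \<open>(r t)\<^sup>2 > 0\<close> by (simp add: field_simps)
  qed
  moreover have "\<eta> * v = \<eta> * t1 + inverse (r t1)" using \<eta> rpos[of t1] by (simp add: v_def field_simps)
  ultimately have "inverse (r v) \<le> 0" by simp
  then show False using rpos[OF v] by simp
qed

text \<open>Between \<open>-c\<close> and \<open>c\<close> solutions increase, above \<open>c\<close> they decrease, up to the vanishing
  perturbation \<open>H - l\<close>.\<close>

theorem sol_asymptotic_top:
  assumes sol: "sol {s..} x"
  shows "(x \<longlongrightarrow> c) at_top \<or> (x \<longlongrightarrow> - c) at_top"
proof -
  obtain l where l: "(H \<longlongrightarrow> l) at_top" using lim_top by blast
  define w where "w t = x t + (H t - l)" for t
  have der: "(w has_real_derivative lam - (x t)\<^sup>2) (at t within {T..})" if "s \<le> T" "T \<le> t" for t T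
  proof -
    have "(w has_real_derivative lam - (x t)\<^sup>2) (at t within {s..})"
      unfolding w_def[abs_def] using sol that by (intro sol_shifted_derivative) auto
    then show ?thesis by (rule DERIV_subset) (use that in auto)
  qed
  have "\<exists>T. s \<le> T \<and> (\<forall>t\<ge>T. \<bar>H t - l\<bar> < \<delta>)" if "\<delta> > 0" for \<delta>
  proof -
    have "eventually (\<lambda>t. \<bar>H t - l\<bar> < \<delta> \<and> t \<ge> s) at_top"
      using tendstoD[OF l that] eventually_ge_at_top[of s] by eventually_elim (simp add: dist_real_def)
    then obtain N where "\<forall>t\<ge>N. \<bar>H t - l\<bar> < \<delta> \<and> t \<ge> s" by (auto simp: eventually_at_top_linorder)
    then show ?thesis by (intro exI[of _ N]) auto
  qed
  then obtain T where T: "\<And>\<delta>. \<delta> > 0 \<Longrightarrow> s \<le> T \<delta>" "\<And>\<delta> t. \<delta> > 0 \<Longrightarrow> t \<ge> T \<delta> \<Longrightarrow> \<bar>H t - l\<bar> < \<delta>"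
    by metis
  have low: "w t \<ge> - c - 2 * \<delta>" if "\<delta> > 0" "t \<ge> T \<delta>" for \<delta> t
  proof -
    have "sol {T \<delta>..} x" using T(1)[OF that(1)] by (intro riccati_sol_subset[OF sol]) (auto simp: is_interval_1)
    from sol_lower_bound[OF this that(1) T(2)[OF that(1)] that(2)] show ?thesis by (simp add: w_def)
  qed
  have high: "eventually (\<lambda>t. w t \<le> c + 2 * \<delta>) at_top" if "\<delta> > 0" for \<delta>
  proof -
    have "eventually (\<lambda>t. - w t \<ge> - c - 2 * \<delta>) at_top"
    proof (rule push_up[where T = "T \<delta>" and k = "(c + \<delta>)\<^sup>2 - c\<^sup>2" and f' = "\<lambda>t. (x t)\<^sup>2 - lam"
          and l = "min (- w (T \<delta>)) (- c - 2 * \<delta> - 1)"])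
      show "((\<lambda>t. - w t) has_real_derivative (x t)\<^sup>2 - lam) (at t within {T \<delta>..})" if "T \<delta> \<le> t" for t
        using DERIV_minus[OF der[OF T(1)[OF \<open>\<delta> > 0\<close>] that]] by simp
      show "0 < (c + \<delta>)\<^sup>2 - c\<^sup>2" using c_pos that by (simp add: power2_eq_square algebra_simps add_pos_pos)
      fix t assume t: "T \<delta> \<le> t" "- w t \<le> - c - 2 * \<delta>"
      have "c + \<delta> \<le> x t" using T(2)[OF that t(1)] t(2) by (simp add: w_def abs_less_iff)
      then have "(c + \<delta>)\<^sup>2 \<le> (x t)\<^sup>2" using c_pos that by (intro power_mono) auto
      then show "(c + \<delta>)\<^sup>2 - c\<^sup>2 \<le> (x t)\<^sup>2 - lam" by (simp add: c_square)
    qed auto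
    then show ?thesis by eventually_elim simp
  qed
  have mid: "eventually (\<lambda>t. w t \<ge> c - 2 * \<delta>) at_top"
    if \<delta>: "\<delta> > 0" "2 * \<delta> < c" and t1: "t1 \<ge> T \<delta>" "w t1 \<ge> - c + 2 * \<delta>" for \<delta> t1
  proof (rule push_up[where T = t1 and k = "c\<^sup>2 - (c - \<delta>)\<^sup>2" and f' = "\<lambda>t. lam - (x t)\<^sup>2" and l = "- c + 2 * \<delta>"])
    show "(w has_real_derivative lam - (x t)\<^sup>2) (at t within {t1..})" if "t1 \<le> t" for t
      using der[of t1 t] T(1)[OF \<delta>(1)] t1 that by simp
    have "(c - \<delta>)\<^sup>2 < c\<^sup>2" using \<delta> by (intro power_strict_mono) auto
    then show "0 < c\<^sup>2 - (c - \<delta>)\<^sup>2" by simp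
    fix t assume t: "t1 \<le> t" "- c + 2 * \<delta> \<le> w t" "w t \<le> c - 2 * \<delta>"
    have "\<bar>x t\<bar> \<le> c - \<delta>" using T(2)[OF \<delta>(1), of t] t t1 by (simp add: w_def abs_less_iff abs_le_iff)
    then have "(x t)\<^sup>2 \<le> (c - \<delta>)\<^sup>2" using power_mono[of "\<bar>x t\<bar>" "c - \<delta>" 2] by simp
    then show "c\<^sup>2 - (c - \<delta>)\<^sup>2 \<le> lam - (x t)\<^sup>2" by (simp add: c_square)
  qed (use \<delta> t1 in auto)
  define \<delta>0 where "\<delta>0 = c / 8"
  have \<delta>0: "\<delta>0 > 0" "8 * \<delta>0 = c" using c_pos by (auto simp: \<delta>0_def)
  have limit: "(x \<longlongrightarrow> a) at_top"
    if a: "\<And>\<delta>. 0 < \<delta> \<Longrightarrow> \<delta> \<le> \<delta>0 \<Longrightarrow> eventually (\<lambda>t. \<bar>w t - a\<bar> \<le> 2 * \<delta>) at_top" for a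
  proof -
    have "(w \<longlongrightarrow> a) at_top"
    proof (rule tendstoI)
      fix e :: real assume "e > 0"
      define \<delta> where "\<delta> = min \<delta>0 (e / 4)"
      have \<delta>: "0 < \<delta>" "\<delta> \<le> \<delta>0" "2 * \<delta> < e" using \<open>e > 0\<close> \<delta>0 by (auto simp: \<delta>_def)
      show "eventually (\<lambda>t. dist (w t) a < e) at_top"
        using a[OF \<delta>(1,2)] by eventually_elim (use \<delta>(3) in \<open>simp add: dist_real_def\<close>)
    qed
    from tendsto_diff[OF this tendsto_diff[OF l tendsto_const[of l]]]
    show ?thesis by (simp add: w_def)
  qed
  show ?thesis
  proof (cases "\<exists>t1\<ge>T \<delta>0. w t1 \<ge> - c + 2 * \<delta>0")
    case True
    then have ev: "eventually (\<lambda>t. w t \<ge> c - 2 * \<delta>0) at_top" using mid[of \<delta>0] \<delta>0 by auto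
    have "(x \<longlongrightarrow> c) at_top"
    proof (rule limit)
      fix \<delta> assume \<delta>: "0 < \<delta>" "\<delta> \<le> \<delta>0"
      have "eventually (\<lambda>t. t \<ge> T \<delta> \<and> w t \<ge> c - 2 * \<delta>0) at_top"
        using ev eventually_ge_at_top[of "T \<delta>"] by eventually_elim simp
      then obtain t1 where "t1 \<ge> T \<delta>" "w t1 \<ge> c - 2 * \<delta>0"
        using eventually_happens'[OF trivial_limit_at_top_linorder] by blast
      then have "eventually (\<lambda>t. w t \<ge> c - 2 * \<delta>) at_top" using \<delta> \<delta>0 by (intro mid[of \<delta> t1]) auto
      then show "eventually (\<lambda>t. \<bar>w t - c\<bar> \<le> 2 * \<delta>) at_top"
        using high[OF \<delta>(1)] by eventually_elim (simp add: abs_le_iff)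
    qed
    then show ?thesis ..
  next
    case False
    have "(x \<longlongrightarrow> - c) at_top"
    proof (rule limit)
      fix \<delta> assume \<delta>: "0 < \<delta>" "\<delta> \<le> \<delta>0"
      have "w t < - c + 2 * \<delta>" if "t \<ge> T \<delta>" for t
      proof (rule ccontr)
        assume "\<not> w t < - c + 2 * \<delta>"
        then have "eventually (\<lambda>t. w t \<ge> c - 2 * \<delta>) at_top" using \<delta> \<delta>0 that by (intro mid[of \<delta> t]) auto
        then have "eventually (\<lambda>t. t \<ge> T \<delta>0 \<and> w t \<ge> c - 2 * \<delta>) at_top"
          using eventually_ge_at_top[of "T \<delta>0"] by eventually_elim simp
        then obtain t1 where "t1 \<ge> T \<delta>0" "w t1 \<ge> c - 2 * \<delta>"
          using eventually_happens'[OF trivial_limit_at_top_linorder] by blast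
        then show False using False \<delta> \<delta>0 by fastforce
      qed
      then have "\<bar>w t - (- c)\<bar> \<le> 2 * \<delta>" if "t \<ge> T \<delta>" for t
        using low[OF \<delta>(1) that] that by (force simp: abs_le_iff)
      then show "eventually (\<lambda>t. \<bar>w t - (- c)\<bar> \<le> 2 * \<delta>) at_top"
        unfolding eventually_at_top_linorder by blast
    qed
    then show ?thesis ..
  qed
qed

lemma sol_bounded_top:
  assumes "sol {s..} x"
  shows "bounded (x ` {s..})"
  using sol_asymptotic_top[OF assms] bounded_half_line[OF sol_continuous_on[OF assms]] by blast

text \<open>At most one solution tends to \<open>-c\<close>: two of them drift apart.\<close>

lemma sol_unique_low:
  assumes "sol {s..} x" "(x \<longlongrightarrow> - c) at_top" "sol {s..} x'" "(x' \<longlongrightarrow> - c) at_top"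
  shows "x s = x' s"
proof -
  have *: False if "sol {s..} x" "(x \<longlongrightarrow> - c) at_top" "sol {s..} x'" "(x' \<longlongrightarrow> - c) at_top" "x s < x' s" for x x'
  proof -
    have "eventually (\<lambda>t. x t < 0 \<and> x' t < 0) at_top"
      using order_tendstoD(2)[OF that(2), of 0] order_tendstoD(2)[OF that(4), of 0] c_pos
      by (simp add: eventually_conj)
    then obtain N where N: "\<And>t. t \<ge> N \<Longrightarrow> x t < 0 \<and> x' t < 0" by (auto simp: eventually_at_top_linorder)
    define T where "T = max s N"
    have less: "x t < x' t" if "t \<ge> s" for t
      by (rule sol_less[OF \<open>sol {s..} x\<close> \<open>sol {s..} x'\<close>, of s]) (use \<open>x s < x' s\<close> that in auto)
    have mono: "x' T - x T \<le> x' v - x v" if "T \<le> v" for v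
    proof (rule derivative_nonneg_imp_le[OF that, where f' = "\<lambda>t. - (x t + x' t) * (x' t - x t)"])
      fix t assume t: "t \<in> {T..v}"
      then have ts: "t \<in> {s..}" by (simp add: T_def)
      show "((\<lambda>t. x' t - x t) has_real_derivative - (x t + x' t) * (x' t - x t)) (at t within {T..v})"
        by (rule DERIV_subset[OF riccati_sol_difference[OF \<open>sol {s..} x\<close> \<open>sol {s..} x'\<close> ts]])
          (auto simp: T_def)
      have "x t < 0" "x' t < 0" using N[of t] t by (auto simp: T_def)
      then show "0 \<le> - (x t + x' t) * (x' t - x t)" using less[of t] ts by (intro mult_nonneg_nonneg) auto
    qed
    have "((\<lambda>t. x' t - x t) \<longlongrightarrow> - c - (- c)) at_top" using that by (intro tendsto_diff)
    moreover have "eventually (\<lambda>t. x' T - x T \<le> x' t - x t) at_top"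
      using mono by (auto simp: eventually_at_top_linorder)
    ultimately have "x' T - x T \<le> - c - (- c)" by (intro tendsto_lowerbound) auto
    then show False using less[of T] by (simp add: T_def)
  qed
  show ?thesis using *[of x x'] *[of x' x] assms by (meson linorder_cases)
qed

section \<open>Repeller and attractor\<close>

text \<open>The initial values at time \<open>s\<close> whose solutions exist for all future, respectively past, times.\<close>

definition forward_set :: "real \<Rightarrow> real set" where
  "forward_set s = {x0. \<exists>x. sol {s..} x \<and> x s = x0}"

definition backward_set :: "real \<Rightarrow> real set" where
  "backward_set s = {x0. \<exists>x. sol {..s} x \<and> x s = x0}"

lemma forward_set_up_closed: "x0 \<in> forward_set s \<Longrightarrow> x0 \<le> x1 \<Longrightarrow> x1 \<in> forward_set s"
  unfolding forward_set_def using forward_exists_above by blast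

lemma sol_forward_set: "sol I x \<Longrightarrow> {s..} \<subseteq> I \<Longrightarrow> x s \<in> forward_set s"
  unfolding forward_set_def using riccati_sol_subset[of lam H I x "{s..}"] by (auto simp: is_interval_1)

text \<open>As long as \<open>H\<close> is close to \<open>l\<close>, the function \<open>x + H - l\<close> increases at its zeros.\<close>

lemma forward_trap:
  assumes H: "\<And>t. t \<ge> T \<Longrightarrow> \<bar>H t - l\<bar> < c" and "x0 + (H T - l) \<ge> 0"
  shows "x0 \<in> forward_set T"
  unfolding forward_set_def mem_Collect_eq
proof (rule forward_exists)
  show "continuous_on {T..} (\<lambda>t. l - H t)" by (intro continuous_intros contH')
  fix S x assume S: "T < S" "sol {T..<S} x" "x T = x0"
  show "\<forall>t\<in>{T..<S}. l - H t \<le> x t"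
  proof
    fix t assume t: "t \<in> {T..<S}"
    have "x t + (H t - l) \<ge> 0"
    proof (rule barrier_ge[of T t _ "\<lambda>u. lam - (x u)\<^sup>2"])
      fix u assume u: "u \<in> {T..t}"
      show "((\<lambda>u. x u + (H u - l)) has_real_derivative lam - (x u)\<^sup>2) (at u within {T..t})"
        by (rule DERIV_subset[OF sol_shifted_derivative[OF S(2)]]) (use u t in auto)
      assume "x u + (H u - l) = 0"
      then have "\<bar>x u\<bar> < c" using H[of u] u by (simp add: abs_less_iff)
      then have "\<bar>x u\<bar>\<^sup>2 < c\<^sup>2" by (intro power_strict_mono) auto
      then show "0 < lam - (x u)\<^sup>2" unfolding c_square by simp
    qed (use assms(2) S t in auto)
    then show "l - H t \<le> x t" by simp
  qed
qed

text \<open>The infimum of the forward set is attained: the linear solutions depend affinely on the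
  initial value, so the limit is nonnegative, and a nontrivial nonnegative solution has no zero.\<close>

lemma forward_set_has_min:
  obtains T where "\<And>s. s \<ge> T \<Longrightarrow> \<exists>m. forward_set s = {m..}"
proof -
  obtain l where l: "(H \<longlongrightarrow> l) at_top" using lim_top by blast
  obtain T where T: "\<And>t. t \<ge> T \<Longrightarrow> \<bar>H t - l\<bar> < c"
    using tendstoD[OF l c_pos] by (auto simp: eventually_at_top_linorder dist_real_def)
  have "\<exists>m. forward_set s = {m..}" if "s \<ge> T" for s
  proof -
    have Hs: "\<bar>H t - l\<bar> < c" if "t \<ge> s" for t using T[of t] that \<open>s \<ge> T\<close> by simp
    have ne: "l - H s \<in> forward_set s" using Hs by (intro forward_trap) auto
    have lower: "- c - 2 * c - (H s - l) \<le> x0" if x0: "x0 \<in> forward_set s" for x0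
    proof -
      obtain x where "sol {s..} x" "x s = x0" using x0 by (auto simp: forward_set_def)
      then show ?thesis using sol_lower_bound[of s x c l s] Hs c_pos by simp
    qed
    then have bdd: "bdd_below (forward_set s)" by (meson bdd_belowI)
    define m where "m = Inf (forward_set s)"
    have ge: "m \<le> x0" if "x0 \<in> forward_set s" for x0 unfolding m_def using that bdd by (rule cInf_lower)
    have gt: "x0 \<in> forward_set s" if "m < x0" for x0
    proof -
      obtain x1 where "x1 \<in> forward_set s" "x1 < x0"
        using \<open>m < x0\<close> cInf_less_iff[of "forward_set s" x0] ne bdd unfolding m_def by blast
      then show ?thesis using forward_set_up_closed by auto
    qed
    obtain y0 p0 where lin0: "linear_sol lam H y0 p0" "y0 s = 1" "p0 s = H s" using linear_exists by metis
    obtain y1 p1 where lin1: "linear_sol lam H y1 p1" "y1 s = 0" "p1 s = 1" using linear_exists by metis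
    define y where "y x0 t = y0 t + x0 * y1 t" for x0 t
    define p where "p x0 t = p0 t + x0 * p1 t" for x0 t
    have lin: "linear_sol lam H (y x0) (p x0)" for x0
      using linear_sol_combination[OF lin0(1) lin1(1), of 1 x0] by (simp add: y_def[abs_def] p_def[abs_def])
    have data: "y x0 s = 1" "p x0 s = x0 + H s" for x0 by (auto simp: y_def p_def lin0 lin1)
    have iff: "x0 \<in> forward_set s \<longleftrightarrow> (\<forall>t\<in>{s..}. y x0 t > 0)" for x0
      unfolding forward_set_def mem_Collect_eq
      by (rule sol_exists_iff[OF lin]) (auto simp: data is_interval_1)
    have nonneg: "y m t \<ge> 0" if "t \<ge> s" for t
    proof (rule tendsto_lowerbound)
      show "((\<lambda>x0. y x0 t) \<longlongrightarrow> y m t) (at_right m)" unfolding y_def by (intro tendsto_intros)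
      show "eventually (\<lambda>x0. 0 \<le> y x0 t) (at_right m)"
        using eventually_at_right_less[of m]
        by eventually_elim (use gt iff that in \<open>force intro: less_imp_le\<close>)
    qed simp
    have "y m t > 0" if "t \<ge> s" for t
    proof (rule ccontr)
      assume "\<not> y m t > 0"
      then have y0: "y m t = 0" using nonneg[OF that] by simp
      then have "t > s" using data(1)[of m] that by (cases "t = s") auto
      have "(y m has_real_derivative p m t) (at t)"
        using lin[of m, unfolded linear_sol_def, rule_format, of t] y0 by simp
      then have "p m t = 0"
      proof (rule DERIV_local_min)
        show "0 < t - s" using \<open>t > s\<close> by simp
        show "\<forall>u. \<bar>t - u\<bar> < t - s \<longrightarrow> y m t \<le> y m u" using nonneg y0 by auto
      qed
      then show False using linear_nontrivial[OF lin[of m], of s t] data y0 by simp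
    qed
    then have "m \<in> forward_set s" using iff by simp
    then have "forward_set s = {m..}" using ge forward_set_up_closed by auto
    then show ?thesis by blast
  qed
  then show ?thesis using that by blast
qed


text \<open>A solution together with its largest domain.\<close>

definition maximal :: "real set \<Rightarrow> (real \<Rightarrow> real) \<Rightarrow> bool" where
  "maximal I x \<longleftrightarrow> open I \<and> I \<noteq> {} \<and> sol I x \<and>
     (\<forall>J x' t. sol J x' \<longrightarrow> t \<in> I \<inter> J \<longrightarrow> x' t = x t \<longrightarrow> J \<subseteq> I)"

lemma first_exit_left:
  fixes I :: "real set"
  assumes "open I" "s \<in> I" "\<not> {..s} \<subseteq> I"
  obtains T where "T < s" "T \<notin> I" "{T<..s} \<subseteq> I"
proof -
  have op: "open (uminus ` I)" using assms(1) by (rule open_negations)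
  have s: "- s \<in> uminus ` I" using assms(2) by simp
  have "\<not> {- s..} \<subseteq> uminus ` I"
  proof
    assume *: "{- s..} \<subseteq> uminus ` I"
    have "{..s} \<subseteq> I"
    proof
      fix t assume "t \<in> {..s}"
      then have "- t \<in> uminus ` I" using * by auto
      then show "t \<in> I" by auto
    qed
    then show False using assms(3) by simp
  qed
  then obtain T where T: "- s < T" "T \<notin> uminus ` I" "{- s..<T} \<subseteq> uminus ` I"
    using first_exit[OF op s] by blast
  have "{- T<..s} \<subseteq> I"
  proof
    fix t assume "t \<in> {- T<..s}"
    then have "- t \<in> uminus ` I" using T(3) by auto
    then show "t \<in> I" by auto
  qed
  moreover have "- T \<notin> I" using T(2) by force
  ultimately show ?thesis using that[of "- T"] T(1) by simp
qed

text \<open>The maximal solution which bounds the forward sets from below, respectively the backward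
  sets from above, together with its asymptotics.\<close>

definition repeller :: "real set \<Rightarrow> (real \<Rightarrow> real) \<Rightarrow> bool" where
  "repeller I r \<longleftrightarrow> maximal I r \<and>
     (I = UNIV \<or> (\<exists>t0. I = {t0<..} \<and> filterlim r at_top (at_right t0))) \<and>
     (\<forall>t\<in>I. forward_set t = {r t..}) \<and> (r \<longlongrightarrow> - c) at_top"

definition attractor :: "real set \<Rightarrow> (real \<Rightarrow> real) \<Rightarrow> bool" where
  "attractor I a \<longleftrightarrow> maximal I a \<and>
     (I = UNIV \<or> (\<exists>tf. I = {..<tf} \<and> filterlim a at_bot (at_left tf))) \<and>
     (\<forall>t\<in>I. backward_set t = {..a t}) \<and> (a \<longlongrightarrow> c) at_bot"

text \<open>The maximal solution \<open>r\<close> through one extremal value is extremal at all times of its domain: a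
  solution below \<open>r\<close> which exists for all times after \<open>t\<close> could be continued backwards to \<open>s\<close>, since
  backwards in time it could only escape to \<open>\<infinity>\<close>. Finally \<open>r\<close> does not tend to \<open>c\<close>, since at large
  times it lies below the trap.\<close>

theorem repeller_through:
  assumes fwd: "forward_set s = {m..}"
  obtains I r where "repeller I r" "s \<in> I" "r s = m"
proof -
  obtain I r where I: "open I" "s \<in> I" "sol I r" "r s = m"
    and max: "\<And>J x' t. sol J x' \<Longrightarrow> t \<in> I \<inter> J \<Longrightarrow> x' t = r t \<Longrightarrow> J \<subseteq> I"
    and exit: "\<And>T. T \<notin> I \<Longrightarrow> T < s \<Longrightarrow> {T<..s} \<subseteq> I \<Longrightarrow> filterlim r at_top (at_right T)"
    by (rule maximal_sol[of s m]) blast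
  have "m \<in> forward_set s" using fwd by simp
  then obtain x where "sol {s..} x" "x s = m" unfolding forward_set_def by blast
  then have sub: "{s..} \<subseteq> I" using max[of "{s..}" x s] I(2,4) by simp
  have intI: "is_interval I" using I(3) by (rule sol_interval)
  have right: "{t..} \<subseteq> I" if "t \<in> I" for t
  proof
    fix u assume u: "u \<in> {t..}"
    show "u \<in> I"
    proof (cases "u \<ge> s")
      case False
      then show ?thesis using intI that u I(2) unfolding is_interval_1 by (metis atLeast_iff linear)
    qed (use sub in auto)
  qed
  have maximal: "maximal I r" unfolding maximal_def using I max by blast
  have fwdI: "r t \<in> forward_set t" if "t \<in> I" for t using sol_forward_set[OF I(3) right[OF that]] .
  have least: "r t \<le> x0" if t: "t \<in> I" and x0: "x0 \<in> forward_set t" for t x0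
  proof (rule ccontr)
    assume "\<not> r t \<le> x0"
    then have less: "x0 < r t" by simp
    obtain J x where J: "open J" "t \<in> J" "sol J x" "x t = x0"
      and maxJ: "\<And>J' x' t'. sol J' x' \<Longrightarrow> t' \<in> J \<inter> J' \<Longrightarrow> x' t' = x t' \<Longrightarrow> J' \<subseteq> J"
      and exitJ: "\<And>T. T \<notin> J \<Longrightarrow> T < t \<Longrightarrow> {T<..t} \<subseteq> J \<Longrightarrow> filterlim x at_top (at_right T)"
      by (rule maximal_sol[of t x0]) blast
    obtain x' where "sol {t..} x'" "x' t = x0" using x0 unfolding forward_set_def by blast
    then have subJ: "{t..} \<subseteq> J" using maxJ[of "{t..}" x' t] J(2,4) by simp
    have below: "x u < r u" if "u \<in> I \<inter> J" for u
      using sol_less[OF J(3) I(3), of t u] less J(2,4) t that by auto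
    have "s \<in> J"
    proof (rule ccontr)
      assume "s \<notin> J"
      then have "s < t" using subJ by (meson atLeast_iff not_le subsetD)
      have "\<not> {..t} \<subseteq> J" using \<open>s \<notin> J\<close> \<open>s < t\<close> by (meson atMost_iff less_imp_le subsetD)
      then obtain T where T: "T < t" "T \<notin> J" "{T<..t} \<subseteq> J" using first_exit_left[OF J(1,2)] by blast
      have "s \<le> T" using T(3) \<open>s \<notin> J\<close> \<open>s < t\<close> by (meson greaterThanAtMost_iff less_imp_le not_le subsetD)
      then have TI: "T \<in> I" using sub by auto
      have "isCont r T" using sol_continuous_on[OF I(3)] I(1) TI by (simp add: continuous_on_eq_continuous_at)
      then have "(r \<longlongrightarrow> r T) (at_right T)" by (simp add: isCont_def filterlim_at_split)
      then have "eventually (\<lambda>u. r u < r T + 1) (at_right T)" by (rule order_tendstoD) simp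
      moreover have "eventually (\<lambda>u. x u > r T + 1) (at_right T)"
        using exitJ[OF T(2,1,3)] by (simp add: filterlim_at_top_dense)
      moreover have "eventually (\<lambda>u. u \<in> {T<..<t}) (at_right T)" using T(1) by (rule eventually_at_right_real)
      ultimately have "eventually (\<lambda>u. False) (at_right T)"
      proof eventually_elim
        case (elim u)
        have "u \<in> I" using \<open>s \<le> T\<close> elim sub by auto
        moreover have "u \<in> J" using T(3) elim by auto
        ultimately show False using below[of u] elim by auto
      qed
      then show False by simp
    qed
    then have "{s..} \<subseteq> J"
      using subJ sol_interval[OF J(3)] J(2) unfolding is_interval_1
      by (metis atLeast_iff linear subsetI subsetD)
    then have "x s \<in> forward_set s" by (rule sol_forward_set[OF J(3)])
    then show False using fwd below[of s] I(2,4) \<open>s \<in> J\<close> by auto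
  qed
  have fwdeq: "forward_set t = {r t..}" if "t \<in> I" for t
    using fwdI[OF that] least[OF that] forward_set_up_closed by auto
  have shape: "I = UNIV \<or> (\<exists>t0. I = {t0<..} \<and> filterlim r at_top (at_right t0))"
  proof (cases "{..s} \<subseteq> I")
    case True
    then have "I = UNIV" using sub by (metis UNIV_eq_I atLeast_iff atMost_iff linear subsetD)
    then show ?thesis ..
  next
    case False
    then obtain T where T: "T < s" "T \<notin> I" "{T<..s} \<subseteq> I" using first_exit_left[OF I(1,2)] by blast
    have "I = {T<..}"
    proof
      show "I \<subseteq> {T<..}"
      proof
        fix t assume "t \<in> I"
        then show "t \<in> {T<..}" using right[of t] T(2) by (meson atLeast_iff greaterThan_iff not_le subsetD)
      qed
      show "{T<..} \<subseteq> I" using T sub by (metis atLeast_iff greaterThanAtMost_iff greaterThan_iff linear subsetI subsetD)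
    qed
    then show ?thesis using exit[OF T(2,1,3)] by blast
  qed
  have solr: "sol {s..} r" using riccati_sol_subset[OF I(3) _ sub] by (simp add: is_interval_1)
  have "(r \<longlongrightarrow> - c) at_top"
  proof -
    obtain l where l: "(H \<longlongrightarrow> l) at_top" using lim_top by blast
    obtain T where T: "\<And>t. t \<ge> T \<Longrightarrow> \<bar>H t - l\<bar> < c"
      using tendstoD[OF l c_pos] by (auto simp: eventually_at_top_linorder dist_real_def)
    have "r t + (H t - l) \<le> 0" if "t \<ge> max s T" for t
    proof -
      have "l - H t \<in> forward_set t" using T that by (intro forward_trap) auto
      moreover have "t \<in> I" using sub that by auto
      ultimately show ?thesis using fwdeq[of t] by auto
    qed
    then have ev: "eventually (\<lambda>t. r t + (H t - l) \<le> 0) at_top"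
      unfolding eventually_at_top_linorder by blast
    have "\<not> (r \<longlongrightarrow> c) at_top"
    proof
      assume "(r \<longlongrightarrow> c) at_top"
      from tendsto_add[OF this tendsto_diff[OF l tendsto_const[of l]]]
      have "((\<lambda>t. r t + (H t - l)) \<longlongrightarrow> c) at_top" by simp
      then have "c \<le> 0" using ev by (rule tendsto_upperbound) simp
      then show False using c_pos by simp
    qed
    then show ?thesis using sol_asymptotic_top[OF solr] by blast
  qed
  then have "repeller I r" unfolding repeller_def using maximal shape fwdeq by blast
  then show ?thesis using I(2,4) that by blast
qed

section \<open>Reflection in time\<close>

lemma reflected: "riccati_field lam (\<lambda>t. - H (- t))"
proof
  show "0 < lam" by (rule lam_pos)
  show "continuous_on UNIV (\<lambda>t. - H (- t))"
    by (intro continuous_intros continuous_on_compose2[OF contH]) auto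
  show "\<exists>l. ((\<lambda>t. - H (- t)) \<longlongrightarrow> l) at_bot"
    using lim_top by (auto simp: filterlim_at_bot_mirror intro: tendsto_minus)
  show "\<exists>l. ((\<lambda>t. - H (- t)) \<longlongrightarrow> l) at_top"
    using lim_bot by (auto simp: filterlim_at_bot_mirror intro: tendsto_minus)
qed

lemma backward_set_reflect:
  "x0 \<in> backward_set s \<longleftrightarrow> - x0 \<in> riccati_field.forward_set lam (\<lambda>t. - H (- t)) (- s)"
proof -
  interpret R: riccati_field lam "\<lambda>t. - H (- t)" by (rule reflected)
  have im: "uminus ` {..s} = {- s..}" "uminus ` {- s..} = {..s}" by auto
  show ?thesis
  proof
    assume "x0 \<in> backward_set s"
    then obtain x where "sol {..s} x" "x s = x0" by (auto simp: backward_set_def)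
    then have "R.sol {- s..} (\<lambda>t. - x (- t))" using riccati_sol_reflect[of lam H "{..s}" x] im by simp
    then show "- x0 \<in> R.forward_set (- s)"
      unfolding R.forward_set_def using \<open>x s = x0\<close> by (intro CollectI exI[of _ "\<lambda>t. - x (- t)"]) simp
  next
    assume "- x0 \<in> R.forward_set (- s)"
    then obtain x where "R.sol {- s..} x" "x (- s) = - x0" by (auto simp: R.forward_set_def)
    then have "sol {..s} (\<lambda>t. - x (- t))"
      using riccati_sol_reflect[of lam "\<lambda>t. - H (- t)" "{- s..}" x] im by simp
    then show "x0 \<in> backward_set s"
      unfolding backward_set_def using \<open>x (- s) = - x0\<close> by (intro CollectI exI[of _ "\<lambda>t. - x (- t)"]) simp
  qed
qed

lemma tendsto_reflect:
  fixes x :: "real \<Rightarrow> real"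
  shows "((\<lambda>t. - x (- t)) \<longlongrightarrow> l) at_top \<longleftrightarrow> (x \<longlongrightarrow> - l) at_bot"
  using tendsto_minus_cancel_left[of "\<lambda>t. x (- t)" l at_top] by (simp add: filterlim_at_bot_mirror)

lemma sol_reflect_atMost:
  assumes "sol {..s} x"
  shows "riccati_sol lam (\<lambda>t. - H (- t)) {- s..} (\<lambda>t. - x (- t))"
  using riccati_sol_reflect[OF assms] by simp

lemma sol_asymptotic_bot:
  assumes "sol {..s} x"
  shows "(x \<longlongrightarrow> c) at_bot \<or> (x \<longlongrightarrow> - c) at_bot"
proof -
  interpret R: riccati_field lam "\<lambda>t. - H (- t)" by (rule reflected)
  show ?thesis
    using R.sol_asymptotic_top[OF sol_reflect_atMost[OF assms]] by (auto simp: tendsto_reflect)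
qed

lemma sol_bounded_bot:
  assumes "sol {..s} x"
  shows "bounded (x ` {..s})"
proof -
  interpret R: riccati_field lam "\<lambda>t. - H (- t)" by (rule reflected)
  have "bounded ((\<lambda>t. - x (- t)) ` {- s..})" by (rule R.sol_bounded_top[OF sol_reflect_atMost[OF assms]])
  moreover have "(\<lambda>t. - x (- t)) ` {- s..} = uminus ` x ` {..s}"
    by (simp add: image_image[symmetric, of uminus "\<lambda>t. x (- t)"] image_image[symmetric, of x uminus])
  ultimately show ?thesis by simp
qed

lemma sol_unique_high:
  assumes "sol {..s} x" "(x \<longlongrightarrow> c) at_bot" "sol {..s} x'" "(x' \<longlongrightarrow> c) at_bot"
  shows "x s = x' s"
proof -
  interpret R: riccati_field lam "\<lambda>t. - H (- t)" by (rule reflected)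
  show ?thesis
    using R.sol_unique_low[OF sol_reflect_atMost[OF assms(1)] _ sol_reflect_atMost[OF assms(3)]] assms
    by (simp add: tendsto_reflect)
qed

lemma maximal_reflect:
  assumes "riccati_field.maximal lam (\<lambda>t. - H (- t)) I x"
  shows "maximal (uminus ` I) (\<lambda>t. - x (- t))"
proof -
  interpret R: riccati_field lam "\<lambda>t. - H (- t)" by (rule reflected)
  have I: "open I" "I \<noteq> {}" "R.sol I x"
    and max: "\<And>J x' t. R.sol J x' \<Longrightarrow> t \<in> I \<inter> J \<Longrightarrow> x' t = x t \<Longrightarrow> J \<subseteq> I"
    using assms unfolding R.maximal_def by blast+
  have "J \<subseteq> uminus ` I" if J: "sol J x'" "t \<in> uminus ` I \<inter> J" "x' t = - x (- t)" for J x' t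
  proof -
    have "- t \<in> I \<inter> uminus ` J" "- x' (- (- t)) = x (- t)" using J(2,3) by auto
    then have "uminus ` J \<subseteq> I" by (rule max[OF riccati_sol_reflect[OF J(1)]])
    then show ?thesis by force
  qed
  moreover have "sol (uminus ` I) (\<lambda>t. - x (- t))" using riccati_sol_reflect[OF I(3)] by simp
  ultimately show ?thesis using I open_negations[OF I(1)] unfolding maximal_def by blast
qed

theorem attractor_through:
  assumes bwd: "backward_set s = {..m}"
  obtains I a where "attractor I a" "s \<in> I" "a s = m"
proof -
  interpret R: riccati_field lam "\<lambda>t. - H (- t)" by (rule reflected)
  have "x0 \<in> R.forward_set (- s) \<longleftrightarrow> x0 \<in> {- m..}" for x0
  proof -
    have "x0 \<in> R.forward_set (- s) \<longleftrightarrow> - x0 \<in> backward_set s" by (simp add: backward_set_reflect)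
    also have "\<dots> \<longleftrightarrow> x0 \<in> {- m..}" unfolding bwd by auto
    finally show ?thesis .
  qed
  then have "R.forward_set (- s) = {- m..}" by blast
  then obtain I r where rep: "R.repeller I r" and I: "- s \<in> I" "r (- s) = - m"
    using R.repeller_through by blast
  have "attractor (uminus ` I) (\<lambda>t. - r (- t))"
    unfolding attractor_def
  proof (intro conjI ballI)
    show "maximal (uminus ` I) (\<lambda>t. - r (- t))"
      using rep unfolding R.repeller_def by (intro maximal_reflect) blast
    have "I = UNIV \<or> (\<exists>t0. I = {t0<..} \<and> filterlim r at_top (at_right t0))"
      using rep unfolding R.repeller_def by blast
    then show "uminus ` I = UNIV \<or>
      (\<exists>tf. uminus ` I = {..<tf} \<and> filterlim (\<lambda>t. - r (- t)) at_bot (at_left tf))"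
    proof
      assume "\<exists>t0. I = {t0<..} \<and> filterlim r at_top (at_right t0)"
      then obtain t0 where t0: "I = {t0<..}" "filterlim r at_top (at_right t0)" by blast
      have "filterlim (\<lambda>t. - r (- t)) at_bot (at_left (- t0))"
        unfolding filterlim_uminus_at_bot using t0(2) by (simp add: at_left_minus filterlim_filtermap)
      moreover have "uminus ` I = {..<- t0}" using t0(1) by simp
      ultimately show ?thesis by blast
    qed simp
    show "((\<lambda>t. - r (- t)) \<longlongrightarrow> c) at_bot"
      using rep tendsto_minus[of r "- c" at_top] by (simp add: R.repeller_def filterlim_at_bot_mirror)
    show "backward_set t = {..- r (- t)}" if "t \<in> uminus ` I" for t
    proof -
      have "- t \<in> I" using that by auto
      then have fs: "R.forward_set (- t) = {r (- t)..}" using rep unfolding R.repeller_def by blast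
      have "x0 \<in> backward_set t \<longleftrightarrow> x0 \<in> {..- r (- t)}" for x0
        unfolding backward_set_reflect fs by auto
      then show ?thesis by blast
    qed
  qed
  moreover have "s \<in> uminus ` I" using I(1) by force
  moreover have "- r (- s) = m" using I(2) by simp
  ultimately show ?thesis by (rule that)
qed

lemma sol_bdd_below:
  assumes sol: "sol I r" and "I = UNIV \<or> (\<exists>t0. I = {t0<..})"
  shows "bdd_below (r ` I)"
  using assms(2)
proof
  assume I: "I = UNIV"
  have "sol {..0} r" "sol {0..} r"
    using riccati_sol_subset[OF sol] I by (auto simp: is_interval_1)
  then have "bounded (r ` {..0} \<union> r ` {0..})" using sol_bounded_bot sol_bounded_top by simp
  moreover have "r ` I = r ` {..0} \<union> r ` {0..}"
    unfolding I image_Un[symmetric] by (rule arg_cong[where f = "\<lambda>S. r ` S"]) auto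
  ultimately show ?thesis using bounded_imp_bdd_below by metis
next
  assume "\<exists>t0. I = {t0<..}"
  then obtain t0 where I: "I = {t0<..}" by blast
  obtain B where B: "\<And>t. \<bar>H t\<bar> \<le> B" using bounded_H by blast
  define s where "s = t0 + 1"
  have "sol {s..} r" by (rule riccati_sol_subset[OF sol]) (auto simp: is_interval_1 I s_def)
  then obtain L where L: "\<And>t. t \<ge> s \<Longrightarrow> L \<le> r t"
    using bounded_imp_bdd_below[OF sol_bounded_top] unfolding bdd_below_def by fastforce
  have near: "r s - 2 * B - lam \<le> r t" if t: "t0 < t" "t \<le> s" for t
  proof -
    have "lam * t - (r t + H t) \<le> lam * s - (r s + H s)"
    proof (rule derivative_nonneg_imp_le[OF t(2), where f' = "\<lambda>t. (r t)\<^sup>2"])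
      fix u assume u: "u \<in> {t..s}"
      have "((\<lambda>t. r t + H t) has_real_derivative lam - (r u)\<^sup>2) (at u within I)"
        using sol u t I by (auto simp: riccati_sol_def)
      then have "((\<lambda>t. r t + H t) has_real_derivative lam - (r u)\<^sup>2) (at u within {t..s})"
        by (rule DERIV_subset) (use t I in auto)
      then show "((\<lambda>t. lam * t - (r t + H t)) has_real_derivative (r u)\<^sup>2) (at u within {t..s})"
        using DERIV_diff[OF DERIV_cmult[OF DERIV_ident, of lam]] by fastforce
    qed simp
    moreover have "lam * (s - t) \<le> lam * 1" using lam_pos t by (intro mult_left_mono) (auto simp: s_def)
    ultimately show ?thesis using B[of t] B[of s] by (simp add: algebra_simps abs_le_iff)
  qed
  show ?thesis
  proof (rule bdd_belowI2)
    fix t assume "t \<in> I"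
    then show "min L (r s - 2 * B - lam) \<le> r t" using L[of t] near[of t] I by (cases "t \<le> s") auto
  qed
qed

lemma sol_bdd_above:
  assumes sol: "sol I a" and I: "I = UNIV \<or> (\<exists>tf. I = {..<tf})"
  shows "bdd_above (a ` I)"
proof -
  interpret R: riccati_field lam "\<lambda>t. - H (- t)" by (rule reflected)
  have "bdd_below ((\<lambda>t. - a (- t)) ` uminus ` I)"
    using I by (intro R.sol_bdd_below[OF riccati_sol_reflect[OF sol]]) auto
  then have "bdd_below (uminus ` a ` I)" by (simp add: image_image)
  then show ?thesis by simp
qed

end


section \<open>The three cases\<close>

text \<open>An integral estimate behind hyperbolicity: if \<open>q\<close> tends to \<open>k > 0\<close> at both ends, then
  the integral of \<open>q\<close> over \<open>[s, t]\<close> is at least \<open>k (t - s) / 2\<close> up to an additive constant. The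
  correction \<open>n\<close> below vanishes outside a compact interval.\<close>

lemma exp_integral_estimate:
  fixes P q :: "real \<Rightarrow> real"
  assumes P: "\<And>t. (P has_real_derivative q t) (at t)" and q: "continuous_on UNIV q"
    and "k > 0" "(q \<longlongrightarrow> k) at_bot" "(q \<longlongrightarrow> k) at_top"
  obtains K \<beta> where "K \<ge> 1" "\<beta> > 0" "\<And>s t. s \<le> t \<Longrightarrow> exp (- 2 * (P t - P s)) \<le> K * exp (- \<beta> * (t - s))"
proof -
  have "eventually (\<lambda>t. q t > k / 2) at_bot" "eventually (\<lambda>t. q t > k / 2) at_top"
    using order_tendstoD(1)[OF assms(4), of "k / 2"] order_tendstoD(1)[OF assms(5), of "k / 2"] \<open>k > 0\<close> by auto
  then obtain a b where ab: "\<And>t. t \<le> a \<Longrightarrow> q t > k / 2" "\<And>t. t \<ge> b \<Longrightarrow> q t > k / 2"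
    by (auto simp: eventually_at_bot_linorder eventually_at_top_linorder)
  define a' where "a' = min a b"
  define n where "n t = max 0 (k / 2 - q t)" for t
  have cn: "continuous_on UNIV n" unfolding n_def using q by (intro continuous_intros)
  define N where "N t = (if 0 \<le> t then integral {0..t} n else - integral {t..0} n)" for t
  have N: "(N has_real_derivative n t) (at t)" for t
    unfolding N_def has_real_derivative_iff_has_vector_derivative by (rule antiderivative_on_UNIV[OF cn])
  have N': "(N has_real_derivative n t) (at t within S)" for t S
    using N by (rule has_field_derivative_at_within)
  have P': "(P has_real_derivative q t) (at t within S)" for t S
    using P by (rule has_field_derivative_at_within)
  have mono: "N s \<le> N t" if "s \<le> t" for s t
    by (rule derivative_nonneg_imp_le[OF that N']) (simp add: n_def)
  have anti: "- N s \<le> - N t" if "s \<le> t" "\<And>u. u \<in> {s..t} \<Longrightarrow> n u = 0" for s t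
    by (rule derivative_nonneg_imp_le[OF that(1) DERIV_minus[OF N']]) (use that(2) in simp)
  have zero: "n u = 0" if "u \<le> a' \<or> u \<ge> b" for u
    using ab[of u] that by (auto simp: n_def a'_def)
  have upper: "N t \<le> N b" for t
    using mono[of t b] anti[of b t] zero by (cases "t \<le> b") auto
  have lower: "N a' \<le> N t" for t
    using mono[of a' t] anti[of t a'] zero by (cases "a' \<le> t") auto
  define D where "D = N b - N a'"
  have D: "D \<ge> 0" using lower[of b] by (simp add: D_def)
  show ?thesis
  proof (rule that[of "exp (2 * D)" k])
    show "1 \<le> exp (2 * D)" using D by simp
    show "k > 0" by fact
    fix s t :: real assume "s \<le> t"
    have "P s + N s - (k / 2) * s \<le> P t + N t - (k / 2) * t"
    proof (rule derivative_nonneg_imp_le[OF \<open>s \<le> t\<close>, where f' = "\<lambda>u. q u + n u - k / 2"])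
      show "((\<lambda>u. P u + N u - k / 2 * u) has_real_derivative q u + n u - k / 2) (at u within {s..t})" for u
        using P' N' by (auto intro!: derivative_eq_intros)
      show "0 \<le> q u + n u - k / 2" for u unfolding n_def by linarith
    qed
    then have "- 2 * (P t - P s) \<le> 2 * D - k * (t - s)"
      using upper[of t] lower[of s] by (simp add: D_def algebra_simps)
    then have "exp (- 2 * (P t - P s)) \<le> exp (2 * D - k * (t - s))" by simp
    also have "\<dots> = exp (2 * D) * exp (- k * (t - s))" by (simp flip: exp_add)
    finally show "exp (- 2 * (P t - P s)) \<le> exp (2 * D) * exp (- k * (t - s))" .
  qed
qed

lemma riccati_deriv: "deriv (riccati lam h l) y = - 2 * y"
proof -
  have "(riccati lam h l has_real_derivative - 2 * y) (at y)"
    unfolding riccati_def[abs_def] by (auto intro!: derivative_eq_intros)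
  then show ?thesis by (rule DERIV_imp_deriv)
qed

lemma riccati_deriv_integral:
  assumes P: "\<And>t. (P has_real_derivative b t) (at t)" and b: "continuous_on UNIV b"
  shows "(LBINT l=ereal s..ereal t. deriv (riccati lam h l) (b l)) = - 2 * (P t - P s)"
proof -
  have "(LBINT l=ereal s..ereal t. - 2 * b l) = - 2 * P t - (- 2 * P s)"
  proof (rule interval_integral_FTC_finite)
    show "continuous_on {min s t..max s t} (\<lambda>l. - 2 * b l)"
      using b by (intro continuous_intros continuous_on_subset[OF b]) auto
    fix u assume "min s t \<le> u" "u \<le> max s t"
    have "((\<lambda>u. - 2 * P u) has_real_derivative - 2 * b u) (at u)" by (rule DERIV_cmult[OF P])
    then show "((\<lambda>u. - 2 * P u) has_vector_derivative - 2 * b u) (at u within {min s t..max s t})"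
      unfolding has_real_derivative_iff_has_vector_derivative by (rule has_vector_derivative_at_within)
  qed
  then show ?thesis by (simp add: riccati_deriv)
qed

lemma antiderivative_exists:
  fixes b :: "real \<Rightarrow> real"
  assumes "continuous_on UNIV b"
  obtains P where "\<And>t. (P has_real_derivative b t) (at t)"
  using antiderivative_on_UNIV[OF assms] unfolding has_real_derivative_iff_has_vector_derivative[symmetric]
  by blast

lemma case_C_not_A: "case_C lam h \<Longrightarrow> \<not> case_A lam h"
  unfolding case_C_def case_A_def hyperbolic_attractive_def bounded_solution_def by blast

lemma case_C_not_B: "case_C lam h \<Longrightarrow> \<not> case_B lam h"
  unfolding case_C_def case_B_def bounded_solution_def by blast

lemma case_A_not_B: "case_A lam h \<Longrightarrow> \<not> case_B lam h"
  unfolding case_A_def case_B_def hyperbolic_def by blast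

text \<open>With a forcing \<open>h\<close> of which \<open>H\<close> is a primitive, the classical notions correspond to those for
  Caratheodory solutions. The number \<open>\<mu>\<close> is an initial value at time 0.\<close>

locale riccati_forced = riccati_field +
  fixes h :: "real \<Rightarrow> real" and \<mu> :: real
  assumes prim: "is_primitive h H"
begin

abbreviation f where "f \<equiv> riccati lam h"

lemma solves_iff: "solves_on f I x \<longleftrightarrow> sol I x"
  by (rule solves_on_riccati_iff[OF prim])

lemma maximal_imp_maximal_solution:
  assumes "maximal I x"
  shows "maximal_solution f I x"
proof -
  obtain s where "s \<in> I" using assms unfolding maximal_def by blast
  then show ?thesis using assms unfolding maximal_def maximal_solution_def solves_iff by blast
qed

lemma maximal_exists:
  obtains I x where "maximal I x" "s \<in> I" "x s = x0"
proof -
  obtain I x where "open I" "s \<in> I" "sol I x" "x s = x0"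
    "\<And>J x' t. sol J x' \<Longrightarrow> t \<in> I \<inter> J \<Longrightarrow> x' t = x t \<Longrightarrow> J \<subseteq> I"
    by (rule maximal_sol[of s x0]) blast
  then show ?thesis using that unfolding maximal_def by blast
qed

text \<open>Solutions on a half-line are automatically bounded.\<close>

lemma bounded_at_minus_infinity_iff: "bounded_at_minus_infinity f s x0 \<longleftrightarrow> x0 \<in> backward_set s"
proof
  assume "bounded_at_minus_infinity f s x0"
  then obtain I x where "sol I x" "{..s} \<subseteq> I" "x s = x0"
    unfolding bounded_at_minus_infinity_def maximal_solution_def solves_iff by blast
  then show "x0 \<in> backward_set s"
    unfolding backward_set_def using riccati_sol_subset[of lam H I x "{..s}"] by (auto simp: is_interval_1)
next
  assume "x0 \<in> backward_set s"
  then obtain x where x: "sol {..s} x" "x s = x0" unfolding backward_set_def by blast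
  obtain I y where y: "maximal I y" "s \<in> I" "y s = x0" by (rule maximal_exists)
  have sub: "{..s} \<subseteq> I" using y x unfolding maximal_def by (metis IntI atMost_iff order_refl)
  have "sol {..s} y"
    using y(1) sub riccati_sol_subset[of lam H I y "{..s}"] unfolding maximal_def by (simp add: is_interval_1)
  then show "bounded_at_minus_infinity f s x0"
    unfolding bounded_at_minus_infinity_def
    using maximal_imp_maximal_solution[OF y(1)] sub y(3) sol_bounded_bot by blast
qed

lemma bounded_at_plus_infinity_iff: "bounded_at_plus_infinity f s x0 \<longleftrightarrow> x0 \<in> forward_set s"
proof
  assume "bounded_at_plus_infinity f s x0"
  then obtain I x where "sol I x" "{s..} \<subseteq> I" "x s = x0"
    unfolding bounded_at_plus_infinity_def maximal_solution_def solves_iff by blast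
  then show "x0 \<in> forward_set s" using sol_forward_set by blast
next
  assume "x0 \<in> forward_set s"
  then obtain x where x: "sol {s..} x" "x s = x0" unfolding forward_set_def by blast
  obtain I y where y: "maximal I y" "s \<in> I" "y s = x0" by (rule maximal_exists)
  have sub: "{s..} \<subseteq> I" using y x unfolding maximal_def by (metis IntI atLeast_iff order_refl)
  have "sol {s..} y"
    using y(1) sub riccati_sol_subset[of lam H I y "{s..}"] unfolding maximal_def by (simp add: is_interval_1)
  then show "bounded_at_plus_infinity f s x0"
    unfolding bounded_at_plus_infinity_def
    using maximal_imp_maximal_solution[OF y(1)] sub y(3) sol_bounded_top by blast
qed

lemma attractor_pullback_attractor:
  assumes "attractor I a"
  shows "pullback_attractor f I a"
proof -
  have a: "maximal I a" "I = UNIV \<or> (\<exists>tf. I = {..<tf})" "\<forall>t\<in>I. backward_set t = {..a t}"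
    using assms unfolding attractor_def by blast+
  then have "bdd_above (a ` I)" by (intro sol_bdd_above) (simp_all add: maximal_def)
  then show ?thesis
    unfolding pullback_attractor_def bounded_at_minus_infinity_iff
    using maximal_imp_maximal_solution[OF a(1)] a(2,3) by simp
qed

lemma repeller_pullback_repeller:
  assumes "repeller I r"
  shows "pullback_repeller f I r"
proof -
  have r: "maximal I r" "I = UNIV \<or> (\<exists>t0. I = {t0<..})" "\<forall>t\<in>I. forward_set t = {r t..}"
    using assms unfolding repeller_def by blast+
  then have "bdd_below (r ` I)" by (intro sol_bdd_below) (simp_all add: maximal_def)
  then show ?thesis
    unfolding pullback_repeller_def bounded_at_plus_infinity_iff
    using maximal_imp_maximal_solution[OF r(1)] r(2,3) by simp
qed

lemma bounded_solution_iff: "bounded_solution f b \<longleftrightarrow> sol UNIV b"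
proof
  assume b: "sol UNIV b"
  then have "sol {..0} b" "sol {0..} b"
    using riccati_sol_subset[OF b] by (auto simp: is_interval_1)
  then have "bounded (b ` {..0} \<union> b ` {0..})" using sol_bounded_bot sol_bounded_top by simp
  moreover have "b ` {..0} \<union> b ` {0..} = range b"
    unfolding image_Un[symmetric] by (rule arg_cong[where f = "\<lambda>S. b ` S"]) auto
  ultimately show "bounded_solution f b" using b by (simp add: bounded_solution_def solves_iff)
qed (simp add: bounded_solution_def solves_iff)

lemma repeller_exists:
  obtains I r where "repeller I r"
proof -
  obtain T where "\<And>s. s \<ge> T \<Longrightarrow> \<exists>m. forward_set s = {m..}" by (rule forward_set_has_min) blast
  then obtain m where "forward_set T = {m..}" by blast
  then show ?thesis using repeller_through that by blast
qed

text \<open>The assumption \<open>backward_set 0 = {..\<mu>}\<close> says that \<open>\<mu>\<close> is the value of the pullback attractor at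
  time 0. Then the solution through \<open>(0, \<mu>)\<close> on the positive half-line decides the case.\<close>

lemma attractor_of_forward_sol:
  assumes bwd: "backward_set 0 = {..\<mu>}" and x: "sol {0..} x" "x 0 = \<mu>"
  obtains a where "attractor UNIV a" "sol UNIV a" "a 0 = \<mu>" "\<And>t. t \<ge> 0 \<Longrightarrow> a t = x t"
proof -
  obtain I a where att: "attractor I a" "0 \<in> I" "a 0 = \<mu>" using attractor_through[OF bwd] by blast
  have a: "sol I a" "\<And>J x' t. sol J x' \<Longrightarrow> t \<in> I \<inter> J \<Longrightarrow> x' t = a t \<Longrightarrow> J \<subseteq> I"
    "I = UNIV \<or> (\<exists>tf. I = {..<tf})"
    using att(1) unfolding attractor_def maximal_def by blast+
  have sub: "{0..} \<subseteq> I" using a(2)[OF x(1), of 0] att(2,3) x(2) by simp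
  have I: "I = UNIV"
  proof (rule ccontr)
    assume "I \<noteq> UNIV"
    then obtain tf where tf: "I = {..<tf}" using a(3) by blast
    then have "max 0 tf \<notin> I" by simp
    then show False using sub by (meson atLeast_iff max.cobounded1 subsetD)
  qed
  have "a t = x t" if "t \<ge> 0" for t
    by (rule sol_unique[OF a(1) x(1), of 0]) (use att(3) x(2) I that in auto)
  then show ?thesis using that[of a] att(1,3) a(1) I by simp
qed

theorem case_C_if_no_forward_sol:
  assumes bwd: "backward_set 0 = {..\<mu>}" and no: "\<mu> \<notin> forward_set 0"
  shows "case_C lam h"
proof -
  obtain I a where a: "attractor I a" using attractor_through[OF bwd] by blast
  have noglobal: "\<not> sol UNIV x" for x
  proof
    assume x: "sol UNIV x"
    then have "x 0 \<in> forward_set 0" by (rule sol_forward_set) simp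
    moreover have "x 0 \<in> backward_set 0"
      using riccati_sol_subset[OF x, of "{..0}"] by (auto simp: backward_set_def is_interval_1)
    ultimately show False using bwd no forward_set_up_closed by auto
  qed
  then obtain tf where tf: "I = {..<tf}" "filterlim a at_bot (at_left tf)"
    using a unfolding attractor_def maximal_def by blast
  obtain J r where r: "repeller J r" by (rule repeller_exists)
  then obtain t0 where t0: "J = {t0<..}" "filterlim r at_top (at_right t0)"
    using noglobal unfolding repeller_def maximal_def by blast
  have "pullback_attractor f {..<tf} a" using attractor_pullback_attractor[OF a] tf by simp
  moreover have "pullback_repeller f {t0<..} r" using repeller_pullback_repeller[OF r] t0 by simp
  ultimately show ?thesis
    unfolding case_C_def solves_iff using noglobal tf(2) t0(2) by blast
qed

lemma hyperbolic_attractiveI: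
  assumes "sol UNIV a" "(a \<longlongrightarrow> c) at_bot" "(a \<longlongrightarrow> c) at_top"
  shows "hyperbolic_attractive f a"
proof -
  have ca: "continuous_on UNIV a" using assms(1) by (rule sol_continuous_on)
  obtain P where P: "\<And>t. (P has_real_derivative a t) (at t)" using antiderivative_exists[OF ca] by blast
  obtain K \<beta> where "K \<ge> 1" "\<beta> > 0" "\<And>s t. s \<le> t \<Longrightarrow> exp (- 2 * (P t - P s)) \<le> K * exp (- \<beta> * (t - s))"
    using exp_integral_estimate[OF P ca c_pos assms(2,3)] by blast
  then show ?thesis
    unfolding hyperbolic_attractive_def riccati_deriv_integral[OF P ca] bounded_solution_iff
    using assms(1) by blast
qed

lemma hyperbolic_repellingI:
  assumes "sol UNIV r" "(r \<longlongrightarrow> - c) at_bot" "(r \<longlongrightarrow> - c) at_top"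
  shows "hyperbolic_repelling f r"
proof -
  have cr: "continuous_on UNIV r" using assms(1) by (rule sol_continuous_on)
  obtain P where P: "\<And>t. (P has_real_derivative r t) (at t)" using antiderivative_exists[OF cr] by blast
  have "\<And>t. ((\<lambda>t. - P t) has_real_derivative - r t) (at t)" by (rule DERIV_minus[OF P])
  moreover have "continuous_on UNIV (\<lambda>t. - r t)" using cr by (rule continuous_on_minus)
  moreover have "((\<lambda>t. - r t) \<longlongrightarrow> c) at_bot" "((\<lambda>t. - r t) \<longlongrightarrow> c) at_top"
    using tendsto_minus[OF assms(2)] tendsto_minus[OF assms(3)] by auto
  ultimately obtain K \<beta> where K: "K \<ge> 1" "\<beta> > 0"
    "\<And>s t. s \<le> t \<Longrightarrow> exp (- 2 * (- P t - - P s)) \<le> K * exp (- \<beta> * (t - s))"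
    using exp_integral_estimate[OF _ _ c_pos, of "\<lambda>t. - P t" "\<lambda>t. - r t"] by blast
  have "exp (- 2 * (P t - P s)) \<le> K * exp (\<beta> * (t - s))" if "t \<le> s" for s t
    using K(3)[OF that] by (simp add: algebra_simps)
  then show ?thesis
    unfolding hyperbolic_repelling_def riccati_deriv_integral[OF P cr] bounded_solution_iff
    using assms(1) K(1,2) by blast
qed

theorem case_A_if_forward_limit:
  assumes bwd: "backward_set 0 = {..\<mu>}" and x: "sol {0..} x" "x 0 = \<mu>" "(x \<longlongrightarrow> c) at_top"
  shows "case_A lam h"
proof -
  obtain a where att: "attractor UNIV a" and sola: "sol UNIV a" and a0: "a 0 = \<mu>"
    and ax: "\<And>t. t \<ge> 0 \<Longrightarrow> a t = x t"
    using attractor_of_forward_sol[OF bwd x(1,2)] by blast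
  have abot: "(a \<longlongrightarrow> c) at_bot" using att by (simp add: attractor_def)
  have atop: "(a \<longlongrightarrow> c) at_top"
    using x(3) by (rule Lim_transform_eventually)
      (use ax in \<open>auto simp: eventually_at_top_linorder intro!: exI[of _ 0]\<close>)
  obtain J r where rep: "repeller J r" by (rule repeller_exists)
  then have solr: "sol J r" and rtop: "(r \<longlongrightarrow> - c) at_top"
    and fwd: "\<And>t. t \<in> J \<Longrightarrow> forward_set t = {r t..}"
    unfolding repeller_def maximal_def by blast+
  have le: "r t \<le> a t" if "t \<in> J" for t
    using sol_forward_set[OF sola, of t] fwd[OF that] by simp
  have J: "J = UNIV"
  proof (rule ccontr)
    assume "J \<noteq> UNIV"
    then obtain t0 where t0: "J = {t0<..}" "filterlim r at_top (at_right t0)"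
      using rep unfolding repeller_def by blast
    have "isCont a t0" using sol_continuous_on[OF sola] by (simp add: continuous_on_eq_continuous_at)
    then have "(a \<longlongrightarrow> a t0) (at_right t0)" by (simp add: isCont_def filterlim_at_split)
    then have "eventually (\<lambda>t. a t < a t0 + 1) (at_right t0)" by (rule order_tendstoD) simp
    moreover have "eventually (\<lambda>t. r t > a t0 + 1) (at_right t0)"
      using t0(2) by (simp add: filterlim_at_top_dense)
    ultimately have "eventually (\<lambda>t. False) (at_right t0)"
      using eventually_at_right_less[of t0]
    proof eventually_elim
      case (elim t)
      then show False using le[of t] t0(1) by simp
    qed
    then show False by simp
  qed
  have "r 0 \<noteq> \<mu>"
  proof
    assume "r 0 = \<mu>"
    then have "r t = a t" for t using sol_unique[OF solr sola, of 0 t] J a0 by simp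
    then have "r = a" by blast
    then have "c = - c" using tendsto_unique[OF trivial_limit_at_top_linorder atop] rtop by blast
    then show False using c_pos by simp
  qed
  have "sol {..0} r" "sol {..0} a"
    using riccati_sol_subset[OF solr] riccati_sol_subset[OF sola] J by (auto simp: is_interval_1)
  then have rbot: "(r \<longlongrightarrow> - c) at_bot"
    using sol_asymptotic_bot sol_unique_high a0 abot \<open>r 0 \<noteq> \<mu>\<close> by blast
  have "pullback_attractor f UNIV a" by (rule attractor_pullback_attractor[OF att])
  moreover have "pullback_repeller f UNIV r"
    using repeller_pullback_repeller[OF rep] J by simp
  moreover have "hyperbolic_attractive f a" by (rule hyperbolic_attractiveI[OF sola abot atop])
  moreover have "hyperbolic_repelling f r"
    using hyperbolic_repellingI[OF _ rbot rtop] solr J by simp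
  ultimately show ?thesis unfolding case_A_def using abot atop rbot rtop by blast
qed

text \<open>A solution which runs from \<open>c\<close> to \<open>-c\<close> is not hyperbolic: its integral over \<open>[0, t]\<close> is
  bounded above for \<open>t > 0\<close>, and that over \<open>[t, 0]\<close> is bounded below for \<open>t < 0\<close>.\<close>

lemma not_hyperbolic:
  assumes sol: "sol UNIV a" and "(a \<longlongrightarrow> c) at_bot" "(a \<longlongrightarrow> - c) at_top"
  shows "\<not> hyperbolic f a"
proof -
  have ca: "continuous_on UNIV a" using sol by (rule sol_continuous_on)
  obtain P where P: "\<And>t. (P has_real_derivative a t) (at t)" using antiderivative_exists[OF ca] by blast
  have P': "(P has_real_derivative a t) (at t within S)" for t S
    using P by (rule has_field_derivative_at_within)
  have Kexp: "((\<lambda>t. K * exp (- \<beta> * t)) \<longlongrightarrow> 0) at_top" if "\<beta> > 0" for K \<beta> :: real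
  proof -
    have "filterlim (\<lambda>t. - \<beta> * t) at_bot at_top"
      using that by (intro filterlim_tendsto_neg_mult_at_bot[OF tendsto_const _ filterlim_ident]) simp
    then have "((\<lambda>t. exp (- \<beta> * t)) \<longlongrightarrow> 0) at_top" by (rule filterlim_compose[OF exp_at_bot])
    from tendsto_mult_left[OF this, of K] show ?thesis by simp
  qed
  have "eventually (\<lambda>t. a t < 0) at_top" using order_tendstoD(2)[OF assms(3), of 0] c_pos by simp
  then obtain T where T: "\<And>t. t \<ge> T \<Longrightarrow> a t < 0" by (auto simp: eventually_at_top_linorder)
  have decr: "P t \<le> P T" if "T \<le> t" for t
    using derivative_nonneg_imp_le[OF that DERIV_minus[OF P']] T by (fastforce intro: less_imp_le)
  have "\<not> hyperbolic_attractive f a"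
  proof
    assume "hyperbolic_attractive f a"
    then obtain K \<beta> where K: "\<beta> > 0" "\<And>t. 0 \<le> t \<Longrightarrow> exp (- 2 * (P t - P 0)) \<le> K * exp (- \<beta> * (t - 0))"
      unfolding hyperbolic_attractive_def riccati_deriv_integral[OF P ca] by blast
    have "eventually (\<lambda>t. exp (- 2 * (P T - P 0)) \<le> K * exp (- \<beta> * t)) at_top"
      using eventually_ge_at_top[of T] eventually_ge_at_top[of 0]
    proof eventually_elim
      case (elim t)
      have "exp (- 2 * (P T - P 0)) \<le> exp (- 2 * (P t - P 0))" using decr[OF elim(1)] by simp
      also have "\<dots> \<le> K * exp (- \<beta> * t)" using K(2)[OF elim(2)] by (simp only: diff_zero)
      finally show ?case .
    qed
    then have "exp (- 2 * (P T - P 0)) \<le> 0" using Kexp[OF K(1), of K] by (intro tendsto_lowerbound) auto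
    then show False using exp_gt_zero not_le by blast
  qed
  moreover have "\<not> hyperbolic_repelling f a"
  proof
    have "eventually (\<lambda>t. a t > 0) at_bot" using order_tendstoD(1)[OF assms(2), of 0] c_pos by simp
    then obtain S where S: "\<And>t. t \<le> S \<Longrightarrow> a t > 0" by (auto simp: eventually_at_bot_linorder)
    have incr: "P t \<le> P S" if "t \<le> S" for t
      using derivative_nonneg_imp_le[OF that P'] S by (fastforce intro: less_imp_le)
    assume "hyperbolic_repelling f a"
    then obtain K \<beta> where K: "\<beta> > 0" "\<And>t. t \<le> 0 \<Longrightarrow> exp (- 2 * (P t - P 0)) \<le> K * exp (\<beta> * (t - 0))"
      unfolding hyperbolic_repelling_def riccati_deriv_integral[OF P ca] by blast
    have "eventually (\<lambda>t. exp (- 2 * (P S - P 0)) \<le> K * exp (- \<beta> * t)) at_top"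
      using eventually_ge_at_top[of "- S"] eventually_ge_at_top[of 0]
    proof eventually_elim
      case (elim t)
      have "exp (- 2 * (P S - P 0)) \<le> exp (- 2 * (P (- t) - P 0))" using incr[of "- t"] elim by simp
      also have "\<dots> \<le> K * exp (- \<beta> * t)" using K(2)[of "- t"] elim by (simp add: algebra_simps)
      finally show ?case .
    qed
    then have "exp (- 2 * (P S - P 0)) \<le> 0" using Kexp[OF K(1), of K] by (intro tendsto_lowerbound) auto
    then show False using exp_gt_zero not_le by blast
  qed
  ultimately show ?thesis by (simp add: hyperbolic_def)
qed

theorem case_B_if_forward_limit:
  assumes bwd: "backward_set 0 = {..\<mu>}" and x: "sol {0..} x" "x 0 = \<mu>" "(x \<longlongrightarrow> - c) at_top"
  shows "case_B lam h"
proof -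
  obtain a where att: "attractor UNIV a" and sola: "sol UNIV a" and a0: "a 0 = \<mu>"
    and ax: "\<And>t. t \<ge> 0 \<Longrightarrow> a t = x t"
    using attractor_of_forward_sol[OF bwd x(1,2)] by blast
  have abot: "(a \<longlongrightarrow> c) at_bot" using att by (simp add: attractor_def)
  have atop: "(a \<longlongrightarrow> - c) at_top"
    using x(3) by (rule Lim_transform_eventually)
      (use ax in \<open>auto simp: eventually_at_top_linorder intro!: exI[of _ 0]\<close>)
  obtain J r where rep: "repeller J r" by (rule repeller_exists)
  then have solr: "sol J r" and rtop: "(r \<longlongrightarrow> - c) at_top"
    and max: "\<And>J' x' t. sol J' x' \<Longrightarrow> t \<in> J \<inter> J' \<Longrightarrow> x' t = r t \<Longrightarrow> J' \<subseteq> J"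
    and fwd: "\<And>t. t \<in> J \<Longrightarrow> forward_set t = {r t..}"
    unfolding repeller_def maximal_def by blast+
  obtain s where s: "{s..} \<subseteq> J"
  proof -
    consider "J = UNIV" | t0 where "J = {t0<..}" using rep unfolding repeller_def by blast
    then show ?thesis
    proof cases
      case 1
      then show ?thesis using that[of 0] by simp
    next
      case (2 t0)
      then have "{t0 + 1..} \<subseteq> J" by auto
      then show ?thesis by (rule that)
    qed
  qed
  have "sol {s..} r" "sol {s..} a"
    using riccati_sol_subset[OF solr _ s] riccati_sol_subset[OF sola, of "{s..}"] by (auto simp: is_interval_1)
  then have eqs: "r s = a s" using sol_unique_low rtop atop by blast
  have "s \<in> J" using s by auto
  then have J: "J = UNIV" using max[OF sola, of s] eqs by auto
  have "r t = a t" for t using sol_unique[OF solr sola, of s t] J eqs by simp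
  then have ra: "r = a" by blast
  have bdd: "bounded_solution f b \<longleftrightarrow> b = a" for b
    unfolding bounded_solution_iff
  proof
    assume b: "sol UNIV b"
    have "b t = a t" for t
    proof (rule antisym)
      have "b t \<in> backward_set t"
        using riccati_sol_subset[OF b, of "{..t}"] by (auto simp: backward_set_def is_interval_1)
      then show "b t \<le> a t" using att by (simp add: attractor_def)
      show "a t \<le> b t" using sol_forward_set[OF b, of t] fwd[of t] J ra by simp
    qed
    then show "b = a" by blast
  qed (simp add: sola)
  have "\<not> hyperbolic f b" for b
  proof
    assume "hyperbolic f b"
    then have "bounded_solution f b"
      by (auto simp: hyperbolic_def hyperbolic_attractive_def hyperbolic_repelling_def)
    then have "b = a" by (simp add: bdd)
    then show False using \<open>hyperbolic f b\<close> not_hyperbolic[OF sola abot atop] by simp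
  qed
  moreover have "pullback_attractor f UNIV a" by (rule attractor_pullback_attractor[OF att])
  moreover have "pullback_repeller f UNIV a"
    using repeller_pullback_repeller[OF rep] J ra by simp
  ultimately show ?thesis unfolding case_B_def using bdd abot atop by blast
qed

end

section \<open>Continuous dependence on the forcing\<close>

text \<open>The energy \<open>e\<^sup>2 + f\<^sup>2\<close> of the difference of two linear solutions satisfies a Gronwall
  inequality.\<close>

lemma energy_estimate:
  fixes e f :: "real \<Rightarrow> real"
  assumes "0 \<le> T" and K: "K \<ge> 0" and m: "m \<ge> 0"
    and e: "\<And>t. (e has_real_derivative e' t) (at t)" and f: "\<And>t. (f has_real_derivative f' t) (at t)"
    and init: "e 0 = 0" "f 0 = 0"
    and e': "\<And>t. t \<in> {0..T} \<Longrightarrow> \<bar>e' t\<bar> \<le> K * (\<bar>e t\<bar> + \<bar>f t\<bar>) + m"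
    and f': "\<And>t. t \<in> {0..T} \<Longrightarrow> \<bar>f' t\<bar> \<le> K * (\<bar>e t\<bar> + \<bar>f t\<bar>) + m"
    and t: "t \<in> {0..T}"
  shows "\<bar>e t\<bar> \<le> m * exp ((2 * K + 1) * T)" "\<bar>f t\<bar> \<le> m * exp ((2 * K + 1) * T)"
proof -
  define k where "k = 4 * K + 2"
  have "- ((e t)\<^sup>2 + (f t)\<^sup>2 + m\<^sup>2) \<ge> - ((e 0)\<^sup>2 + (f 0)\<^sup>2 + m\<^sup>2) * exp (integral {0..t} (\<lambda>_. k))"
  proof (rule gronwall_lower[where D = "\<lambda>u. - (2 * e u * e' u + 2 * f u * f' u)"])
    show "0 \<le> t" using t by simp
    fix u assume u: "u \<in> {0..t}"
    have "(e has_real_derivative e' u) (at u within {0..t})" "(f has_real_derivative f' u) (at u within {0..t})"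
      using e f by (auto intro: has_field_derivative_at_within)
    then show "((\<lambda>u. - ((e u)\<^sup>2 + (f u)\<^sup>2 + m\<^sup>2)) has_real_derivative - (2 * e u * e' u + 2 * f u * f' u))
        (at u within {0..t})"
      by (auto intro!: derivative_eq_intros)
    have uT: "u \<in> {0..T}" using u t by auto
    define s where "s = \<bar>e u\<bar> + \<bar>f u\<bar>"
    have s2: "s\<^sup>2 \<le> 2 * ((e u)\<^sup>2 + (f u)\<^sup>2)"
    proof -
      have "0 \<le> (\<bar>e u\<bar> - \<bar>f u\<bar>)\<^sup>2" by simp
      then show ?thesis by (simp add: s_def power2_eq_square algebra_simps)
    qed
    have "2 * e u * e' u + 2 * f u * f' u \<le> 2 * (\<bar>e u\<bar> * \<bar>e' u\<bar>) + 2 * (\<bar>f u\<bar> * \<bar>f' u\<bar>)"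
      using abs_ge_self[of "e u * e' u"] abs_ge_self[of "f u * f' u"] by (simp add: abs_mult)
    also have "\<dots> \<le> 2 * (\<bar>e u\<bar> * (K * s + m)) + 2 * (\<bar>f u\<bar> * (K * s + m))"
      using e'[OF uT] f'[OF uT] unfolding s_def by (intro add_mono mult_left_mono) auto
    also have "\<dots> = 2 * K * s\<^sup>2 + 2 * m * s" by (simp add: s_def power2_eq_square algebra_simps)
    also have "\<dots> \<le> 2 * K * s\<^sup>2 + (m\<^sup>2 + s\<^sup>2)"
    proof -
      have "0 \<le> (m - s)\<^sup>2" by simp
      then show ?thesis by (simp add: power2_eq_square algebra_simps)
    qed
    also have "\<dots> = (2 * K + 1) * s\<^sup>2 + m\<^sup>2" by (simp add: algebra_simps)
    also have "\<dots> \<le> (2 * K + 1) * (2 * ((e u)\<^sup>2 + (f u)\<^sup>2)) + k * m\<^sup>2"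
      using s2 K by (intro add_mono mult_left_mono) (auto simp: k_def mult_le_cancel_right1 algebra_simps)
    finally show "k * - ((e u)\<^sup>2 + (f u)\<^sup>2 + m\<^sup>2) \<le> - (2 * e u * e' u + 2 * f u * f' u)"
      by (simp add: k_def algebra_simps)
  qed (intro continuous_intros)
  then have "(e t)\<^sup>2 + (f t)\<^sup>2 + m\<^sup>2 \<le> m\<^sup>2 * exp (k * t)" using t init by (simp add: mult.commute)
  also have "\<dots> \<le> m\<^sup>2 * exp (k * T)" using t K by (intro mult_left_mono) (auto simp: k_def intro!: mult_left_mono)
  also have "\<dots> = (m * exp ((2 * K + 1) * T))\<^sup>2"
    by (simp add: power_mult_distrib k_def algebra_simps flip: exp_double)
  finally have *: "(e t)\<^sup>2 + (f t)\<^sup>2 + m\<^sup>2 \<le> (m * exp ((2 * K + 1) * T))\<^sup>2" .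
  have "(e t)\<^sup>2 \<le> (m * exp ((2 * K + 1) * T))\<^sup>2" "(f t)\<^sup>2 \<le> (m * exp ((2 * K + 1) * T))\<^sup>2"
    using * zero_le_power2[of "e t"] zero_le_power2[of "f t"] zero_le_power2[of m] by linarith+
  then show "\<bar>e t\<bar> \<le> m * exp ((2 * K + 1) * T)" "\<bar>f t\<bar> \<le> m * exp ((2 * K + 1) * T)"
    using m by (auto intro: power2_le_imp_le simp: abs_le_square_iff)
qed

lemma linear_sol_continuous_dependence:
  assumes lin0: "linear_sol lam H0 y0 p0" and "lam > 0" and B: "\<And>t. \<bar>H0 t\<bar> \<le> B"
    and "T \<ge> 0" "\<epsilon> > 0"
  obtains \<delta> where "\<delta> > 0"
    "\<And>H y p t. (\<And>t. t \<in> {0..T} \<Longrightarrow> \<bar>H t - H0 t\<bar> \<le> \<delta>) \<Longrightarrow> linear_sol lam H y p \<Longrightarrow>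
       y 0 = y0 0 \<Longrightarrow> p 0 = p0 0 \<Longrightarrow> t \<in> {0..T} \<Longrightarrow> \<bar>y t - y0 t\<bar> < \<epsilon> \<and> \<bar>p t - p0 t\<bar> < \<epsilon>"
proof -
  have "compact (y0 ` {0..T})" "compact (p0 ` {0..T})"
    using linear_sol_continuous_on[OF lin0] by (auto intro: compact_continuous_image)
  then obtain N1 N2 where N12: "\<And>t. t \<in> {0..T} \<Longrightarrow> \<bar>y0 t\<bar> \<le> N1" "\<And>t. t \<in> {0..T} \<Longrightarrow> \<bar>p0 t\<bar> \<le> N2"
    using compact_imp_bounded bounded_iff by (metis imageI real_norm_def)
  define N where "N = max N1 N2"
  have N: "\<bar>y0 t\<bar> \<le> N" "\<bar>p0 t\<bar> \<le> N" if "t \<in> {0..T}" for t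
    using N12[OF that] by (auto simp: N_def)
  have N0: "N \<ge> 0" using N(1)[of 0] \<open>T \<ge> 0\<close> by simp
  have B0: "B \<ge> 0" using B[of 0] by simp
  define b where "b = B + 1"
  define K where "K = 1 + b + (lam + b\<^sup>2)"
  define M where "M = N * (2 * b + 1)"
  define X where "X = exp ((2 * K + 1) * T)"
  have pos: "b \<ge> 0" "K \<ge> 0" "M \<ge> 0" "X > 0"
    using B0 N0 \<open>lam > 0\<close> by (auto simp: b_def K_def M_def X_def)
  define \<delta> where "\<delta> = min 1 (\<epsilon> / (M * X + 1))"
  have MX: "M * X + 1 > 0" using pos by (simp add: add_nonneg_pos)
  have \<delta>: "\<delta> > 0" "\<delta> \<le> 1" using \<open>\<epsilon> > 0\<close> MX by (auto simp: \<delta>_def)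
  have small: "\<delta> * M * X < \<epsilon>"
  proof -
    have "\<delta> * (M * X) \<le> (\<epsilon> / (M * X + 1)) * (M * X)"
      using pos by (intro mult_right_mono) (auto simp: \<delta>_def)
    also have "\<dots> < \<epsilon>" using \<open>\<epsilon> > 0\<close> MX by (simp add: field_simps)
    finally show ?thesis by (simp add: mult.assoc)
  qed
  show ?thesis
  proof (rule that[OF \<delta>(1)])
    fix H y p t
    assume close: "\<And>t. t \<in> {0..T} \<Longrightarrow> \<bar>H t - H0 t\<bar> \<le> \<delta>" and lin: "linear_sol lam H y p"
      and init: "y 0 = y0 0" "p 0 = p0 0" and t: "t \<in> {0..T}"
    define e where "e t = y t - y0 t" for t
    define f where "f t = p t - p0 t" for t
    define e' where "e' t = f t - H t * e t - (H t - H0 t) * y0 t" for t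
    define f' where "f' t = (lam - (H t)\<^sup>2) * e t + H t * f t - ((H t)\<^sup>2 - (H0 t)\<^sup>2) * y0 t + (H t - H0 t) * p0 t" for t
    have de: "(e has_real_derivative e' t) (at t)" and df: "(f has_real_derivative f' t) (at t)" for t
      using lin lin0 unfolding linear_sol_def e_def[abs_def] f_def[abs_def] e'_def f'_def
      by (auto intro!: derivative_eq_intros simp: algebra_simps)
    have Hb: "\<bar>H t\<bar> \<le> b" if "t \<in> {0..T}" for t
      using close[OF that] B[of t] \<delta>(2) by (simp add: b_def)
    have prod: "\<bar>u * v\<bar> \<le> U * V" if "\<bar>u\<bar> \<le> U" "\<bar>v\<bar> \<le> V" for u v U V :: real
      unfolding abs_mult using that by (intro mult_mono) auto
    have e'b: "\<bar>e' t\<bar> \<le> K * (\<bar>e t\<bar> + \<bar>f t\<bar>) + \<delta> * M" if t: "t \<in> {0..T}" for t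
    proof -
      have "\<bar>e' t\<bar> \<le> \<bar>f t\<bar> + \<bar>H t * e t\<bar> + \<bar>(H t - H0 t) * y0 t\<bar>" unfolding e'_def by linarith
      also have "\<dots> \<le> \<bar>f t\<bar> + b * \<bar>e t\<bar> + \<delta> * N"
        by (intro add_mono prod Hb t close N) auto
      also have "\<dots> \<le> K * \<bar>f t\<bar> + K * \<bar>e t\<bar> + \<delta> * M"
        using pos \<open>lam > 0\<close> N0 \<delta>
        by (intro add_mono mult_right_mono mult_left_mono)
          (auto simp: K_def M_def mult_le_cancel_right1 mult_le_cancel_left1)
      finally show ?thesis by (simp add: algebra_simps)
    qed
    have f'b: "\<bar>f' t\<bar> \<le> K * (\<bar>e t\<bar> + \<bar>f t\<bar>) + \<delta> * M" if t: "t \<in> {0..T}" for t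
    proof -
      have "\<bar>f' t\<bar> \<le> \<bar>(lam - (H t)\<^sup>2) * e t\<bar> + \<bar>H t * f t\<bar> + \<bar>((H t)\<^sup>2 - (H0 t)\<^sup>2) * y0 t\<bar> + \<bar>(H t - H0 t) * p0 t\<bar>"
        unfolding f'_def by linarith
      also have "\<dots> \<le> (lam + b\<^sup>2) * \<bar>e t\<bar> + b * \<bar>f t\<bar> + (\<delta> * (2 * b)) * N + \<delta> * N"
      proof (intro add_mono prod Hb t close N)
        have "(H t)\<^sup>2 \<le> b\<^sup>2" using power_mono[OF Hb[OF t], of 2] by simp
        then show "\<bar>lam - (H t)\<^sup>2\<bar> \<le> lam + b\<^sup>2"
          using abs_triangle_ineq4[of lam "(H t)\<^sup>2"] \<open>lam > 0\<close> by simp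
        have "\<bar>H t + H0 t\<bar> \<le> 2 * b" using Hb[OF t] B[of t] by (simp add: b_def)
        from prod[OF close[OF t] this] show "\<bar>(H t)\<^sup>2 - (H0 t)\<^sup>2\<bar> \<le> \<delta> * (2 * b)"
          by (simp add: power2_eq_square algebra_simps)
      qed auto
      also have "\<dots> \<le> K * \<bar>e t\<bar> + K * \<bar>f t\<bar> + \<delta> * M"
      proof -
        have "(lam + b\<^sup>2) * \<bar>e t\<bar> \<le> K * \<bar>e t\<bar>" "b * \<bar>f t\<bar> \<le> K * \<bar>f t\<bar>"
          using pos \<open>lam > 0\<close> by (auto intro!: mult_right_mono simp: K_def)
        moreover have "(\<delta> * (2 * b)) * N + \<delta> * N = \<delta> * M" by (simp add: M_def algebra_simps)
        ultimately show ?thesis by linarith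
      qed
      finally show ?thesis by (simp add: algebra_simps)
    qed
    have "\<bar>e t\<bar> \<le> \<delta> * M * X" "\<bar>f t\<bar> \<le> \<delta> * M * X"
      unfolding X_def
      using energy_estimate[OF \<open>T \<ge> 0\<close> pos(2) _ de df _ _ e'b f'b t] \<delta> pos init
      by (auto simp: e_def f_def)
    then show "\<bar>y t - y0 t\<bar> < \<epsilon> \<and> \<bar>p t - p0 t\<bar> < \<epsilon>" using small by (auto simp: e_def f_def)
  qed
qed

text \<open>The solution through \<open>(0, \<mu>)\<close> exists for all future times.\<close>

definition survives :: "real \<Rightarrow> (real \<Rightarrow> real) \<Rightarrow> real \<Rightarrow> bool" where
  "survives lam H \<mu> \<longleftrightarrow> (\<exists>x. riccati_sol lam H {0..} x \<and> x 0 = \<mu>)"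

lemma (in riccati_field) survives_iff: "survives lam H \<mu> \<longleftrightarrow> \<mu> \<in> forward_set 0"
  by (simp add: survives_def forward_set_def)

lemma (in riccati_field) survives_iff_linear:
  assumes "linear_sol lam H y p" "y 0 = 1" "p 0 = \<mu> + H 0"
  shows "survives lam H \<mu> \<longleftrightarrow> (\<forall>t\<ge>0. y t > 0)"
  unfolding survives_def using sol_exists_iff[OF assms(1), of 0 \<mu> "{0..}"] assms(2,3)
  by (simp add: is_interval_1 Ball_def)

context riccati_field
begin

text \<open>After the blow-up time the linear solution becomes negative, which is a stable property.\<close>

lemma not_survives_open:
  assumes no: "\<not> survives lam H \<mu>" and "H 0 = 0"
  obtains \<delta> where "\<delta> > 0"
    "\<And>K. riccati_field lam K \<Longrightarrow> K 0 = 0 \<Longrightarrow> (\<And>t. t \<ge> 0 \<Longrightarrow> \<bar>K t - H t\<bar> \<le> \<delta>) \<Longrightarrow> \<not> survives lam K \<mu>"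
proof -
  obtain y p where lin: "linear_sol lam H y p" "y 0 = 1" "p 0 = \<mu> + H 0" using linear_exists by metis
  obtain t1 where t1: "t1 \<ge> 0" "y t1 \<le> 0" using no survives_iff_linear[OF lin] by (auto simp: not_less)
  then have "t1 > 0" using lin(2) by (cases "t1 = 0") auto
  obtain T where T: "T \<ge> 0" "y T < 0"
  proof (cases "y t1 < 0")
    case False
    then have y0: "y t1 = 0" using t1 by simp
    then have der: "(y has_real_derivative p t1) (at t1)"
      using lin(1)[unfolded linear_sol_def, rule_format, of t1] by simp
    have "p t1 \<noteq> 0" using linear_nontrivial[OF lin(1), of 0 t1] lin(2) y0 by simp
    then consider "p t1 > 0" | "p t1 < 0" by linarith
    then show ?thesis
    proof cases
      case 1
      then obtain d where d: "d > 0" "\<And>h. h > 0 \<Longrightarrow> h < d \<Longrightarrow> y (t1 - h) < y t1"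
        using DERIV_pos_inc_left[OF der] by blast
      define h where "h = min (d / 2) t1"
      have "h > 0" "h < d" "h \<le> t1" using d(1) \<open>t1 > 0\<close> by (auto simp: h_def)
      then show ?thesis using that[of "t1 - h"] d(2)[of h] y0 by simp
    next
      case 2
      then obtain d where d: "d > 0" "\<And>h. h > 0 \<Longrightarrow> h < d \<Longrightarrow> y (t1 + h) < y t1"
        using DERIV_neg_dec_right[OF der] by blast
      then show ?thesis using that[of "t1 + d / 2"] y0 t1(1) d(2)[of "d / 2"] by simp
    qed
  qed (use t1 that in blast)
  obtain B where B: "\<And>t. \<bar>H t\<bar> \<le> B" using bounded_H by blast
  obtain \<delta> where \<delta>: "\<delta> > 0"
    "\<And>K z q t. (\<And>t. t \<in> {0..T} \<Longrightarrow> \<bar>K t - H t\<bar> \<le> \<delta>) \<Longrightarrow> linear_sol lam K z q \<Longrightarrow>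
       z 0 = y 0 \<Longrightarrow> q 0 = p 0 \<Longrightarrow> t \<in> {0..T} \<Longrightarrow> \<bar>z t - y t\<bar> < - y T \<and> \<bar>q t - p t\<bar> < - y T"
    using linear_sol_continuous_dependence[OF lin(1) lam_pos B T(1), of "- y T"] T(2) by auto
  show ?thesis
  proof (rule that[OF \<delta>(1)])
    fix K assume K: "riccati_field lam K" "K 0 = 0" "\<And>t. t \<ge> 0 \<Longrightarrow> \<bar>K t - H t\<bar> \<le> \<delta>"
    interpret K: riccati_field lam K by (rule K(1))
    obtain z q where zq: "linear_sol lam K z q" "z 0 = 1" "q 0 = \<mu> + K 0" using K.linear_exists by metis
    have "\<bar>z T - y T\<bar> < - y T"
      using \<delta>(2)[OF _ zq(1), of T] K lin zq T(1) \<open>H 0 = 0\<close> by simp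
    then have "z T < 0" by linarith
    then show "\<not> survives lam K \<mu>"
      unfolding K.survives_iff_linear[OF zq] using T(1) by (meson less_asym)
  qed
qed

text \<open>At a late time \<open>T\<close> the solution is positive, and so is that of a perturbed equation, which from
  then on is trapped.\<close>

lemma survives_high_open:
  assumes x: "sol {0..} x" "x 0 = \<mu>" "(x \<longlongrightarrow> c) at_top" and "H 0 = 0"
  obtains \<delta> where "\<delta> > 0"
    "\<And>K. riccati_field lam K \<Longrightarrow> K 0 = 0 \<Longrightarrow> (\<And>t. t \<ge> 0 \<Longrightarrow> \<bar>K t - H t\<bar> \<le> \<delta>) \<Longrightarrow> survives lam K \<mu>"
proof -
  obtain y p where lin: "linear_sol lam H y p" "y 0 = 1" "p 0 = \<mu> + H 0" using linear_exists by metis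
  obtain l where l: "(H \<longlongrightarrow> l) at_top" using lim_top by blast
  have "eventually (\<lambda>t. \<bar>H t - l\<bar> < c / 4 \<and> x t > c / 2) at_top"
    using tendstoD[OF l, of "c / 4"] order_tendstoD(1)[OF x(3), of "c / 2"] c_pos
    by (intro eventually_conj) (auto simp: dist_real_def)
  then obtain T0 where T0: "\<And>t. t \<ge> T0 \<Longrightarrow> \<bar>H t - l\<bar> < c / 4 \<and> x t > c / 2"
    by (auto simp: eventually_at_top_linorder)
  define T where "T = max 0 T0"
  have T: "T \<ge> 0" "\<And>t. t \<ge> T \<Longrightarrow> \<bar>H t - l\<bar> < c / 4" "x T > c / 2" using T0 by (auto simp: T_def)
  have data: "p 0 = (x 0 + H 0) * y 0" using lin x(2) by simp
  have ypos: "y t > 0" "p t = (x t + H t) * y t" if "t \<ge> 0" for t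
    using linear_sol_along_riccati_sol[OF lin(1) x(1) contH' _ _ data, of t] lin(2) that by auto
  have cont: "continuous_on {0..T} y" by (rule linear_sol_continuous_on[OF lin(1)])
  obtain t0 where t0: "t0 \<in> {0..T}" "\<And>t. t \<in> {0..T} \<Longrightarrow> y t0 \<le> y t"
    using continuous_attains_inf[OF compact_Icc _ cont] T(1) by auto
  have y0: "y t0 > 0" using ypos t0 by simp
  obtain B where B: "\<And>t. \<bar>H t\<bar> \<le> B" using bounded_H by blast
  have B0: "B \<ge> 0" using B[of 0] by simp
  define k where "k = p T - H T * y T"
  have k: "k > 0"
  proof -
    have "k = x T * y T" using ypos(2)[OF T(1)] by (simp add: k_def algebra_simps)
    moreover have "x T > 0" using T(3) c_pos by linarith
    ultimately show ?thesis using ypos(1)[OF T(1)] by simp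
  qed
  define \<epsilon> where "\<epsilon> = min (y t0) (k / (2 * (B + 2)))"
  have "\<epsilon> > 0" using y0 k B0 by (simp add: \<epsilon>_def)
  obtain \<delta>1 where \<delta>1: "\<delta>1 > 0"
    "\<And>K z q t. (\<And>t. t \<in> {0..T} \<Longrightarrow> \<bar>K t - H t\<bar> \<le> \<delta>1) \<Longrightarrow> linear_sol lam K z q \<Longrightarrow>
       z 0 = y 0 \<Longrightarrow> q 0 = p 0 \<Longrightarrow> t \<in> {0..T} \<Longrightarrow> \<bar>z t - y t\<bar> < \<epsilon> \<and> \<bar>q t - p t\<bar> < \<epsilon>"
    using linear_sol_continuous_dependence[OF lin(1) lam_pos B T(1) \<open>\<epsilon> > 0\<close>] by blast
  define \<delta> where "\<delta> = min (min \<delta>1 1) (min (c / 8) (k / (2 * y T)))"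
  have yT: "y T > 0" using ypos T(1) by simp
  have \<delta>: "\<delta> > 0" "\<delta> \<le> \<delta>1" "\<delta> \<le> 1" "\<delta> \<le> c / 8" "\<delta> \<le> k / (2 * y T)"
    using \<delta>1(1) c_pos k yT by (auto simp: \<delta>_def)
  show ?thesis
  proof (rule that[OF \<delta>(1)])
    fix K assume K: "riccati_field lam K" "K 0 = 0" "\<And>t. t \<ge> 0 \<Longrightarrow> \<bar>K t - H t\<bar> \<le> \<delta>"
    interpret K: riccati_field lam K by (rule K(1))
    obtain z q where zq: "linear_sol lam K z q" "z 0 = 1" "q 0 = \<mu> + K 0" using K.linear_exists by metis
    have close: "\<bar>z t - y t\<bar> < \<epsilon>" "\<bar>q t - p t\<bar> < \<epsilon>" if "t \<in> {0..T}" for t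
      using \<delta>1(2)[OF _ zq(1) _ _ that] K lin zq \<delta>(2) \<open>H 0 = 0\<close> by (force intro: order_trans)+
    have zpos: "z t > 0" if "t \<in> {0..T}" for t
    proof -
      have "\<epsilon> \<le> y t0" by (simp add: \<epsilon>_def)
      then show ?thesis using close(1)[OF that] t0(2)[OF that] by linarith
    qed
    have TT: "T \<in> {0..T}" using T(1) by simp
    define x1 where "x1 = q T / z T - K T"
    have num: "q T - K T * z T \<ge> 0"
    proof -
      have KT: "\<bar>K T - H T\<bar> \<le> \<delta>" using K(3) T(1) by blast
      have "\<bar>K T * (z T - y T)\<bar> \<le> (B + 1) * \<epsilon>"
        unfolding abs_mult using KT B[of T] \<delta>(3) close(1)[OF TT] by (intro mult_mono) auto
      moreover have "\<bar>(K T - H T) * y T\<bar> \<le> k / 2"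
      proof -
        have "\<bar>(K T - H T) * y T\<bar> \<le> (k / (2 * y T)) * y T"
          unfolding abs_mult using KT \<delta>(5) yT by (intro mult_mono) auto
        then show ?thesis using yT by simp
      qed
      moreover have "(B + 2) * \<epsilon> \<le> k / 2"
      proof -
        have "(B + 2) * \<epsilon> \<le> (B + 2) * (k / (2 * (B + 2)))" using B0 by (intro mult_left_mono) (auto simp: \<epsilon>_def)
        also have "\<dots> = k / 2" using B0 by (simp add: field_simps)
        finally show ?thesis .
      qed
      moreover have "q T - K T * z T = k + (q T - p T) - K T * (z T - y T) - (K T - H T) * y T"
        by (simp add: k_def algebra_simps)
      moreover have "(B + 2) * \<epsilon> = (B + 1) * \<epsilon> + \<epsilon>" by (simp add: algebra_simps)
      ultimately show ?thesis using close(2)[OF TT] by linarith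
    qed
    have "x1 \<ge> 0" using num zpos[OF TT] by (simp add: x1_def field_simps)
    have "x1 \<in> K.forward_set T"
    proof (rule K.forward_trap[where l = "K T"])
      fix t assume "t \<ge> T"
      have "\<bar>K t - H t\<bar> \<le> c / 8" "\<bar>K T - H T\<bar> \<le> c / 8"
        using K(3)[of t] K(3)[of T] \<delta>(4) T(1) \<open>t \<ge> T\<close> by auto
      then show "\<bar>K t - K T\<bar> < c" using T(2)[OF \<open>t \<ge> T\<close>] T(2)[OF order_refl] by linarith
    qed (use \<open>x1 \<ge> 0\<close> in simp)
    then obtain x' where x': "K.sol {T..} x'" "x' T = x1" by (auto simp: K.forward_set_def)
    have zT: "q T = (x' T + K T) * z T" using zpos[OF TT] by (simp add: x'(2) x1_def)
    have "z t > 0" if "t \<ge> 0" for t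
    proof (cases "t \<le> T")
      case True
      then show ?thesis using zpos that by simp
    next
      case False
      then show ?thesis
        using linear_sol_along_riccati_sol(1)[OF zq(1) x'(1) K.contH' _ zpos[OF TT] zT, of t] by simp
    qed
    then show "survives lam K \<mu>" using K.survives_iff_linear[OF zq] by blast
  qed
qed

end

text \<open>Along a continuous family which passes from blow-up to survival, the first survivor tends
  to \<open>- sqrt lam\<close>.\<close>

theorem critical_parameter:
  fixes F :: "real \<Rightarrow> real \<Rightarrow> real"
  assumes field: "\<And>s. s \<in> {s0..s1} \<Longrightarrow> riccati_field lam (F s)" and F0: "\<And>s. s \<in> {s0..s1} \<Longrightarrow> F s 0 = 0"
    and cont: "\<And>s \<delta>. s \<in> {s0..s1} \<Longrightarrow> \<delta> > 0 \<Longrightarrow>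
      \<exists>\<eta>>0. \<forall>s'\<in>{s0..s1}. \<bar>s' - s\<bar> < \<eta> \<longrightarrow> (\<forall>t\<ge>0. \<bar>F s' t - F s t\<bar> \<le> \<delta>)"
    and "s0 \<le> s1" "\<not> survives lam (F s0) \<mu>" "survives lam (F s1) \<mu>"
  obtains s x where "s0 < s" "s \<le> s1" "riccati_sol lam (F s) {0..} x" "x 0 = \<mu>" "(x \<longlongrightarrow> - sqrt lam) at_top"
    "\<forall>s'\<in>{s0..<s}. \<not> survives lam (F s') \<mu>"
proof -
  define P where "P = {s \<in> {s0..s1}. survives lam (F s) \<mu>}"
  have s1: "s1 \<in> P" using assms by (simp add: P_def)
  have bdd: "bdd_below P" by (rule bdd_belowI[of _ s0]) (simp add: P_def)
  define s where "s = Inf P"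
  have lower: "s \<le> s'" if "s' \<in> P" for s' unfolding s_def using that bdd by (rule cInf_lower)
  have s: "s \<in> {s0..s1}"
  proof -
    have "s0 \<le> s" unfolding s_def using s1 by (intro cInf_greatest) (auto simp: P_def)
    then show ?thesis using lower[OF s1] by simp
  qed
  interpret S: riccati_field lam "F s" by (rule field[OF s])
  have surv: "survives lam (F s) \<mu>"
  proof (rule ccontr)
    assume "\<not> survives lam (F s) \<mu>"
    then obtain \<delta> where \<delta>: "\<delta> > 0"
      "\<And>K. riccati_field lam K \<Longrightarrow> K 0 = 0 \<Longrightarrow> (\<And>t. t \<ge> 0 \<Longrightarrow> \<bar>K t - F s t\<bar> \<le> \<delta>) \<Longrightarrow> \<not> survives lam K \<mu>"
      using S.not_survives_open F0[OF s] by blast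
    obtain \<eta> where \<eta>: "\<eta> > 0"
      "\<And>s' t. s' \<in> {s0..s1} \<Longrightarrow> \<bar>s' - s\<bar> < \<eta> \<Longrightarrow> t \<ge> 0 \<Longrightarrow> \<bar>F s' t - F s t\<bar> \<le> \<delta>"
      using cont[OF s \<delta>(1)] by blast
    obtain s' where s': "s' \<in> P" "s' < s + \<eta>"
      using cInf_lessD[of P "s + \<eta>"] s1 \<eta>(1) unfolding s_def by auto
    have "\<not> survives lam (F s') \<mu>"
    proof (rule \<delta>(2))
      show "riccati_field lam (F s')" "F s' 0 = 0" using s'(1) field F0 by (auto simp: P_def)
      show "\<bar>F s' t - F s t\<bar> \<le> \<delta>" if "t \<ge> 0" for t
        using s' lower[OF s'(1)] that by (intro \<eta>(2)) (auto simp: P_def)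
    qed
    then show False using s'(1) by (simp add: P_def)
  qed
  have "s \<noteq> s0" using surv assms(5) by blast
  then have "s0 < s" using s by simp
  obtain x where x: "S.sol {0..} x" "x 0 = \<mu>" using surv by (auto simp: survives_def)
  have "\<not> (x \<longlongrightarrow> sqrt lam) at_top"
  proof
    assume "(x \<longlongrightarrow> sqrt lam) at_top"
    then obtain \<delta> where \<delta>: "\<delta> > 0"
      "\<And>K. riccati_field lam K \<Longrightarrow> K 0 = 0 \<Longrightarrow> (\<And>t. t \<ge> 0 \<Longrightarrow> \<bar>K t - F s t\<bar> \<le> \<delta>) \<Longrightarrow> survives lam K \<mu>"
      using S.survives_high_open[OF x _ F0[OF s]] by blast
    obtain \<eta> where \<eta>: "\<eta> > 0"
      "\<And>s' t. s' \<in> {s0..s1} \<Longrightarrow> \<bar>s' - s\<bar> < \<eta> \<Longrightarrow> t \<ge> 0 \<Longrightarrow> \<bar>F s' t - F s t\<bar> \<le> \<delta>"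
      using cont[OF s \<delta>(1)] by blast
    define s' where "s' = max s0 (s - \<eta> / 2)"
    have s': "s' \<in> {s0..s1}" "\<bar>s' - s\<bar> < \<eta>" "s' < s" using \<eta>(1) s \<open>s0 < s\<close> by (auto simp: s'_def)
    have "survives lam (F s') \<mu>" using field[OF s'(1)] F0[OF s'(1)] \<eta>(2)[OF s'(1,2)] by (rule \<delta>(2))
    then have "s' \<in> P" using s'(1) by (simp add: P_def)
    then show False using lower[of s'] s'(3) by simp
  qed
  then have "(x \<longlongrightarrow> - sqrt lam) at_top" using S.sol_asymptotic_top[OF x(1)] by blast
  moreover have "\<forall>s'\<in>{s0..<s}. \<not> survives lam (F s') \<mu>"
    using lower s by (force simp: P_def)
  ultimately show ?thesis using that[of s x] \<open>s0 < s\<close> s x by simp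
qed

section \<open>The rate function\<close>

text \<open>If the solution survives, then it does so for every faster rate, and tends to
  \<open>sqrt lam\<close>: for \<open>\<rho> > 1\<close> the function \<open>x1 (\<rho> t) / \<rho>\<close> is a subsolution of the faster equation, and its
  limit exceeds \<open>- sqrt lam\<close>.\<close>

lemma survives_faster:
  assumes "riccati_field lam H1" "riccati_field lam H2" and "\<rho> > 1" "\<mu> > 0"
    and H2: "\<And>t. t \<ge> 0 \<Longrightarrow> H2 t = H1 (\<rho> * t) / \<rho>"
    and x1: "riccati_sol lam H1 {0..} x1" "x1 0 = \<mu>"
  obtains x2 where "riccati_sol lam H2 {0..} x2" "x2 0 = \<mu>" "(x2 \<longlongrightarrow> sqrt lam) at_top"
proof -
  interpret A: riccati_field lam H1 by fact
  interpret B: riccati_field lam H2 by fact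
  define z where "z t = x1 (\<rho> * t) / \<rho>" for t
  have cz: "continuous_on {0..} z"
    unfolding z_def using \<open>\<rho> > 1\<close>
    by (intro continuous_intros continuous_on_compose2[OF A.sol_continuous_on[OF x1(1)]]) auto
  have z: "((\<lambda>t. z t + H2 t) has_real_derivative lam - (\<rho> * z t)\<^sup>2) (at t within {0..})" if "t \<ge> 0" for t
  proof -
    have im: "(\<lambda>t. \<rho> * t) ` {0..} \<subseteq> {0..}" using \<open>\<rho> > 1\<close> by auto
    have "((\<lambda>t. x1 t + H1 t) has_real_derivative lam - (x1 (\<rho> * t))\<^sup>2) (at (\<rho> * t) within {0..})"
      using x1(1) that \<open>\<rho> > 1\<close> by (simp add: riccati_sol_def)
    then have "((\<lambda>t. x1 t + H1 t) has_real_derivative lam - (x1 (\<rho> * t))\<^sup>2)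
        (at (\<rho> * t) within (\<lambda>t. \<rho> * t) ` {0..})"
      using im by (rule DERIV_subset)
    moreover have "((\<lambda>t. \<rho> * t) has_real_derivative \<rho>) (at t within {0..})"
      by (auto intro!: derivative_eq_intros)
    ultimately have "((\<lambda>t. x1 t + H1 t) \<circ> (\<lambda>t. \<rho> * t) has_real_derivative (lam - (x1 (\<rho> * t))\<^sup>2) * \<rho>)
        (at t within {0..})" by (rule DERIV_image_chain)
    from DERIV_cdivide[OF this, of \<rho>]
    have "((\<lambda>t. (x1 (\<rho> * t) + H1 (\<rho> * t)) / \<rho>) has_real_derivative lam - (\<rho> * z t)\<^sup>2) (at t within {0..})"
      using \<open>\<rho> > 1\<close> by (simp add: o_def z_def)
    then show ?thesis
      by (rule has_field_derivative_transform_within[OF _ zero_less_one])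
        (use that H2 in \<open>auto simp: z_def add_divide_distrib\<close>)
  qed
  have barrier: "z t \<le> x t" if x: "B.sol J x" "x 0 = \<mu>" and t: "0 \<le> t" "{0..t} \<subseteq> J" for J x t
  proof -
    have cx: "continuous_on {0..t} x" using B.sol_continuous_on[OF x(1)] t(2) by (rule continuous_on_subset)
    have cz': "continuous_on {0..t} z" using cz by (rule continuous_on_subset) auto
    have "x t - z t \<ge> (x 0 - z 0) * exp (integral {0..t} (\<lambda>u. - (x u + z u)))"
    proof (rule gronwall_lower[OF t(1), where D = "\<lambda>u. (\<rho> * z u)\<^sup>2 - (x u)\<^sup>2"])
      show "continuous_on {0..t} (\<lambda>u. - (x u + z u))" by (intro continuous_intros cx cz')
      fix u assume u: "u \<in> {0..t}"
      have "((\<lambda>t. x t + H2 t) has_real_derivative lam - (x u)\<^sup>2) (at u within J)"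
        using x(1) u t(2) by (auto simp: riccati_sol_def)
      then have 1: "((\<lambda>t. x t + H2 t) has_real_derivative lam - (x u)\<^sup>2) (at u within {0..t})"
        using t(2) by (rule DERIV_subset)
      have 2: "((\<lambda>t. z t + H2 t) has_real_derivative lam - (\<rho> * z u)\<^sup>2) (at u within {0..t})"
        by (rule DERIV_subset[OF z]) (use u in auto)
      from DERIV_diff[OF 1 2]
      show "((\<lambda>u. x u - z u) has_real_derivative (\<rho> * z u)\<^sup>2 - (x u)\<^sup>2) (at u within {0..t})" by simp
      have "1 * (z u)\<^sup>2 \<le> \<rho>\<^sup>2 * (z u)\<^sup>2"
        using \<open>\<rho> > 1\<close> by (intro mult_right_mono one_le_power) auto
      then have "(z u)\<^sup>2 \<le> (\<rho> * z u)\<^sup>2" by (simp add: power_mult_distrib)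
      then show "- (x u + z u) * (x u - z u) \<le> (\<rho> * z u)\<^sup>2 - (x u)\<^sup>2"
        by (simp add: power2_eq_square algebra_simps)
    qed
    moreover have "x 0 - z 0 \<ge> 0" using \<open>\<rho> > 1\<close> \<open>\<mu> > 0\<close> x(2) x1(2) by (simp add: z_def field_simps)
    ultimately have "0 \<le> x t - z t" by (smt (verit) exp_ge_zero mult_nonneg_nonneg)
    then show ?thesis by simp
  qed
  have "\<exists>x. B.sol {0..} x \<and> x 0 = \<mu>"
    using cz by (rule B.forward_exists) (auto intro!: barrier)
  then obtain x2 where x2: "B.sol {0..} x2" "x2 0 = \<mu>" by blast
  have "\<not> (x2 \<longlongrightarrow> - sqrt lam) at_top"
  proof
    assume low: "(x2 \<longlongrightarrow> - sqrt lam) at_top"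
    have scale: "filterlim (\<lambda>t. \<rho> * t) at_top at_top"
      using \<open>\<rho> > 1\<close> by (intro filterlim_tendsto_pos_mult_at_top[OF tendsto_const _ filterlim_ident]) simp
    have "\<exists>a. a \<ge> - sqrt lam \<and> (x1 \<longlongrightarrow> a) at_top"
      using A.sol_asymptotic_top[OF x1(1)] A.c_pos by (auto intro: exI[of _ "sqrt lam"] exI[of _ "- sqrt lam"])
    then obtain a where a: "a \<ge> - sqrt lam" "(x1 \<longlongrightarrow> a) at_top" by blast
    have "(z \<longlongrightarrow> a / \<rho>) at_top"
      unfolding z_def[abs_def] using \<open>\<rho> > 1\<close>
      by (intro tendsto_divide filterlim_compose[OF a(2) scale] tendsto_const) auto
    moreover have "eventually (\<lambda>t. z t \<le> x2 t) at_top"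
      using eventually_ge_at_top[of 0] by eventually_elim (rule barrier[OF x2], auto)
    ultimately have "a / \<rho> \<le> - sqrt lam" using low by (intro tendsto_le[of at_top x2 _ z]) auto
    moreover have "- sqrt lam < a / \<rho>"
    proof -
      have "- sqrt lam * \<rho> < - sqrt lam * 1" using A.c_pos \<open>\<rho> > 1\<close> by (intro mult_strict_left_mono_neg) auto
      then show ?thesis using a(1) \<open>\<rho> > 1\<close> by (simp add: field_simps)
    qed
    ultimately show False by simp
  qed
  then show ?thesis using that x2 B.sol_asymptotic_top[OF x2(1)] by blast
qed


lemma L1_Linf_half_line_diff:
  assumes "a \<in> L1_Linf {0..}" "b \<in> L1_Linf {0..}"
  shows "(\<lambda>t. a t - s * b t) \<in> L1_Linf {0..}"
proof -
  define a1 where "a1 t = (if t \<ge> 0 then a t else 0)" for t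
  define b1 where "b1 t = (if t \<ge> 0 then b t else 0)" for t
  have ab: "a1 \<in> L1_Linf UNIV" "b1 \<in> L1_Linf UNIV"
    using assms unfolding L1_Linf_half_line_iff a1_def[abs_def] b1_def[abs_def] by auto
  obtain C N where C: "negligible N" "\<And>t. t \<notin> N \<Longrightarrow> \<bar>a1 t\<bar> \<le> C"
    using ab(1) unfolding L1_Linf_UNIV_iff by blast
  obtain D M where D: "negligible M" "\<And>t. t \<notin> M \<Longrightarrow> \<bar>b1 t\<bar> \<le> D"
    using ab(2) unfolding L1_Linf_UNIV_iff by blast
  have "\<bar>a1 t - s * b1 t\<bar> \<le> C + \<bar>s\<bar> * D" if "t \<notin> N \<union> M" for t
  proof -
    have "\<bar>a1 t - s * b1 t\<bar> \<le> \<bar>a1 t\<bar> + \<bar>s\<bar> * \<bar>b1 t\<bar>" by (metis abs_mult abs_triangle_ineq4)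
    also have "\<dots> \<le> C + \<bar>s\<bar> * D" using C(2)[of t] D(2)[of t] that by (intro add_mono mult_left_mono) auto
    finally show ?thesis .
  qed
  moreover have "negligible (N \<union> M)" using C D by simp
  moreover have "integrable lebesgue (\<lambda>t. a1 t - s * b1 t)"
    using ab unfolding L1_Linf_UNIV_iff by auto
  ultimately have "(\<lambda>t. a1 t - s * b1 t) \<in> L1_Linf UNIV" unfolding L1_Linf_UNIV_iff by blast
  moreover have "(\<lambda>t. a1 t - s * b1 t) = (\<lambda>t. if t \<ge> 0 then a t - s * b t else 0)"
    by (auto simp: a1_def b1_def)
  ultimately show ?thesis unfolding L1_Linf_half_line_iff by simp
qed

lemma L1_Linf_half_line_time_scaled:
  assumes "g \<in> L1_Linf {0..}" "\<kappa> > 0"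
  shows "(\<lambda>t. g (t * \<kappa>)) \<in> L1_Linf {0..}"
proof -
  define g1 where "g1 t = (if t \<ge> 0 then g t else 0)" for t
  have g1: "g1 \<in> L1_Linf UNIV" using assms(1) unfolding L1_Linf_half_line_iff g1_def[abs_def] .
  obtain C N where C: "negligible N" "\<And>t. t \<notin> N \<Longrightarrow> \<bar>g1 t\<bar> \<le> C"
    using g1 unfolding L1_Linf_UNIV_iff by blast
  have "negligible ((\<lambda>t. t * inverse \<kappa>) ` N)" using C(1) by (rule negligible_scaled_image)
  moreover have "\<bar>g1 (t * \<kappa>)\<bar> \<le> C" if "t \<notin> (\<lambda>t. t * inverse \<kappa>) ` N" for t
  proof (rule C(2))
    show "t * \<kappa> \<notin> N"
    proof
      assume "t * \<kappa> \<in> N"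
      then have "(t * \<kappa>) * inverse \<kappa> \<in> (\<lambda>t. t * inverse \<kappa>) ` N" by (rule imageI)
      moreover have "(t * \<kappa>) * inverse \<kappa> = t" using assms(2) by simp
      ultimately show False using that by metis
    qed
  qed
  moreover have "integrable lebesgue (\<lambda>t. g1 (t * \<kappa>))"
    using g1 lebesgue_integrable_real_affine[of g1 \<kappa> 0] assms(2)
    by (simp add: L1_Linf_UNIV_iff mult.commute)
  ultimately have "(\<lambda>t. g1 (t * \<kappa>)) \<in> L1_Linf UNIV" unfolding L1_Linf_UNIV_iff by blast
  moreover have "(\<lambda>t. g1 (t * \<kappa>)) = (\<lambda>t. if t \<ge> 0 then g (t * \<kappa>) else 0)"
    using assms(2) by (auto simp: g1_def zero_le_mult_iff fun_eq_iff)
  ultimately show ?thesis unfolding L1_Linf_half_line_iff by simp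
qed

text \<open>The past, given by \<open>\<alpha>e\<close> with primitive \<open>A\<close>, is fixed, and \<open>\<mu>\<close> is the value of its pullback
  attractor at time 0.\<close>

locale fixed_past =
  fixes lam \<mu> :: real and \<alpha>e A :: "real \<Rightarrow> real"
  assumes past_field: "riccati_field lam A" and mu_pos: "\<mu> > 0"
    and past_prim: "is_primitive \<alpha>e A" and past_0: "A 0 = 0"
    and past_backward: "riccati_field.backward_set lam A 0 = {..\<mu>}"
begin

text \<open>The primitive of a forcing which agrees with \<open>\<alpha>e\<close> in the past and has primitive \<open>K\<close> in the
  future.\<close>

definition glue :: "(real \<Rightarrow> real) \<Rightarrow> real \<Rightarrow> real" where
  "glue K t = (if t < 0 then A t else K t)"

lemma glue_field:
  assumes "is_primitive k K" "K 0 = 0" "(K \<longlongrightarrow> l) at_top"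
  shows "riccati_field lam (glue K)"
proof -
  interpret P: riccati_field lam A by (rule past_field)
  show ?thesis
  proof
    show "0 < lam" by (rule P.lam_pos)
    show "continuous_on UNIV (glue K)"
      unfolding glue_def[abs_def]
      by (rule is_primitive_continuous_on[OF is_primitive_glue[OF past_prim assms(1) past_0 assms(2)]])
    obtain l' where "(A \<longlongrightarrow> l') at_bot" using P.lim_bot by blast
    then have "(glue K \<longlongrightarrow> l') at_bot"
      by (rule Lim_transform_eventually)
        (rule eventually_mono[OF eventually_gt_at_bot[of 0]], simp add: glue_def)
    then show "\<exists>l. (glue K \<longlongrightarrow> l) at_bot" by blast
    have "(glue K \<longlongrightarrow> l) at_top"
      using assms(3) by (rule Lim_transform_eventually)
        (rule eventually_mono[OF eventually_ge_at_top[of 0]], simp add: glue_def)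
    then show "\<exists>l. (glue K \<longlongrightarrow> l) at_top" by blast
  qed
qed

lemma glue_backward:
  assumes "riccati_field lam (glue K)" "K 0 = 0"
  shows "riccati_field.backward_set lam (glue K) 0 = {..\<mu>}"
proof -
  interpret P: riccati_field lam A by (rule past_field)
  interpret G: riccati_field lam "glue K" by fact
  have eq: "glue K t = A t" if "t \<in> {..0}" for t
    using that past_0 assms(2) by (auto simp: glue_def)
  have "G.sol {..0} x \<longleftrightarrow> P.sol {..0} x" for x
    using riccati_sol_cong[of lam "glue K" "{..0}" x x A] riccati_sol_cong[of lam A "{..0}" x x "glue K"] eq
    by auto
  then have "G.backward_set 0 = P.backward_set 0" by (simp add: G.backward_set_def P.backward_set_def)
  then show ?thesis using past_backward by simp
qed

lemma cases_of_future:
  assumes K: "is_primitive k K" "K 0 = 0" "(K \<longlongrightarrow> l) at_top"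
  defines "h \<equiv> \<lambda>t. if t < 0 then \<alpha>e t else k t"
  shows "\<not> survives lam (glue K) \<mu> \<Longrightarrow> case_C lam h"
    and "riccati_sol lam (glue K) {0..} x \<Longrightarrow> x 0 = \<mu> \<Longrightarrow> (x \<longlongrightarrow> sqrt lam) at_top \<Longrightarrow> case_A lam h"
    and "riccati_sol lam (glue K) {0..} x \<Longrightarrow> x 0 = \<mu> \<Longrightarrow> (x \<longlongrightarrow> - sqrt lam) at_top \<Longrightarrow> case_B lam h"
    and "survives lam (glue K) \<mu> \<Longrightarrow> \<not> case_C lam h"
proof -
  have field: "riccati_field lam (glue K)" using glue_field K by blast
  interpret G: riccati_field lam "glue K" by (rule field)
  interpret G: riccati_forced lam "glue K" h \<mu>
  proof
    show "is_primitive h (glue K)"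
      unfolding h_def glue_def[abs_def] by (rule is_primitive_glue[OF past_prim K(1) past_0 K(2)])
  qed
  have bwd: "G.backward_set 0 = {..\<mu>}" by (rule glue_backward[OF field K(2)])
  show "\<not> survives lam (glue K) \<mu> \<Longrightarrow> case_C lam h"
    using G.case_C_if_no_forward_sol[OF bwd] G.survives_iff by blast
  show A: "riccati_sol lam (glue K) {0..} x \<Longrightarrow> x 0 = \<mu> \<Longrightarrow> (x \<longlongrightarrow> sqrt lam) at_top \<Longrightarrow> case_A lam h" for x
    by (rule G.case_A_if_forward_limit[OF bwd])
  show B: "riccati_sol lam (glue K) {0..} x \<Longrightarrow> x 0 = \<mu> \<Longrightarrow> (x \<longlongrightarrow> - sqrt lam) at_top \<Longrightarrow> case_B lam h" for x
    by (rule G.case_B_if_forward_limit[OF bwd])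
  assume "survives lam (glue K) \<mu>"
  then obtain x where x: "G.sol {0..} x" "x 0 = \<mu>" by (auto simp: survives_def)
  then have "case_A lam h \<or> case_B lam h" using A B G.sol_asymptotic_top[OF x(1)] by blast
  then show "\<not> case_C lam h" using case_C_not_A case_C_not_B by blast
qed

text \<open>The estimate is uniform in \<open>t\<close>: for large \<open>t\<close> both values of \<open>G\<close> are close to its limit, and for
  bounded \<open>t\<close> the Lipschitz condition applies.\<close>

lemma time_scaling_continuous:
  fixes G :: "real \<Rightarrow> real"
  assumes C: "\<And>s t. \<bar>G s - G t\<bar> \<le> C * \<bar>s - t\<bar>" and B: "\<And>t. t \<ge> 0 \<Longrightarrow> \<bar>G t\<bar> \<le> B"
    and b: "(G \<longlongrightarrow> b) at_top" and "s0 > 0" "\<kappa> \<ge> s0" "\<delta> > 0"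
  shows "\<exists>\<eta>>0. \<forall>\<kappa>'\<ge>s0. \<bar>\<kappa>' - \<kappa>\<bar> < \<eta> \<longrightarrow>
    (\<forall>t\<ge>0. \<bar>G (t * \<kappa>') / \<kappa>' - G (t * \<kappa>) / \<kappa>\<bar> \<le> \<delta>)"
proof -
  have C0: "C \<ge> 0" using C[of 0 1] by simp
  have B0: "B \<ge> 0" using B[of 0] by simp
  have "\<delta> * s0 / 8 > 0" using assms by simp
  from tendstoD[OF b this] obtain N0 where N0: "\<And>t. t \<ge> N0 \<Longrightarrow> \<bar>G t - b\<bar> < \<delta> * s0 / 8"
    by (auto simp: eventually_at_top_linorder dist_real_def)
  define N where "N = max 0 N0"
  have N: "N \<ge> 0" "\<And>t. t \<ge> N \<Longrightarrow> \<bar>G t - b\<bar> < \<delta> * s0 / 8" using N0 by (auto simp: N_def)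
  define \<eta> where "\<eta> = min (\<delta> * s0\<^sup>2 / (4 * (C * N + 1))) (\<delta> * s0\<^sup>2 / (2 * (B + 1)))"
  have CN: "C * N + 1 > 0" using C0 N(1) by (simp add: add_nonneg_pos)
  have \<eta>: "\<eta> > 0" using assms CN B0 by (simp add: \<eta>_def)
  show ?thesis
  proof (intro exI[of _ \<eta>] conjI \<eta> allI impI)
    fix \<kappa>' t :: real
    assume \<kappa>': "\<kappa>' \<ge> s0" "\<bar>\<kappa>' - \<kappa>\<bar> < \<eta>" "t \<ge> 0"
    note \<kappa> = \<open>\<kappa> \<ge> s0\<close> \<kappa>'
    have pos: "\<kappa> > 0" "\<kappa>' > 0" using \<kappa> \<open>s0 > 0\<close> by auto
    have 1: "\<bar>G (t * \<kappa>') - G (t * \<kappa>)\<bar> \<le> \<delta> * s0 / 4"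
    proof (cases "t * s0 \<ge> N")
      case True
      have "t * s0 \<le> t * \<kappa>" "t * s0 \<le> t * \<kappa>'" using \<kappa> by (auto intro: mult_left_mono)
      then have "\<bar>G (t * \<kappa>) - b\<bar> < \<delta> * s0 / 8" "\<bar>G (t * \<kappa>') - b\<bar> < \<delta> * s0 / 8"
        using True N(2) by auto
      then show ?thesis by linarith
    next
      case False
      have "\<bar>G (t * \<kappa>') - G (t * \<kappa>)\<bar> \<le> C * (t * \<bar>\<kappa>' - \<kappa>\<bar>)"
        using C[of "t * \<kappa>'" "t * \<kappa>"] \<kappa>(4) by (simp add: abs_mult flip: right_diff_distrib)
      also have "\<dots> \<le> C * ((N / s0) * (\<delta> * s0\<^sup>2 / (4 * (C * N + 1))))"
        using False \<kappa> C0 \<open>s0 > 0\<close> N(1)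
        by (intro mult_left_mono mult_mono) (auto simp: \<eta>_def field_simps)
      also have "\<dots> = (C * N / (C * N + 1)) * (\<delta> * s0 / 4)"
        using \<open>s0 > 0\<close> CN by (simp add: power2_eq_square algebra_simps)
      also have "\<dots> \<le> 1 * (\<delta> * s0 / 4)"
        using CN assms by (intro mult_right_mono) auto
      finally show ?thesis by simp
    qed
    have "G (t * \<kappa>') / \<kappa>' - G (t * \<kappa>) / \<kappa> = (G (t * \<kappa>') - G (t * \<kappa>)) / \<kappa>' + G (t * \<kappa>) * (\<kappa> - \<kappa>') / (\<kappa> * \<kappa>')"
      using pos by (simp add: field_simps)
    then have "\<bar>G (t * \<kappa>') / \<kappa>' - G (t * \<kappa>) / \<kappa>\<bar> \<le>
        \<bar>(G (t * \<kappa>') - G (t * \<kappa>)) / \<kappa>'\<bar> + \<bar>G (t * \<kappa>) * (\<kappa> - \<kappa>') / (\<kappa> * \<kappa>')\<bar>"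
      by (metis abs_triangle_ineq)
    also have "\<dots> \<le> (\<delta> * s0 / 4) / s0 + B * (\<delta> * s0\<^sup>2 / (2 * (B + 1))) / (s0 * s0)"
    proof (rule add_mono)
      have "\<bar>(G (t * \<kappa>') - G (t * \<kappa>)) / \<kappa>'\<bar> = \<bar>G (t * \<kappa>') - G (t * \<kappa>)\<bar> / \<kappa>'" using pos by simp
      also have "\<dots> \<le> (\<delta> * s0 / 4) / s0" using 1 \<kappa> \<open>s0 > 0\<close> assms by (intro frac_le) auto
      finally show "\<bar>(G (t * \<kappa>') - G (t * \<kappa>)) / \<kappa>'\<bar> \<le> (\<delta> * s0 / 4) / s0" .
      have "\<bar>G (t * \<kappa>) * (\<kappa> - \<kappa>') / (\<kappa> * \<kappa>')\<bar> = \<bar>G (t * \<kappa>)\<bar> * \<bar>\<kappa>' - \<kappa>\<bar> / (\<kappa> * \<kappa>')"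
        using pos by (simp add: abs_mult abs_minus_commute)
      also have "\<dots> \<le> B * (\<delta> * s0\<^sup>2 / (2 * (B + 1))) / (s0 * s0)"
      proof (rule frac_le)
        show "\<bar>G (t * \<kappa>)\<bar> * \<bar>\<kappa>' - \<kappa>\<bar> \<le> B * (\<delta> * s0\<^sup>2 / (2 * (B + 1)))"
          using B[of "t * \<kappa>"] \<kappa> pos B0 by (intro mult_mono) (auto simp: \<eta>_def)
        show "0 \<le> B * (\<delta> * s0\<^sup>2 / (2 * (B + 1)))" using B0 assms by simp
        show "s0 * s0 \<le> \<kappa> * \<kappa>'" using \<kappa> \<open>s0 > 0\<close> by (intro mult_mono) auto
      qed (use \<open>s0 > 0\<close> in simp)
      finally show "\<bar>G (t * \<kappa>) * (\<kappa> - \<kappa>') / (\<kappa> * \<kappa>')\<bar> \<le> B * (\<delta> * s0\<^sup>2 / (2 * (B + 1))) / (s0 * s0)" .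
    qed
    also have "\<dots> = \<delta> / 4 + (B / (B + 1)) * (\<delta> / 2)"
      using \<open>s0 > 0\<close> B0 by (simp add: power2_eq_square)
    also have "\<dots> \<le> \<delta> / 4 + 1 * (\<delta> / 2)"
      using B0 assms by (intro add_left_mono mult_right_mono) auto
    finally show "\<bar>G (t * \<kappa>') / \<kappa>' - G (t * \<kappa>) / \<kappa>\<bar> \<le> \<delta>" using assms by simp
  qed
qed

lemma half_line_primitive:
  assumes "g \<in> L1_Linf {0..}"
  obtains G C B b where "is_primitive (\<lambda>t. if t \<ge> 0 then g t else 0) G" "G 0 = 0"
    "\<And>s t. \<bar>G s - G t\<bar> \<le> C * \<bar>s - t\<bar>" "\<And>t. t \<ge> 0 \<Longrightarrow> \<bar>G t\<bar> \<le> B" "(G \<longlongrightarrow> b) at_top"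
proof -
  have "(\<lambda>t. if t \<ge> 0 then g t else 0) \<in> L1_Linf UNIV" using assms by (simp add: L1_Linf_half_line_iff)
  then obtain G b where G: "is_primitive (\<lambda>t. if t \<ge> 0 then g t else 0) G" "G 0 = 0" "(G \<longlongrightarrow> b) at_top"
    by (rule L1_Linf_primitive) blast
  obtain C where "\<And>s t. \<bar>G s - G t\<bar> \<le> C * \<bar>s - t\<bar>" using G(1) unfolding is_primitive_def by blast
  moreover have "bounded (G ` {0..})"
    using bounded_half_line[OF is_primitive_continuous_on[OF G(1)] G(3)] .
  then obtain B where "\<And>t. t \<ge> 0 \<Longrightarrow> \<bar>G t\<bar> \<le> B" by (auto simp: bounded_iff)
  ultimately show ?thesis using that G by blast
qed

text \<open>Below the critical rate solutions blow up: between \<open>\<kappa>1\<close> and the critical rate by minimality of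
  the latter, and below \<open>\<kappa>1\<close> because survival would carry over to \<open>\<kappa>1\<close>.\<close>

theorem critical_rate_exists:
  assumes g: "g \<in> L1_Linf {0..}" and "\<kappa>1 > 0" "case_C lam (forcing \<alpha>e g \<kappa>1)"
  obtains \<kappa> where "\<kappa> > 0" "\<And>\<kappa>'. \<kappa>' > \<kappa> \<Longrightarrow> case_A lam (forcing \<alpha>e g \<kappa>')" "case_B lam (forcing \<alpha>e g \<kappa>)"
    "\<And>\<kappa>'. 0 < \<kappa>' \<Longrightarrow> \<kappa>' < \<kappa> \<Longrightarrow> case_C lam (forcing \<alpha>e g \<kappa>')"
proof -
  define g1 where "g1 t = (if t \<ge> 0 then g t else 0)" for t
  obtain G C B b where G: "is_primitive g1 G" "G 0 = 0"
    "\<And>s t. \<bar>G s - G t\<bar> \<le> C * \<bar>s - t\<bar>" "\<And>t. t \<ge> 0 \<Longrightarrow> \<bar>G t\<bar> \<le> B" "(G \<longlongrightarrow> b) at_top"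
    unfolding g1_def[abs_def] by (rule half_line_primitive[OF g]) blast
  define K where "K \<kappa> t = G (t * \<kappa>) / \<kappa>" for \<kappa> t
  define F where "F \<kappa> = glue (K \<kappa>)" for \<kappa>
  have K: "is_primitive (\<lambda>t. g1 (t * \<kappa>)) (K \<kappa>)" "K \<kappa> 0 = 0" "(K \<kappa> \<longlongrightarrow> b / \<kappa>) at_top" if "\<kappa> > 0" for \<kappa>
  proof -
    show "is_primitive (\<lambda>t. g1 (t * \<kappa>)) (K \<kappa>)"
      unfolding K_def[abs_def] by (rule is_primitive_time_scaled[OF G(1) that])
    show "K \<kappa> 0 = 0" by (simp add: K_def G(2))
    have "filterlim (\<lambda>t. t * \<kappa>) at_top at_top"
      using that by (intro filterlim_at_top_mult_tendsto_pos[OF tendsto_const _ filterlim_ident])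
    then show "(K \<kappa> \<longlongrightarrow> b / \<kappa>) at_top"
      unfolding K_def[abs_def] using that
      by (intro tendsto_divide filterlim_compose[OF G(5)] tendsto_const) auto
  qed
  have forcing: "forcing \<alpha>e g \<kappa> = (\<lambda>t. if t < 0 then \<alpha>e t else g1 (t * \<kappa>))" if "\<kappa> > 0" for \<kappa>
    using that by (auto simp: forcing_def g1_def fun_eq_iff zero_le_mult_iff)
  have field: "riccati_field lam (F \<kappa>)" if "\<kappa> > 0" for \<kappa>
    unfolding F_def using K[OF that] by (rule glue_field)
  have F0: "F \<kappa> 0 = 0" if "\<kappa> > 0" for \<kappa> using K(2)[OF that] by (simp add: F_def glue_def)
  note cases = cases_of_future[OF K, folded F_def]
  have faster: "\<exists>x. riccati_sol lam (F \<kappa>') {0..} x \<and> x 0 = \<mu> \<and> (x \<longlongrightarrow> sqrt lam) at_top"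
    if surv: "survives lam (F \<kappa>) \<mu>" and that: "0 < \<kappa>" "\<kappa> < \<kappa>'" for \<kappa> \<kappa>'
  proof -
    obtain x where x: "riccati_sol lam (F \<kappa>) {0..} x" "x 0 = \<mu>" using surv by (auto simp: survives_def)
    have eq: "F \<kappa>' t = F \<kappa> (\<kappa>' / \<kappa> * t) / (\<kappa>' / \<kappa>)" if "t \<ge> 0" for t
    proof -
      have "\<kappa>' / \<kappa> * t \<ge> 0" using that \<open>0 < \<kappa>\<close> \<open>\<kappa> < \<kappa>'\<close> by simp
      moreover have "\<kappa>' / \<kappa> * t * \<kappa> = t * \<kappa>'" using \<open>0 < \<kappa>\<close> by simp
      ultimately show ?thesis using that \<open>0 < \<kappa>\<close> by (simp add: F_def glue_def K_def not_less mult.commute)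
    qed
    have "\<kappa>' / \<kappa> > 1" using that by simp
    then show ?thesis
      using survives_faster[OF field[OF that(1)] field _ mu_pos eq x] that by fastforce
  qed
  have no1: "\<not> survives lam (F \<kappa>1) \<mu>" using cases(4)[OF \<open>\<kappa>1 > 0\<close>] forcing assms by fastforce
  interpret P: riccati_field lam A by (rule past_field)
  \<comment> \<open>for fast rates the total mass of the forcing is so small that the solution is trapped\<close>
  define \<kappa>2 where "\<kappa>2 = max \<kappa>1 (B / P.c + 1)"
  have \<kappa>2: "\<kappa>2 > 0" "\<kappa>1 \<le> \<kappa>2" using \<open>\<kappa>1 > 0\<close> by (auto simp: \<kappa>2_def)
  have surv2: "survives lam (F \<kappa>2) \<mu>"
  proof -
    interpret F2: riccati_field lam "F \<kappa>2" by (rule field[OF \<kappa>2(1)])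
    have "B / P.c < \<kappa>2" by (simp add: \<kappa>2_def less_max_iff_disj)
    then have "B < P.c * \<kappa>2" using P.c_pos by (simp add: field_simps)
    have "\<mu> \<in> F2.forward_set 0"
    proof (rule F2.forward_trap[where l = 0])
      fix t :: real assume "t \<ge> 0"
      have "\<bar>F \<kappa>2 t\<bar> = \<bar>G (t * \<kappa>2)\<bar> / \<kappa>2" using \<open>t \<ge> 0\<close> \<kappa>2(1) by (simp add: F_def glue_def K_def)
      also have "\<dots> \<le> B / \<kappa>2" using G(4)[of "t * \<kappa>2"] \<open>t \<ge> 0\<close> \<kappa>2(1) by (intro divide_right_mono) auto
      also have "\<dots> < P.c" using \<open>B < P.c * \<kappa>2\<close> \<kappa>2(1) by (simp add: field_simps)
      finally show "\<bar>F \<kappa>2 t - 0\<bar> < P.c" by simp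
    qed (use mu_pos F0[OF \<kappa>2(1)] in simp)
    then show ?thesis by (simp add: F2.survives_iff)
  qed
  have pos: "\<kappa> > 0" if "\<kappa> \<in> {\<kappa>1..\<kappa>2}" for \<kappa> using that \<open>\<kappa>1 > 0\<close> by simp
  have cont: "\<exists>\<eta>>0. \<forall>\<kappa>'\<in>{\<kappa>1..\<kappa>2}. \<bar>\<kappa>' - \<kappa>\<bar> < \<eta> \<longrightarrow> (\<forall>t\<ge>0. \<bar>F \<kappa>' t - F \<kappa> t\<bar> \<le> \<delta>)"
    if \<kappa>: "\<kappa> \<in> {\<kappa>1..\<kappa>2}" and "\<delta> > 0" for \<kappa> \<delta>
  proof -
    have "\<kappa> \<ge> \<kappa>1" using \<kappa> by simp
    from time_scaling_continuous[OF G(3,4,5) \<open>\<kappa>1 > 0\<close> this \<open>\<delta> > 0\<close>]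
    obtain \<eta> where "\<eta> > 0" "\<forall>\<kappa>'\<ge>\<kappa>1. \<bar>\<kappa>' - \<kappa>\<bar> < \<eta> \<longrightarrow>
        (\<forall>t\<ge>0. \<bar>G (t * \<kappa>') / \<kappa>' - G (t * \<kappa>) / \<kappa>\<bar> \<le> \<delta>)" by blast
    then show ?thesis using \<kappa> by (intro exI[of _ \<eta>]) (simp add: F_def glue_def K_def)
  qed
  obtain \<kappa> x where \<kappa>: "\<kappa>1 < \<kappa>" "\<kappa> \<le> \<kappa>2" "riccati_sol lam (F \<kappa>) {0..} x" "x 0 = \<mu>"
      "(x \<longlongrightarrow> - sqrt lam) at_top" "\<forall>\<kappa>'\<in>{\<kappa>1..<\<kappa>}. \<not> survives lam (F \<kappa>') \<mu>"
    by (rule critical_parameter[of \<kappa>1 \<kappa>2 lam F \<mu>, OF field[OF pos] F0[OF pos] cont \<kappa>2(2) no1 surv2]) blast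
  have "\<kappa> > 0" using \<kappa>(1) \<open>\<kappa>1 > 0\<close> by simp
  show ?thesis
  proof (rule that[OF \<open>\<kappa> > 0\<close>])
    show "case_B lam (forcing \<alpha>e g \<kappa>)"
      unfolding forcing[OF \<open>\<kappa> > 0\<close>] by (rule cases(3)[OF \<open>\<kappa> > 0\<close> \<open>\<kappa> > 0\<close> \<open>\<kappa> > 0\<close> \<kappa>(3-5)])
    have surv: "survives lam (F \<kappa>) \<mu>" using \<kappa>(3,4) by (auto simp: survives_def)
    show "case_A lam (forcing \<alpha>e g \<kappa>')" if "\<kappa>' > \<kappa>" for \<kappa>'
    proof -
      have "\<kappa>' > 0" using that \<open>\<kappa> > 0\<close> by simp
      then show ?thesis using faster[OF surv \<open>\<kappa> > 0\<close> that] cases(2)[of \<kappa>'] forcing[of \<kappa>'] by auto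
    qed
    show "case_C lam (forcing \<alpha>e g \<kappa>')" if \<kappa>': "0 < \<kappa>'" "\<kappa>' < \<kappa>" for \<kappa>'
    proof -
      have "\<not> survives lam (F \<kappa>') \<mu>"
      proof (cases "\<kappa>1 \<le> \<kappa>'")
        case False
        then show ?thesis using faster[of \<kappa>' \<kappa>1] \<kappa>'(1) no1 by (auto simp: survives_def)
      qed (use \<kappa>(6) \<kappa>'(2) in simp)
      then show ?thesis using cases(1)[of \<kappa>'] forcing[of \<kappa>'] \<kappa>'(1) by auto
    qed
  qed
qed

text \<open>The three cases exclude each other, so the critical rate is unique. If no rate is in Case C, then the
  rate function is 1 by definition, and the three properties are immediate.\<close>

lemma rate_function_properties:
  assumes g: "g \<in> L1_Linf {0..}"
  shows "rate_function lam \<alpha>e g > 0"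
    and "\<not> case_C lam (forcing \<alpha>e g (rate_function lam \<alpha>e g))"
    and "case_B lam (forcing \<alpha>e g 1) \<Longrightarrow> rate_function lam \<alpha>e g = 1"
proof -
  have *: "rate_function lam \<alpha>e g > 0 \<and> \<not> case_C lam (forcing \<alpha>e g (rate_function lam \<alpha>e g)) \<and>
    (case_B lam (forcing \<alpha>e g 1) \<longrightarrow> rate_function lam \<alpha>e g = 1)"
  proof (cases "\<exists>\<kappa>1>0. case_C lam (forcing \<alpha>e g \<kappa>1)")
    case True
    then obtain \<kappa> where \<kappa>: "\<kappa> > 0" "\<And>\<kappa>'. \<kappa>' > \<kappa> \<Longrightarrow> case_A lam (forcing \<alpha>e g \<kappa>')" "case_B lam (forcing \<alpha>e g \<kappa>)"
      "\<And>\<kappa>'. 0 < \<kappa>' \<Longrightarrow> \<kappa>' < \<kappa> \<Longrightarrow> case_C lam (forcing \<alpha>e g \<kappa>')"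
      using critical_rate_exists[OF g] by metis
    have uniq: "\<kappa>' = \<kappa>" if "\<kappa>' > 0" "case_B lam (forcing \<alpha>e g \<kappa>')" for \<kappa>'
      using \<kappa>(2)[of \<kappa>'] \<kappa>(4)[of \<kappa>'] that case_A_not_B case_C_not_B by (meson linorder_cases)
    have "rate_function lam \<alpha>e g = \<kappa>"
      unfolding rate_function_def if_P[OF True] using \<kappa> uniq by (intro the_equality) blast+
    then show ?thesis using \<kappa>(1,3) case_C_not_B uniq[of 1] by auto
  next
    case False
    then have "rate_function lam \<alpha>e g = 1" unfolding rate_function_def by (rule if_not_P)
    then show ?thesis using False by (metis zero_less_one)
  qed
  then show "rate_function lam \<alpha>e g > 0"
    and "\<not> case_C lam (forcing \<alpha>e g (rate_function lam \<alpha>e g))"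
    and "case_B lam (forcing \<alpha>e g 1) \<Longrightarrow> rate_function lam \<alpha>e g = 1" by auto
qed

end


section \<open>Regularised and optimal control problems\<close>

lemma solves_on_cong:
  assumes "\<And>t x. t \<in> I \<Longrightarrow> f t x = f' t x"
  shows "solves_on f I x \<longleftrightarrow> solves_on f' I x"
proof -
  have "(AE t in lebesgue_on I. (x has_real_derivative f t (x t)) (at t within I)) \<longleftrightarrow>
    (AE t in lebesgue_on I. (x has_real_derivative f' t (x t)) (at t within I))"
    using assms by (intro AE_cong) (simp add: space_restrict_space)
  then show ?thesis by (simp add: solves_on_def)
qed

text \<open>Admissibility of a control is survival for the forcing \<open>\<alpha> - u\<close>; the lower bound is automatic.\<close>

lemma ocp_admissible_iff_survives:
  assumes "riccati_field lam H" "is_primitive h H"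
    and h: "\<And>t. t \<ge> 0 \<Longrightarrow> h t = \<alpha> t - u t"
  shows "ocp_admissible lam \<mu> \<alpha> u \<longleftrightarrow> u \<in> L1_Linf {0..} \<and> survives lam H \<mu>"
proof -
  interpret riccati_field lam H by fact
  have eq: "solves_on (\<lambda>t x. lam - \<alpha> t + u t - x\<^sup>2) {0..} x \<longleftrightarrow> sol {0..} x" for x
    unfolding solves_on_riccati_iff[OF assms(2), symmetric]
    by (rule solves_on_cong) (simp add: riccati_def h)
  have "\<exists>M::nat. \<forall>t\<ge>0. x t \<ge> - real M" if x: "sol {0..} x" for x
  proof -
    obtain B where "\<And>t. t \<ge> 0 \<Longrightarrow> \<bar>x t\<bar> \<le> B"
      using sol_bounded_top[OF x] by (auto simp: bounded_iff)
    moreover obtain M :: nat where "B \<le> real M" using real_arch_simple by blast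
    ultimately have "\<forall>t\<ge>0. x t \<ge> - real M" by (meson abs_le_D2 minus_le_iff order_trans)
    then show ?thesis by blast
  qed
  then show ?thesis by (auto simp: ocp_admissible_def survives_def eq)
qed

context fixed_past
begin

lemma feedback_admissible:
  assumes g: "g \<in> L1_Linf {0..}" and \<alpha>: "\<alpha> \<in> L1_Linf {0..}"
  shows "ocp_admissible lam \<mu> \<alpha> (\<lambda>t. \<alpha> t - g (t * rate_function lam \<alpha>e g))"
proof -
  define \<kappa> where "\<kappa> = rate_function lam \<alpha>e g"
  have \<kappa>: "\<kappa> > 0" "\<not> case_C lam (forcing \<alpha>e g \<kappa>)" using rate_function_properties[OF g] by (auto simp: \<kappa>_def)
  have gs: "(\<lambda>t. g (t * \<kappa>)) \<in> L1_Linf {0..}" by (rule L1_Linf_half_line_time_scaled[OF g \<kappa>(1)])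
  obtain K C B b where K: "is_primitive (\<lambda>t. if t \<ge> 0 then g (t * \<kappa>) else 0) K" "K 0 = 0" "(K \<longlongrightarrow> b) at_top"
    by (rule half_line_primitive[OF gs]) blast
  have h: "(\<lambda>t. if t < 0 then \<alpha>e t else if t \<ge> 0 then g (t * \<kappa>) else 0) = forcing \<alpha>e g \<kappa>"
    by (auto simp: forcing_def)
  have "survives lam (glue K) \<mu>" using cases_of_future(1)[OF K] \<kappa>(2) unfolding h by blast
  moreover have "is_primitive (forcing \<alpha>e g \<kappa>) (glue K)"
    using is_primitive_glue[OF past_prim K(1) past_0 K(2)] unfolding h glue_def[abs_def] .
  moreover have "(\<lambda>t. \<alpha> t - g (t * \<kappa>)) \<in> L1_Linf {0..}"
    using L1_Linf_half_line_diff[OF \<alpha> gs, of 1] by simp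
  ultimately show ?thesis
    unfolding \<kappa>_def[symmetric]
    using ocp_admissible_iff_survives[OF glue_field[OF K], of "forcing \<alpha>e g \<kappa>" \<alpha> "\<lambda>t. \<alpha> t - g (t * \<kappa>)" \<mu>]
    by (simp add: forcing_def)
qed

text \<open>Scaling an admissible control down to the critical size makes the resulting equation a
  Case B equation, so that the corresponding rate is 1.\<close>

lemma scaled_control:
  assumes \<alpha>: "\<alpha> \<in> L1_Linf {0..}" and ext: "\<And>t. t \<ge> 0 \<Longrightarrow> \<alpha>e t = \<alpha> t" and limA: "(A \<longlongrightarrow> a) at_top"
    and no: "\<not> survives lam A \<mu>" and u: "ocp_admissible lam \<mu> \<alpha> u"
  obtains s where "0 < s" "s \<le> 1" "(\<lambda>t. \<alpha> t - s * u t) \<in> L1_Linf {0..}"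
    "rate_function lam \<alpha>e (\<lambda>t. \<alpha> t - s * u t) = 1"
proof -
  have uL: "u \<in> L1_Linf {0..}" using u by (simp add: ocp_admissible_def)
  obtain U C B b where U: "is_primitive (\<lambda>t. if t \<ge> 0 then u t else 0) U" "U 0 = 0"
    "\<And>t. t \<ge> 0 \<Longrightarrow> \<bar>U t\<bar> \<le> B" "(U \<longlongrightarrow> b) at_top"
    by (rule half_line_primitive[OF uL]) blast
  have B0: "B \<ge> 0" using U(3)[of 0] by simp
  define K where "K s t = A t - s * U t" for s t
  define k where "k s t = \<alpha>e t - s * (if t \<ge> 0 then u t else 0)" for s t
  have K: "is_primitive (k s) (K s)" "K s 0 = 0" "(K s \<longlongrightarrow> a - s * b) at_top" for s
  proof -
    show "is_primitive (k s) (K s)"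
      unfolding k_def[abs_def] K_def[abs_def] by (rule is_primitive_diff_scaled[OF past_prim U(1)])
    show "K s 0 = 0" by (simp add: K_def past_0 U(2))
    show "(K s \<longlongrightarrow> a - s * b) at_top"
      unfolding K_def[abs_def] by (intro tendsto_diff limA tendsto_mult_left U(4))
  qed
  define F where "F s = glue (K s)" for s
  have field: "riccati_field lam (F s)" for s unfolding F_def by (rule glue_field[OF K])
  have F0: "F s 0 = 0" for s by (simp add: F_def glue_def K(2))
  have h: "(\<lambda>t. if t < 0 then \<alpha>e t else k s t) = forcing \<alpha>e (\<lambda>t. \<alpha> t - s * u t) 1" for s
    using ext by (auto simp: forcing_def k_def fun_eq_iff)
  have primF: "is_primitive (forcing \<alpha>e (\<lambda>t. \<alpha> t - s * u t) 1) (F s)" for s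
    unfolding h[symmetric] F_def glue_def[abs_def] by (rule is_primitive_glue[OF past_prim K(1) past_0 K(2)])
  have "F 0 = A" by (auto simp: F_def glue_def K_def)
  then have no0: "\<not> survives lam (F 0) \<mu>" using no by simp
  have surv1: "survives lam (F 1) \<mu>"
    using ocp_admissible_iff_survives[OF field primF[of 1], of \<alpha> u \<mu>] u by (simp add: forcing_def)
  have cont: "\<exists>\<eta>>0. \<forall>s'\<in>{0..1}. \<bar>s' - s\<bar> < \<eta> \<longrightarrow> (\<forall>t\<ge>0. \<bar>F s' t - F s t\<bar> \<le> \<delta>)"
    if "\<delta> > 0" for s \<delta>
  proof (intro exI[of _ "\<delta> / (B + 1)"] conjI ballI impI allI)
    show "\<delta> / (B + 1) > 0" using that B0 by simp
    fix s' t :: real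
    assume s': "\<bar>s' - s\<bar> < \<delta> / (B + 1)" and t: "t \<ge> 0"
    have "F s' t - F s t = (s - s') * U t" using t by (simp add: F_def glue_def K_def algebra_simps)
    then have "\<bar>F s' t - F s t\<bar> = \<bar>s' - s\<bar> * \<bar>U t\<bar>" by (simp add: abs_mult abs_minus_commute)
    also have "\<dots> \<le> (\<delta> / (B + 1)) * (B + 1)"
      using s' U(3)[OF t] B0 that by (intro mult_mono) auto
    finally show "\<bar>F s' t - F s t\<bar> \<le> \<delta>" using B0 by simp
  qed
  obtain s x where s: "0 < s" "s \<le> 1" "riccati_sol lam (F s) {0..} x" "x 0 = \<mu>" "(x \<longlongrightarrow> - sqrt lam) at_top"
    by (rule critical_parameter[of 0 1 lam F \<mu>, OF field F0 cont zero_le_one no0 surv1]) blast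
  have "case_B lam (forcing \<alpha>e (\<lambda>t. \<alpha> t - s * u t) 1)"
    using cases_of_future(3)[OF K[of s]] s(3-5) unfolding h F_def by blast
  moreover have L: "(\<lambda>t. \<alpha> t - s * u t) \<in> L1_Linf {0..}" by (rule L1_Linf_half_line_diff[OF \<alpha> uL])
  ultimately have "rate_function lam \<alpha>e (\<lambda>t. \<alpha> t - s * u t) = 1" using rate_function_properties(3) by blast
  then show ?thesis using that s(1,2) L by blast
qed

end

theorem theorem4p3:
  fixes lam \<mu> :: real and \<alpha> \<alpha>e g :: "real \<Rightarrow> real"
  assumes "lam > 0" and "\<mu> > 0"
    and "\<alpha> \<in> L1_Linf {0..}"
    and "\<exists>T>0. \<exists>x. solves_on (riccati lam \<alpha>) {0..<T} x \<and> x 0 = \<mu> \<and> filterlim x at_bot (at_left T)"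
    and "admissible_extension lam \<mu> \<alpha> \<alpha>e"
    and "g \<in> L1_Linf {0..}"
  shows "rcp_optimal lam \<alpha> \<alpha>e g \<longleftrightarrow>
    ocp_optimal lam \<mu> \<alpha> (\<lambda>t. \<alpha> t - g (t * rate_function lam \<alpha>e g))"
proof -
  have \<alpha>e: "\<alpha>e \<in> L1_Linf UNIV" and ext: "\<And>t. t \<ge> 0 \<Longrightarrow> \<alpha>e t = \<alpha> t"
    using assms(5) unfolding admissible_extension_def by blast+
  obtain I a where att: "pullback_attractor (riccati lam \<alpha>e) I a" "0 \<in> I" "a 0 = \<mu>"
    using assms(5) unfolding admissible_extension_def by blast
  obtain A l1 l2 where A: "is_primitive \<alpha>e A" "A 0 = 0" "(A \<longlongrightarrow> l1) at_bot" "(A \<longlongrightarrow> l2) at_top"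
    using L1_Linf_primitive[OF \<alpha>e] by blast
  interpret P: riccati_field lam A
    using assms(1) is_primitive_continuous_on[OF A(1)] A(3,4) by unfold_locales blast+
  interpret P: riccati_forced lam A \<alpha>e \<mu> by unfold_locales (rule A(1))
  have "x0 \<in> P.backward_set 0 \<longleftrightarrow> x0 \<le> \<mu>" for x0
    using att unfolding pullback_attractor_def P.bounded_at_minus_infinity_iff by blast
  then have bwd: "P.backward_set 0 = {..\<mu>}" by blast
  interpret fixed_past lam \<mu> \<alpha>e A
    by unfold_locales (use P.riccati_field_axioms assms(2) A(1,2) bwd in auto)
  have no: "\<not> survives lam A \<mu>"
  proof
    assume "survives lam A \<mu>"
    then obtain y where y: "P.sol {0..} y" "y 0 = \<mu>" by (auto simp: survives_def)
    obtain T x where T: "T > 0" and x: "solves_on (riccati lam \<alpha>) {0..<T} x" "x 0 = \<mu>" "filterlim x at_bot (at_left T)"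
      using assms(4) by blast
    have "solves_on (riccati lam \<alpha>e) {0..<T} x"
      using x(1) solves_on_cong[of "{0..<T}" "riccati lam \<alpha>" "riccati lam \<alpha>e" x] ext by (simp add: riccati_def)
    then have solx: "P.sol {0..<T} x" by (simp add: P.solves_iff)
    obtain B where B: "\<And>t. t \<ge> 0 \<Longrightarrow> \<bar>y t\<bar> \<le> B" using P.sol_bounded_top[OF y(1)] by (auto simp: bounded_iff)
    have "eventually (\<lambda>t. x t < - B) (at_left T)" using x(3) by (simp add: filterlim_at_bot_dense)
    moreover have "eventually (\<lambda>t. t \<in> {0<..<T}) (at_left T)" using T by (rule eventually_at_left_real)
    ultimately have "eventually (\<lambda>t. False) (at_left T)"
    proof eventually_elim
      case (elim t)
      have "x t = y t" by (rule P.sol_unique[OF solx y(1), of 0]) (use elim x(2) y(2) T in auto)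
      then show False using elim B[of t] by auto
    qed
    then show False by simp
  qed
  \<comment> \<open>the cost of a control, and the control which belongs to \<open>g\<close>\<close>
  define J where "J u = (\<integral>t. (u t)\<^sup>2 \<partial>lebesgue_on {0..})" for u :: "real \<Rightarrow> real"
  define feedback where "feedback g = (\<lambda>t. \<alpha> t - g (t * rate_function lam \<alpha>e g))" for g
  have rcp: "rcp_optimal lam \<alpha> \<alpha>e g \<longleftrightarrow> g \<in> L1_Linf {0..} \<and> (\<forall>g'\<in>L1_Linf {0..}. J (feedback g) \<le> J (feedback g'))"
    by (auto simp: rcp_optimal_def is_arg_min_def J_def feedback_def not_less)
  have ocp: "ocp_optimal lam \<mu> \<alpha> v \<longleftrightarrow> ocp_admissible lam \<mu> \<alpha> v \<and> (\<forall>u. ocp_admissible lam \<mu> \<alpha> u \<longrightarrow> J v \<le> J u)" for v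
    by (auto simp: ocp_optimal_def is_arg_min_def J_def not_less)
  have adm: "ocp_admissible lam \<mu> \<alpha> (feedback g')" if "g' \<in> L1_Linf {0..}" for g'
    unfolding feedback_def by (rule feedback_admissible[OF that assms(3)])
  have better: "\<exists>g'\<in>L1_Linf {0..}. J (feedback g') \<le> J u" if u: "ocp_admissible lam \<mu> \<alpha> u" for u
  proof -
    obtain s where s: "0 < s" "s \<le> 1" "(\<lambda>t. \<alpha> t - s * u t) \<in> L1_Linf {0..}"
      "rate_function lam \<alpha>e (\<lambda>t. \<alpha> t - s * u t) = 1"
      by (rule scaled_control[OF assms(3) ext A(4) no u]) blast
    have "J (feedback (\<lambda>t. \<alpha> t - s * u t)) = s\<^sup>2 * J u"
      by (simp add: J_def feedback_def s(4) power_mult_distrib)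
    also have "\<dots> \<le> 1 * J u"
      using s(1,2) by (intro mult_right_mono) (auto simp: J_def power_le_one)
    finally show ?thesis using s(3) by (intro bexI[of _ "\<lambda>t. \<alpha> t - s * u t"]) auto
  qed
  have "rcp_optimal lam \<alpha> \<alpha>e g \<longleftrightarrow> ocp_optimal lam \<mu> \<alpha> (feedback g)"
  proof
    assume "rcp_optimal lam \<alpha> \<alpha>e g"
    then show "ocp_optimal lam \<mu> \<alpha> (feedback g)"
      unfolding rcp ocp using adm better by (meson order_trans)
  next
    assume "ocp_optimal lam \<mu> \<alpha> (feedback g)"
    then show "rcp_optimal lam \<alpha> \<alpha>e g" unfolding rcp ocp using adm assms(6) by blast
  qed
  then show ?thesis by (simp add: feedback_def)
qed

end
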